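(* Let $(X,|\cdot|_X)$ be a Banach space $X$ of functions on $\Omega$ equipped with a semi-norm $|\cdot|_X$ such that $\mathcal H^s(\Omega)\subset X$ and, for some constant $\Lambda_X$, $|v|_X\le\Lambda_X\|v\|_{\mathcal H^s(\Omega)}$ for all $v\in\mathcal H^s(\Omega)$. Assume $u_0\in X\cap C(\Omega)$ and that the observation matrix $G=(\phi_j(x_i))_{i,j=1}^m$ is invertible. Let $\varepsilon>0$ and choose $\varepsilon_1,\varepsilon_2>0$ with $\varepsilon_2\le\bar\varepsilon_2$ and $$\varepsilon_1+m\|G^{-1}\|_{\ell_1\to\ell_1}\Lambda_{s,d}C_B\,\varepsilon_2+(C_X+\varepsilon_2)\Big(m\|G^{-1}\|_{\ell_1\to\ell_1}\varepsilon_1+m(\Lambda_{s,d}C_B+\varepsilon_1)\delta\Big)\le\varepsilon,$$ where $C_X:=\max_{1\le j\le m}|\phi_j|_X<\infty$ and $\delta:=\dfrac{m\|G^{-1}\|_{\ell_1\to\ell_1}^2\varepsilon_2}{1-m\|G^{-1}\|_{\ell_1\to\ell_1}\varepsilon_2}$. Then the function $\widehat u^*$ produced by the recovery algorithm described in the context with tolerances $\varepsilon_1,\varepsilon_2$ satisfies $$|v-\widehat u^*|_X\le R(\mathcal K_\omega)_X+\varepsilon\qquad\text{for all }v\in\mathcal K_\omega ,$$ that is, $\widehat u^*$ is a near-optimal recovery in $(X,|\cdot|_X)$ for functions in $\mathcal K_\omega$.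
   Context: Setting. $n\in\{2,3\}$; $\Omega\subset\mathbb R^n$ is a bounded polygonal/polyhedral Lipschitz domain, $\Gamma=\partial\Omega$, $\frac12<s<\frac32$, $d>0$, $C_B>0$. $H^s(\Gamma)$ is the Sobolev–Slobodeckij space on $\Gamma$. $\mathcal H^s(\Omega)$ is the Hilbert space of harmonic functions $v$ on $\Omega$ with trace $v|_\Gamma\in H^s(\Gamma)$, with $\langle v,w\rangle_{\mathcal H^s(\Omega)}=\langle v|_\Gamma,w|_\Gamma\rangle_{H^s(\Gamma)}$. The right-hand side $f\in H^{-1}(\Omega)$ is given and $u_0\in H_0^1(\Omega)$ solves $-\Delta u_0=f$. For $g\in H^{1/2}(\Gamma)$, $u(g)\in H^1(\Omega)$ solves $-\Delta u=f$ in $\Omega$, $u=g$ on $\Gamma$. Measurements and model class. $x_1,\dots,x_m\in\Omega$ satisfy $\operatorname{dist}(x_i,\Gamma)>d$; $\lambda_i(v)=v(x_i)$. $\mathcal K:=\{u(g):g\in H^s(\Gamma),\|g\|_{H^s(\Gamma)}\le C_B\}$ and $\mathcal K_\omega:=\{u\in\mathcal K:u(x_i)=\omega_i,\ i=1,\dots,m\}$, where the data $\omega=(\omega_i)$ are the measurements of some function in $\mathcal K$ (so $\mathcal K_\omega\ne\emptyset$). $\Lambda_{s,d}>0$ is a constant with $\max_i|v(x_i)|\le\Lambda_{s,d}\|v\|_{\mathcal H^s(\Omega)}$ for all $v\in\mathcal H^s(\Omega)$. The Riesz representers $\phi_j\in\mathcal H^s(\Omega)$ are defined by $\langle\phi_j,v\rangle_{\mathcal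 H^s(\Omega)}=v(x_j)$ for all $v\in\mathcal H^s(\Omega)$. Chebyshev radius: $R(Z)_X:=\inf_{v\in X}\sup_{z\in Z}|v-z|_X$ for $Z\subset X$. Threshold. $\bar\varepsilon_2>0$ depends only on $m$ and $\|G^{-1}\|_{\ell_1\to\ell_1}$ and is such that $m\|G^{-1}\|_{\ell_1\to\ell_1}\bar\varepsilon_2<1$; then for $\varepsilon_2\le\bar\varepsilon_2$ every matrix $\widehat G$ with $\|G-\widehat G\|_{\ell_1\to\ell_1}\le m\varepsilon_2$ is invertible with $\|G^{-1}-\widehat G^{-1}\|_{\ell_1\to\ell_1}\le\delta$. Recovery algorithm with tolerances $\varepsilon_1,\varepsilon_2$: (1) take any $\widehat u_0\in X$ (with well-defined values at the $x_i$) such that $|\widehat u_0-u_0|_X+\max_i|\widehat u_0(x_i)-u_0(x_i)|\le\varepsilon_1$ and set $\widehat\omega=(\omega_i-\widehat u_0(x_i))_{i=1}^m$; (2) take any $\widehat\phi_j\in X$ (with well-defined values at the $x_i$), $j=1,\dots,m$, such that $|\widehat\phi_j-\phi_j|_X+\max_i|\widehat\phi_j(x_i)-\phi_j(x_i)|\le\varepsilon_2$; (3) set $\widehat G=(\widehat\phi_j(x_i))_{i,j=1}^m$; (4) set $\widehat U=\widehat G^{-1}\widehat\omega$ (Moore–Penrose pseudo-inverse) and $\widehat u^*_{\mathcal H}=\sum_{i=1}^m\widehat U_i\widehat\phi_i$; (5) output $\widehat u^*=\widehat u_0+\widehat u_{\mathcal H}^*$. *)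

theory Defs
  imports "HOL-Analysis.Analysis"
begin

subsection \<open>Polygonal and polyhedral Lipschitz domains\<close>

definition lipschitz_boundary :: "(real^'n) set \<Rightarrow> bool" where
  "lipschitz_boundary \<Omega> \<longleftrightarrow>
     (\<forall>x \<in> frontier \<Omega>. \<exists>e r L \<zeta>. norm e = 1 \<and> r > 0 \<and> L-lipschitz_on UNIV \<zeta> \<and>
        \<Omega> \<inter> ball x r = {y \<in> ball x r. \<zeta> (y - (y \<bullet> e) *\<^sub>R e) < y \<bullet> e})"

text \<open>The boundary is presented as a finite union of convex \<open>(n-1)\<close>-dimensional polytopes that
  overlap only in lower dimension; a non-convex face is to be subdivided.\<close>

definition facet_decomposition :: "(real^'n) set \<Rightarrow> (real^'n) set set \<Rightarrow> bool" where
  "facet_decomposition \<Omega> F \<longleftrightarrow>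
     finite F \<and> \<Union>F = frontier \<Omega> \<and>
     (\<forall>P \<in> F. polytope P \<and> aff_dim P = int CARD('n) - 1) \<and>
     (\<forall>P \<in> F. \<forall>Q \<in> F. P \<noteq> Q \<longrightarrow> aff_dim (P \<inter> Q) < int CARD('n) - 1)"

definition polyhedral_lipschitz_domain :: "(real^'n) set \<Rightarrow> (real^'n) set set \<Rightarrow> bool" where
  "polyhedral_lipschitz_domain \<Omega> F \<longleftrightarrow>
     open \<Omega> \<and> connected \<Omega> \<and> bounded \<Omega> \<and> \<Omega> \<noteq> {} \<and> lipschitz_boundary \<Omega> \<and>
     facet_decomposition \<Omega> F"

text \<open>A unit normal of a facet; its orientation is arbitrary and is never used.\<close>

definition facet_normal :: "(real^'n) set \<Rightarrow> real^'n" where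
  "facet_normal P = (SOME \<nu>. norm \<nu> = 1 \<and> (\<forall>x \<in> P. \<forall>y \<in> P. (x - y) \<bullet> \<nu> = 0))"

text \<open>The area of a flat set is the volume of the right prism of height one erected on it.\<close>

definition surface_measure :: "(real^'n) set set \<Rightarrow> (real^'n) measure" where
  "surface_measure F = measure_of UNIV (sets borel)
     (\<lambda>A. \<Sum>P\<in>F. emeasure lborel
             {x + t *\<^sub>R facet_normal P | x t. x \<in> A \<inter> P \<and> 0 \<le> t \<and> t \<le> 1})"

text \<open>The component of \<open>w\<close> tangential to the boundary at \<open>x\<close>. The facet containing \<open>x\<close> is unique for
  almost every \<open>x\<close> of the boundary.\<close>

definition tangential_part :: "(real^'n) set set \<Rightarrow> real^'n \<Rightarrow> real^'n \<Rightarrow> real^'n" where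
  "tangential_part F x w =
     (let \<nu> = facet_normal (SOME P. P \<in> F \<and> x \<in> P) in w - (w \<bullet> \<nu>) *\<^sub>R \<nu>)"

subsection \<open>Square integrable functions and Sobolev spaces on the domain\<close>

definition L2 :: "'a measure \<Rightarrow> ('a \<Rightarrow> 'b::euclidean_space) set" where
  "L2 M = {g \<in> borel_measurable M. integrable M (\<lambda>x. (norm (g x))\<^sup>2)}"

definition L2_tendsto ::
    "'a measure \<Rightarrow> (nat \<Rightarrow> 'a \<Rightarrow> 'b::euclidean_space) \<Rightarrow> ('a \<Rightarrow> 'b) \<Rightarrow> bool" where
  "L2_tendsto M g h \<longleftrightarrow> (\<forall>k. g k \<in> L2 M) \<and> h \<in> L2 M \<and>
     (\<lambda>k. \<integral>x. (norm (g k x - h x))\<^sup>2 \<partial>M) \<longlonglongrightarrow> 0"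

definition C1_with_gradient :: "(real^'n \<Rightarrow> real) \<Rightarrow> (real^'n \<Rightarrow> real^'n) \<Rightarrow> bool" where
  "C1_with_gradient \<psi> \<psi>' \<longleftrightarrow> (\<forall>x. GDERIV \<psi> x :> \<psi>' x) \<and> continuous_on UNIV \<psi>'"

definition test_function ::
    "(real^'n) set \<Rightarrow> (real^'n \<Rightarrow> real) \<Rightarrow> (real^'n \<Rightarrow> real^'n) \<Rightarrow> bool" where
  "test_function \<Omega> \<phi> \<phi>' \<longleftrightarrow> C1_with_gradient \<phi> \<phi>' \<and>
     (\<exists>K. compact K \<and> K \<subseteq> \<Omega> \<and> (\<forall>x. x \<notin> K \<longrightarrow> \<phi> x = 0))"

text \<open>\<open>v\<close> belongs to \<open>H\<^sup>1(\<Omega>)\<close> and \<open>p\<close> is its weak gradient.\<close>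

definition has_weak_gradient ::
    "(real^'n) set \<Rightarrow> (real^'n \<Rightarrow> real) \<Rightarrow> (real^'n \<Rightarrow> real^'n) \<Rightarrow> bool" where
  "has_weak_gradient \<Omega> v p \<longleftrightarrow> v \<in> L2 (lebesgue_on \<Omega>) \<and> p \<in> L2 (lebesgue_on \<Omega>) \<and>
     (\<forall>\<phi> \<phi>'. test_function \<Omega> \<phi> \<phi>' \<longrightarrow>
        (\<integral>x. v x *\<^sub>R \<phi>' x \<partial>lebesgue_on \<Omega>) = - (\<integral>x. \<phi> x *\<^sub>R p x \<partial>lebesgue_on \<Omega>))"

definition H1_zero :: "(real^'n) set \<Rightarrow> (real^'n \<Rightarrow> real) set" where
  "H1_zero \<Omega> = {v. \<exists>p \<phi> \<phi>'. has_weak_gradient \<Omega> v p \<and> (\<forall>k. test_function \<Omega> (\<phi> k) (\<phi>' k)) \<and>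
     L2_tendsto (lebesgue_on \<Omega>) \<phi> v \<and> L2_tendsto (lebesgue_on \<Omega>) \<phi>' p}"

text \<open>Bounded linear functionals on \<open>H\<^sub>0\<^sup>1(\<Omega>)\<close>.\<close>

definition H_minus1 :: "(real^'n) set \<Rightarrow> ((real^'n \<Rightarrow> real) \<Rightarrow> real) set" where
  "H_minus1 \<Omega> = {f.
     (\<forall>v \<in> H1_zero \<Omega>. \<forall>w \<in> H1_zero \<Omega>. f (\<lambda>x. v x + w x) = f v + f w) \<and>
     (\<forall>c. \<forall>v \<in> H1_zero \<Omega>. f (\<lambda>x. c * v x) = c * f v) \<and>
     (\<exists>C. \<forall>v \<in> H1_zero \<Omega>. \<forall>p. has_weak_gradient \<Omega> v p \<longrightarrow>
        \<bar>f v\<bar> \<le> C * sqrt ((\<integral>x. (v x)\<^sup>2 \<partial>lebesgue_on \<Omega>) + (\<integral>x. (norm (p x))\<^sup>2 \<partial>lebesgue_on \<Omega>)))}"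

text \<open>\<open>u \<in> H\<^sup>1(\<Omega>)\<close> and \<open>- \<Delta> u = f\<close> in \<open>\<Omega>\<close>.\<close>

definition poisson_solution ::
    "(real^'n) set \<Rightarrow> ((real^'n \<Rightarrow> real) \<Rightarrow> real) \<Rightarrow> (real^'n \<Rightarrow> real) \<Rightarrow> bool" where
  "poisson_solution \<Omega> f u \<longleftrightarrow> (\<exists>p. has_weak_gradient \<Omega> u p \<and>
     (\<forall>v \<in> H1_zero \<Omega>. \<forall>q. has_weak_gradient \<Omega> v q \<longrightarrow>
        (\<integral>x. p x \<bullet> q x \<partial>lebesgue_on \<Omega>) = f v))"

subsection \<open>Traces\<close>

text \<open>The trace is the continuous extension to \<open>H\<^sup>1(\<Omega>)\<close> of the restriction to the boundary of functions
  that are continuously differentiable up to the boundary.\<close>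

definition has_boundary_trace ::
    "(real^'n) set \<Rightarrow> (real^'n) set set \<Rightarrow> (real^'n \<Rightarrow> real) \<Rightarrow> (real^'n \<Rightarrow> real) \<Rightarrow> bool" where
  "has_boundary_trace \<Omega> F v g \<longleftrightarrow> (\<exists>p \<psi> \<psi>'. has_weak_gradient \<Omega> v p \<and>
     (\<forall>k. C1_with_gradient (\<psi> k) (\<psi>' k)) \<and>
     L2_tendsto (lebesgue_on \<Omega>) \<psi> v \<and> L2_tendsto (lebesgue_on \<Omega>) \<psi>' p \<and>
     L2_tendsto (surface_measure F) \<psi> g)"

definition boundary_trace ::
    "(real^'n) set \<Rightarrow> (real^'n) set set \<Rightarrow> (real^'n \<Rightarrow> real) \<Rightarrow> (real^'n \<Rightarrow> real)" where
  "boundary_trace \<Omega> F v = (SOME g. has_boundary_trace \<Omega> F v g)"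

subsection \<open>Sobolev-Slobodeckij spaces on the boundary\<close>

text \<open>\<open>g\<close> belongs to \<open>H\<^sup>1(\<Gamma>)\<close> and \<open>q\<close> is its weak tangential gradient. Restrictions of continuously
  differentiable functions are dense in \<open>H\<^sup>1(\<Gamma>)\<close>, and their tangential gradients are the tangential parts
  of the full gradients. Taking the closure over the whole boundary encodes the absence of jumps
  of \<open>g\<close> across edges.\<close>

definition has_tangential_gradient ::
    "(real^'n) set set \<Rightarrow> (real^'n \<Rightarrow> real) \<Rightarrow> (real^'n \<Rightarrow> real^'n) \<Rightarrow> bool" where
  "has_tangential_gradient F g q \<longleftrightarrow> (\<exists>\<psi> \<psi>'. (\<forall>k. C1_with_gradient (\<psi> k) (\<psi>' k)) \<and>
     L2_tendsto (surface_measure F) \<psi> g \<and>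
     L2_tendsto (surface_measure F) (\<lambda>k x. tangential_part F x (\<psi>' k x)) q)"

definition tangential_gradient ::
    "(real^'n) set set \<Rightarrow> (real^'n \<Rightarrow> real) \<Rightarrow> (real^'n \<Rightarrow> real^'n)" where
  "tangential_gradient F g = (SOME q. has_tangential_gradient F g q)"

text \<open>The exponent is \<open>(n-1) + 2\<sigma>\<close>, with \<open>n-1\<close> the dimension of the boundary.\<close>

definition slobodeckij_integrand ::
    "real \<Rightarrow> (real^'n \<Rightarrow> 'b::euclidean_space) \<Rightarrow> (real^'n \<Rightarrow> 'b) \<Rightarrow> (real^'n) \<times> (real^'n) \<Rightarrow> real" where
  "slobodeckij_integrand \<sigma> g h = (\<lambda>(x, y).
     ((g x - g y) \<bullet> (h x - h y)) / dist x y powr (real CARD('n) - 1 + 2 * \<sigma>))"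

definition slobodeckij_finite ::
    "(real^'n) set set \<Rightarrow> real \<Rightarrow> (real^'n \<Rightarrow> 'b::euclidean_space) \<Rightarrow> bool" where
  "slobodeckij_finite F \<sigma> g \<longleftrightarrow>
     integrable (surface_measure F \<Otimes>\<^sub>M surface_measure F) (slobodeckij_integrand \<sigma> g g)"

definition slobodeckij_form ::
    "(real^'n) set set \<Rightarrow> real \<Rightarrow> (real^'n \<Rightarrow> 'b::euclidean_space) \<Rightarrow> (real^'n \<Rightarrow> 'b) \<Rightarrow> real" where
  "slobodeckij_form F \<sigma> g h =
     integral\<^sup>L (surface_measure F \<Otimes>\<^sub>M surface_measure F) (slobodeckij_integrand \<sigma> g h)"

text \<open>\<open>H\<^sup>s(\<Gamma>)\<close> and its inner product, for \<open>0 < s < 3/2\<close>. In this range no compatibility condition on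
  the tangential gradient arises at edges beyond finiteness of its Slobodeckij seminorm.\<close>

definition Hs_boundary :: "(real^'n) set set \<Rightarrow> real \<Rightarrow> (real^'n \<Rightarrow> real) set" where
  "Hs_boundary F s = {g. g \<in> L2 (surface_measure F) \<and>
     (if s < 1 then slobodeckij_finite F s g
      else \<exists>q. has_tangential_gradient F g q \<and> (s > 1 \<longrightarrow> slobodeckij_finite F (s - 1) q))}"

definition Hs_boundary_inner ::
    "(real^'n) set set \<Rightarrow> real \<Rightarrow> (real^'n \<Rightarrow> real) \<Rightarrow> (real^'n \<Rightarrow> real) \<Rightarrow> real" where
  "Hs_boundary_inner F s g h =
     (\<integral>x. g x * h x \<partial>surface_measure F) +
     (if s < 1 then slobodeckij_form F s g h
      else (\<integral>x. tangential_gradient F g x \<bullet> tangential_gradient F h x \<partial>surface_measure F) +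
           (if s > 1
            then slobodeckij_form F (s - 1) (tangential_gradient F g) (tangential_gradient F h)
            else 0))"

definition Hs_boundary_norm :: "(real^'n) set set \<Rightarrow> real \<Rightarrow> (real^'n \<Rightarrow> real) \<Rightarrow> real" where
  "Hs_boundary_norm F s g = sqrt (Hs_boundary_inner F s g g)"

subsection \<open>Harmonic functions with trace in \<open>H\<^sup>s(\<Gamma>)\<close>, and the model class\<close>

text \<open>Harmonicity is \<open>- \<Delta> v = 0\<close> in the weak sense used for all boundary value problems here. Such a \<open>v\<close>
  is represented by the function that is continuous on \<open>\<Omega>\<close>, which gives meaning to its point values.\<close>

definition harmonic_Hs ::
    "(real^'n) set \<Rightarrow> (real^'n) set set \<Rightarrow> real \<Rightarrow> (real^'n \<Rightarrow> real) set" where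
  "harmonic_Hs \<Omega> F s = {v. continuous_on \<Omega> v \<and> poisson_solution \<Omega> (\<lambda>_. 0) v \<and>
     (\<exists>g \<in> Hs_boundary F s. has_boundary_trace \<Omega> F v g)}"

definition harmonic_inner ::
    "(real^'n) set \<Rightarrow> (real^'n) set set \<Rightarrow> real \<Rightarrow> (real^'n \<Rightarrow> real) \<Rightarrow> (real^'n \<Rightarrow> real) \<Rightarrow> real" where
  "harmonic_inner \<Omega> F s v w =
     Hs_boundary_inner F s (boundary_trace \<Omega> F v) (boundary_trace \<Omega> F w)"

definition harmonic_norm ::
    "(real^'n) set \<Rightarrow> (real^'n) set set \<Rightarrow> real \<Rightarrow> (real^'n \<Rightarrow> real) \<Rightarrow> real" where
  "harmonic_norm \<Omega> F s v = sqrt (harmonic_inner \<Omega> F s v v)"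

definition riesz_representer ::
    "(real^'n) set \<Rightarrow> (real^'n) set set \<Rightarrow> real \<Rightarrow> real^'n \<Rightarrow> (real^'n \<Rightarrow> real) \<Rightarrow> bool" where
  "riesz_representer \<Omega> F s z \<phi> \<longleftrightarrow> \<phi> \<in> harmonic_Hs \<Omega> F s \<and>
     (\<forall>v \<in> harmonic_Hs \<Omega> F s. harmonic_inner \<Omega> F s \<phi> v = v z)"

text \<open>The class \<open>\<K>\<close>. Its members are again represented by functions continuous on \<open>\<Omega>\<close>; such
  representatives exist for all \<open>u(g)\<close> as soon as \<open>u\<^sub>0\<close> is continuous, because \<open>u(g) - u\<^sub>0\<close> is harmonic.\<close>

definition model_class ::
    "(real^'n) set \<Rightarrow> (real^'n) set set \<Rightarrow> real \<Rightarrow> ((real^'n \<Rightarrow> real) \<Rightarrow> real) \<Rightarrow> real \<Rightarrow>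
     (real^'n \<Rightarrow> real) set" where
  "model_class \<Omega> F s f CB = {u. continuous_on \<Omega> u \<and>
     (\<exists>g \<in> Hs_boundary F s. Hs_boundary_norm F s g \<le> CB \<and>
        poisson_solution \<Omega> f u \<and> has_boundary_trace \<Omega> F u g)}"

definition data_class ::
    "(real^'n) set \<Rightarrow> (real^'n) set set \<Rightarrow> real \<Rightarrow> ((real^'n \<Rightarrow> real) \<Rightarrow> real) \<Rightarrow> real \<Rightarrow>
     ('m \<Rightarrow> real^'n) \<Rightarrow> real^'m \<Rightarrow> (real^'n \<Rightarrow> real) set" where
  "data_class \<Omega> F s f CB x \<omega> = {u \<in> model_class \<Omega> F s f CB. \<forall>i. u (x i) = \<omega> $ i}"

subsection \<open>Banach spaces of functions and Chebyshev radius\<close>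

text \<open>The elements of \<open>X\<close> are all representatives, and \<open>v\<close>, \<open>w\<close> represent the same element iff
  \<open>N (v - w) = 0\<close>. Functions that agree on \<open>\<Omega>\<close> are identified, and identified functions agree almost
  everywhere on \<open>\<Omega>\<close>. Thus spaces of pointwise defined functions and spaces of equivalence classes
  modulo null sets are both covered.\<close>

definition banach_function_space ::
    "(real^'n) set \<Rightarrow> (real^'n \<Rightarrow> real) set \<Rightarrow> ((real^'n \<Rightarrow> real) \<Rightarrow> real) \<Rightarrow> bool" where
  "banach_function_space \<Omega> X N \<longleftrightarrow>
     (\<lambda>_. 0) \<in> X \<and>
     (\<forall>v \<in> X. \<forall>w \<in> X. (\<lambda>y. v y + w y) \<in> X \<and> N (\<lambda>y. v y + w y) \<le> N v + N w) \<and>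
     (\<forall>c. \<forall>v \<in> X. (\<lambda>y. c * v y) \<in> X \<and> N (\<lambda>y. c * v y) = \<bar>c\<bar> * N v) \<and>
     (\<forall>v. (\<forall>y \<in> \<Omega>. v y = 0) \<longrightarrow> v \<in> X \<and> N v = 0) \<and>
     (\<forall>v \<in> X. N v = 0 \<longrightarrow> (AE y in lebesgue_on \<Omega>. v y = 0)) \<and>
     (\<forall>v. (\<forall>k::nat. v k \<in> X) \<and>
          (\<forall>e>0. \<exists>M. \<forall>j\<ge>M. \<forall>k\<ge>M. N (\<lambda>y. v j y - v k y) < e) \<longrightarrow>
          (\<exists>w \<in> X. (\<lambda>k. N (\<lambda>y. v k y - w y)) \<longlonglongrightarrow> 0))"

definition seminorm_on ::
    "(real^'n \<Rightarrow> real) set \<Rightarrow> ((real^'n \<Rightarrow> real) \<Rightarrow> real) \<Rightarrow> ((real^'n \<Rightarrow> real) \<Rightarrow> real) \<Rightarrow> bool" where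
  "seminorm_on X N p \<longleftrightarrow>
     (\<forall>v \<in> X. p v \<ge> 0) \<and>
     (\<forall>v \<in> X. \<forall>w \<in> X. p (\<lambda>y. v y + w y) \<le> p v + p w) \<and>
     (\<forall>c. \<forall>v \<in> X. p (\<lambda>y. c * v y) = \<bar>c\<bar> * p v) \<and>
     (\<forall>v \<in> X. N v = 0 \<longrightarrow> p v = 0)"

definition chebyshev_radius ::
    "(real^'n \<Rightarrow> real) set \<Rightarrow> ((real^'n \<Rightarrow> real) \<Rightarrow> real) \<Rightarrow> (real^'n \<Rightarrow> real) set \<Rightarrow> ereal" where
  "chebyshev_radius X p Z = (INF v\<in>X. SUP z\<in>Z. ereal (p (\<lambda>y. v y - z y)))"

subsection \<open>Matrices and the recovery algorithm\<close>

definition l1_norm :: "real^'m \<Rightarrow> real" where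
  "l1_norm v = (\<Sum>i\<in>UNIV. \<bar>v $ i\<bar>)"

definition l1_opnorm :: "real^'m^'m \<Rightarrow> real" where
  "l1_opnorm A = (SUP v\<in>{v. l1_norm v \<le> 1}. l1_norm (A *v v))"

definition moore_penrose :: "real^'m^'m \<Rightarrow> real^'m^'m" where
  "moore_penrose A = (THE B. A ** B ** A = A \<and> B ** A ** B = B \<and>
     transpose (A ** B) = A ** B \<and> transpose (B ** A) = B ** A)"

definition observation_matrix ::
    "('m \<Rightarrow> real^'n) \<Rightarrow> ('m \<Rightarrow> real^'n \<Rightarrow> real) \<Rightarrow> real^'m^'m" where
  "observation_matrix x \<phi> = (\<chi> i j. \<phi> j (x i))"

definition max_discrepancy ::
    "('m::finite \<Rightarrow> real^'n) \<Rightarrow> (real^'n \<Rightarrow> real) \<Rightarrow> (real^'n \<Rightarrow> real) \<Rightarrow> real" where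
  "max_discrepancy x v w = (MAX i. \<bar>v (x i) - w (x i)\<bar>)"

definition recovery_output ::
    "(real^'n \<Rightarrow> real) set \<Rightarrow> ((real^'n \<Rightarrow> real) \<Rightarrow> real) \<Rightarrow> ('m::finite \<Rightarrow> real^'n) \<Rightarrow> real^'m \<Rightarrow>
     (real^'n \<Rightarrow> real) \<Rightarrow> ('m \<Rightarrow> real^'n \<Rightarrow> real) \<Rightarrow> real \<Rightarrow> real \<Rightarrow> (real^'n \<Rightarrow> real) \<Rightarrow> bool" where
  "recovery_output X p x \<omega> u0 \<phi> \<epsilon>1 \<epsilon>2 uhat \<longleftrightarrow> (\<exists>u0hat \<phi>hat.
     u0hat \<in> X \<and> p (\<lambda>y. u0hat y - u0 y) + max_discrepancy x u0hat u0 \<le> \<epsilon>1 \<and>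
     (\<forall>j. \<phi>hat j \<in> X \<and> p (\<lambda>y. \<phi>hat j y - \<phi> j y) + max_discrepancy x (\<phi>hat j) (\<phi> j) \<le> \<epsilon>2) \<and>
     (let \<omega>hat = (\<chi> i. \<omega> $ i - u0hat (x i));
          Ghat = observation_matrix x \<phi>hat;
          Uhat = moore_penrose Ghat *v \<omega>hat
      in uhat = (\<lambda>y. u0hat y + (\<Sum>i\<in>UNIV. Uhat $ i * \<phi>hat i y))))"

end

theory Submission
  imports Defs
begin

text \<open>Subtracting \<open>u\<^sub>0\<close> identifies the data class with the harmonic functions in a ball that interpolate the
  shifted data. The interpolant in the span of the representers is orthogonal to all harmonic functions
  vanishing at the observation points, so reflection in it preserves the data class, and the triangle
  inequality for a point and its mirror image shows that the exact algorithm attains the Chebyshev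
  radius. A Neumann type estimate for the perturbed observation matrix controls the effect of the tolerances.

  Since the norm of a harmonic function is computed from choices of a trace and of a tangential gradient, the
  Hilbert space structure depends on both being unique up to null sets. Near almost every boundary point
  the boundary is a hyperplane with a half ball of the domain on one side. Traces are unique because the
  divergence theorem on the half space, applied to \<open>\<eta> \<psi>\<^sup>2\<close> with a bump function \<open>\<eta>\<close>, bounds
  \<open>\<psi>\<close> on the hyperplane by its \<open>H\<^sup>1\<close> norm; tangential gradients are unique by integration
  by parts within a facet. Both only use that the integral of a directional derivative is zero, because
  functions on a facet are integrated over the prism erected on it.\<close>

subsection \<open>Square integrable functions\<close>

text \<open>Facets carry no coordinates. Since area is the volume of a prism, the flux through a
  facet must be produced as a volume integral over a slab of height one, and test functions on a
  facet are replaced by test functions in the interior of its prism. Uniqueness only asks for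
  vanishing almost everywhere, so the trace inequality may be local, on balls that avoid the edges,
  with a constant depending on the ball; Lindelof's theorem glues the balls. The budget is the price
  of three substitutions in \<open>u0 + uH\<close>: \<open>\<epsilon>1\<close> for
  \<open>u0\<close>; \<open>\<epsilon>2\<close> times the sum norm of the exact coefficients for the
  representers; and \<open>CX + \<epsilon>2\<close>, a bound for the computed representers, times
  the coefficient error. The exact coefficients are at most
  \<open>m * g1 * \<Lambda>sd * CB\<close>, because the shifted data are point values of a harmonic
  function of norm at most \<open>CB\<close>. The coefficient error has a part
  \<open>m * g1 * \<epsilon>1\<close> from the shifted data and a part from the matrix, which is
  governed by \<open>\<delta>\<close>.\<close>

lemma L2_measurable: "g \<in> L2 M \<Longrightarrow> g \<in> borel_measurable M"
  by (simp add: L2_def)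

lemma L2_integrable_sq: "g \<in> L2 M \<Longrightarrow> integrable M (\<lambda>x. (norm (g x))\<^sup>2)"
  by (simp add: L2_def)

lemma norm_lincomb_sq_le:
  fixes a b :: "'b::real_inner"
  shows "(norm (r *\<^sub>R a + t *\<^sub>R b))\<^sup>2 \<le> 2 * r\<^sup>2 * (norm a)\<^sup>2 + 2 * t\<^sup>2 * (norm b)\<^sup>2"
proof -
  have "norm (r *\<^sub>R a + t *\<^sub>R b) \<le> \<bar>r\<bar> * norm a + \<bar>t\<bar> * norm b"
    by (metis norm_scaleR norm_triangle_ineq)
  then have "(norm (r *\<^sub>R a + t *\<^sub>R b))\<^sup>2 \<le> (\<bar>r\<bar> * norm a + \<bar>t\<bar> * norm b)\<^sup>2"
    by (simp add: power_mono)
  also have "\<dots> \<le> 2 * (\<bar>r\<bar> * norm a)\<^sup>2 + 2 * (\<bar>t\<bar> * norm b)\<^sup>2"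
    using sum_squares_bound[of "\<bar>r\<bar> * norm a" "\<bar>t\<bar> * norm b"] by (simp add: power2_sum)
  finally show ?thesis by (simp add: power_mult_distrib)
qed

text \<open>Young's inequality with a free weight. In \<open>L2_tendsto_inner\<close> the weight is
  chosen first to make one term small, then convergence makes the other small; this stands in for
  the Cauchy-Schwarz inequality for integrals.\<close>

lemma abs_inner_le_sq:
  fixes a b :: "'b::real_inner"
  assumes "e > 0"
  shows "\<bar>a \<bullet> b\<bar> \<le> (norm a)\<^sup>2 / (2 * e) + e * (norm b)\<^sup>2 / 2"
proof -
  have "\<bar>a \<bullet> b\<bar> \<le> norm a * norm b" by (rule Cauchy_Schwarz_ineq2)
  moreover have "0 \<le> (norm a - e * norm b)\<^sup>2 / (2 * e)" using assms by simp
  then have "norm a * norm b \<le> (norm a)\<^sup>2 / (2 * e) + e * (norm b)\<^sup>2 / 2"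
    using assms by (simp add: power2_eq_square field_simps)
  ultimately show ?thesis by linarith
qed

lemma L2_lincomb:
  fixes f g :: "'a \<Rightarrow> 'b::euclidean_space"
  assumes "f \<in> L2 M" "g \<in> L2 M"
  shows "(\<lambda>x. r *\<^sub>R f x + t *\<^sub>R g x) \<in> L2 M"
proof -
  note [measurable] = assms[THEN L2_measurable]
  have "integrable M (\<lambda>x. (norm (r *\<^sub>R f x + t *\<^sub>R g x))\<^sup>2)"
  proof (rule Bochner_Integration.integrable_bound)
    show "integrable M (\<lambda>x. 2 * r\<^sup>2 * (norm (f x))\<^sup>2 + 2 * t\<^sup>2 * (norm (g x))\<^sup>2)"
      using assms[THEN L2_integrable_sq] by auto
  qed (auto simp: norm_lincomb_sq_le)
  then show ?thesis by (simp add: L2_def)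
qed

lemma L2_diff:
  fixes f g :: "'a \<Rightarrow> 'b::euclidean_space"
  assumes "f \<in> L2 M" "g \<in> L2 M"
  shows "(\<lambda>x. f x - g x) \<in> L2 M"
  using L2_lincomb[OF assms, of 1 "-1"] by simp

lemma L2_inner_integrable:
  fixes f g :: "'a \<Rightarrow> 'b::euclidean_space"
  assumes "f \<in> L2 M" "g \<in> L2 M"
  shows "integrable M (\<lambda>x. f x \<bullet> g x)"
proof (rule Bochner_Integration.integrable_bound)
  note [measurable] = assms[THEN L2_measurable]
  show "integrable M (\<lambda>x. (norm (f x))\<^sup>2 / (2 * 1) + 1 * (norm (g x))\<^sup>2 / 2)"
    using assms[THEN L2_integrable_sq] by auto
  show "(\<lambda>x. f x \<bullet> g x) \<in> borel_measurable M" by simp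
  show "AE x in M. norm (f x \<bullet> g x) \<le> norm ((norm (f x))\<^sup>2 / (2 * 1) + 1 * (norm (g x))\<^sup>2 / 2)"
    using abs_inner_le_sq[of 1] by (auto simp del: mult_1 intro!: AE_I2 order_trans[OF _ abs_ge_self])
qed

lemma L2_mult_integrable:
  fixes f g :: "'a \<Rightarrow> real"
  shows "f \<in> L2 M \<Longrightarrow> g \<in> L2 M \<Longrightarrow> integrable M (\<lambda>x. f x * g x)"
  using L2_inner_integrable[of f M g] by simp

lemma L2_cong_AE:
  fixes f g :: "'a \<Rightarrow> 'b::euclidean_space"
  assumes "f \<in> L2 M" "g \<in> borel_measurable M" "AE x in M. f x = g x"
  shows "g \<in> L2 M"
proof -
  have "integrable M (\<lambda>x. (norm (g x))\<^sup>2)"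
    using assms by (subst integrable_cong_AE[where g="\<lambda>x. (norm (f x))\<^sup>2"]) (auto simp: L2_def)
  then show ?thesis using assms by (simp add: L2_def)
qed

lemma L2_inner_const:
  fixes f :: "'a \<Rightarrow> 'b::euclidean_space"
  assumes "f \<in> L2 M"
  shows "(\<lambda>x. f x \<bullet> c) \<in> L2 M"
proof -
  note [measurable] = assms[THEN L2_measurable]
  have "integrable M (\<lambda>x. (norm (f x \<bullet> c))\<^sup>2)"
  proof (rule Bochner_Integration.integrable_bound)
    show "integrable M (\<lambda>x. (norm (f x))\<^sup>2 * (norm c)\<^sup>2)"
      using assms[THEN L2_integrable_sq] by auto
    show "AE x in M. norm ((norm (f x \<bullet> c))\<^sup>2) \<le> norm ((norm (f x))\<^sup>2 * (norm c)\<^sup>2)"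
      using power_mono[OF Cauchy_Schwarz_ineq2, of _ c 2] by (auto simp: power_mult_distrib)
  qed simp
  then show ?thesis by (simp add: L2_def)
qed

lemma bounded_L2:
  fixes f :: "'a \<Rightarrow> 'b::euclidean_space"
  assumes "finite_measure M" "f \<in> borel_measurable M" "\<And>x. x \<in> space M \<Longrightarrow> norm (f x) \<le> B"
  shows "f \<in> L2 M"
proof -
  interpret finite_measure M by fact
  note [measurable] = assms(2)
  have "integrable M (\<lambda>x. (norm (f x))\<^sup>2)"
    using assms(3) by (intro integrable_const_bound[where B="B\<^sup>2"]) (auto intro!: AE_I2 power_mono)
  then show ?thesis by (simp add: L2_def)
qed

lemma L2_integrable:
  fixes f :: "'a \<Rightarrow> real"
  assumes "finite_measure M" "f \<in> L2 M"
  shows "integrable M f"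
proof -
  have "(\<lambda>x. 1::real) \<in> L2 M" by (rule bounded_L2[OF assms(1), where B=1]) auto
  from L2_mult_integrable[OF assms(2) this] show ?thesis by simp
qed

lemma L2_tendstoD:
  assumes "L2_tendsto M g h"
  shows "g k \<in> L2 M" "h \<in> L2 M" "(\<lambda>k. \<integral>x. (norm (g k x - h x))\<^sup>2 \<partial>M) \<longlonglongrightarrow> 0"
  using assms by (auto simp: L2_tendsto_def)

lemma L2_tendsto_lincomb:
  fixes f :: "nat \<Rightarrow> 'a \<Rightarrow> 'b::euclidean_space"
  assumes "L2_tendsto M f F" "L2_tendsto M g G"
  shows "L2_tendsto M (\<lambda>k x. r *\<^sub>R f k x + t *\<^sub>R g k x) (\<lambda>x. r *\<^sub>R F x + t *\<^sub>R G x)"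
proof -
  note f = L2_tendstoD[OF assms(1)] and g = L2_tendstoD[OF assms(2)]
  have int: "integrable M (\<lambda>x. (norm (f k x - F x))\<^sup>2)" "integrable M (\<lambda>x. (norm (g k x - G x))\<^sup>2)" for k
    using L2_diff[THEN L2_integrable_sq] f g by blast+
  have "(\<lambda>k. \<integral>x. (norm ((r *\<^sub>R f k x + t *\<^sub>R g k x) - (r *\<^sub>R F x + t *\<^sub>R G x)))\<^sup>2 \<partial>M) \<longlonglongrightarrow> 0"
  proof (rule tendsto_sandwich[OF _ _ tendsto_const])
    show "(\<lambda>k. 2 * r\<^sup>2 * (\<integral>x. (norm (f k x - F x))\<^sup>2 \<partial>M) + 2 * t\<^sup>2 * (\<integral>x. (norm (g k x - G x))\<^sup>2 \<partial>M)) \<longlonglongrightarrow> 0"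
      using tendsto_add[OF tendsto_mult_right_zero[OF f(3), of "2 * r\<^sup>2"] tendsto_mult_right_zero[OF g(3), of "2 * t\<^sup>2"]] by simp
    have "(\<integral>x. (norm ((r *\<^sub>R f k x + t *\<^sub>R g k x) - (r *\<^sub>R F x + t *\<^sub>R G x)))\<^sup>2 \<partial>M)
       \<le> (\<integral>x. 2 * r\<^sup>2 * (norm (f k x - F x))\<^sup>2 + 2 * t\<^sup>2 * (norm (g k x - G x))\<^sup>2 \<partial>M)" for k
    proof (rule integral_mono)
      show "integrable M (\<lambda>x. (norm ((r *\<^sub>R f k x + t *\<^sub>R g k x) - (r *\<^sub>R F x + t *\<^sub>R G x)))\<^sup>2)"
        by (intro L2_integrable_sq L2_diff L2_lincomb f g)
      show "(norm ((r *\<^sub>R f k x + t *\<^sub>R g k x) - (r *\<^sub>R F x + t *\<^sub>R G x)))\<^sup>2 \<le> 2 * r\<^sup>2 * (norm (f k x - F x))\<^sup>2 + 2 * t\<^sup>2 * (norm (g k x - G x))\<^sup>2" for x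
        using norm_lincomb_sq_le[of r "f k x - F x" t "g k x - G x"] by (simp add: algebra_simps)
    qed (use int in auto)
    then show "\<forall>\<^sub>F k in sequentially. (\<integral>x. (norm ((r *\<^sub>R f k x + t *\<^sub>R g k x) - (r *\<^sub>R F x + t *\<^sub>R G x)))\<^sup>2 \<partial>M)
       \<le> 2 * r\<^sup>2 * (\<integral>x. (norm (f k x - F x))\<^sup>2 \<partial>M) + 2 * t\<^sup>2 * (\<integral>x. (norm (g k x - G x))\<^sup>2 \<partial>M)"
      using int by simp
  qed simp
  then show ?thesis
    by (simp add: L2_tendsto_def L2_lincomb f g)
qed

lemma L2_tendsto_cong_AE:
  fixes f :: "nat \<Rightarrow> 'a \<Rightarrow> 'b::euclidean_space"
  assumes "L2_tendsto M f F" "G \<in> borel_measurable M" "AE x in M. F x = G x"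
  shows "L2_tendsto M f G"
proof -
  note f = L2_tendstoD[OF assms(1)]
  have G: "G \<in> L2 M" using L2_cong_AE[OF f(2) assms(2,3)] .
  note [measurable] = f(1,2)[THEN L2_measurable] assms(2)
  have "(\<integral>x. (norm (f k x - G x))\<^sup>2 \<partial>M) = (\<integral>x. (norm (f k x - F x))\<^sup>2 \<partial>M)" for k
    using assms(3) by (intro integral_cong_AE) auto
  then show ?thesis using f G by (simp add: L2_tendsto_def)
qed

lemma L2_tendsto_inner:
  fixes f :: "nat \<Rightarrow> 'a \<Rightarrow> 'b::euclidean_space"
  assumes "L2_tendsto M f F" "h \<in> L2 M"
  shows "(\<lambda>k. \<integral>x. f k x \<bullet> h x \<partial>M) \<longlonglongrightarrow> (\<integral>x. F x \<bullet> h x \<partial>M)"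
proof -
  note f = L2_tendstoD[OF assms(1)]
  define D where "D k = (\<integral>x. (norm (f k x - F x))\<^sup>2 \<partial>M)" for k
  define K where "K = (\<integral>x. (norm (h x))\<^sup>2 \<partial>M)"
  have K: "K \<ge> 0" by (simp add: K_def)
  have bound: "\<bar>(\<integral>x. f k x \<bullet> h x \<partial>M) - (\<integral>x. F x \<bullet> h x \<partial>M)\<bar> \<le> D k / (2 * e) + e * K / 2" if "e > 0" for k e
  proof -
    have "\<bar>(\<integral>x. f k x \<bullet> h x \<partial>M) - (\<integral>x. F x \<bullet> h x \<partial>M)\<bar> = \<bar>\<integral>x. (f k x - F x) \<bullet> h x \<partial>M\<bar>"
      using L2_inner_integrable[OF f(1) assms(2)] L2_inner_integrable[OF f(2) assms(2)]
      by (simp add: inner_diff_left)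
    also have "\<dots> \<le> (\<integral>x. \<bar>(f k x - F x) \<bullet> h x\<bar> \<partial>M)" by (rule integral_abs_bound)
    also have "\<dots> \<le> (\<integral>x. (norm (f k x - F x))\<^sup>2 / (2 * e) + e * (norm (h x))\<^sup>2 / 2 \<partial>M)"
    proof (rule integral_mono)
      show "integrable M (\<lambda>x. \<bar>(f k x - F x) \<bullet> h x\<bar>)"
        by (intro integrable_abs L2_inner_integrable L2_diff f assms)
      show "integrable M (\<lambda>x. (norm (f k x - F x))\<^sup>2 / (2 * e) + e * (norm (h x))\<^sup>2 / 2)"
        using L2_diff[OF f(1,2), THEN L2_integrable_sq] assms(2)[THEN L2_integrable_sq] by auto
    qed (rule abs_inner_le_sq[OF that])
    also have "\<dots> = D k / (2 * e) + e * K / 2"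
      using L2_diff[OF f(1,2), THEN L2_integrable_sq] assms(2)[THEN L2_integrable_sq]
      by (simp add: D_def K_def)
    finally show ?thesis .
  qed
  show ?thesis
  proof (rule LIMSEQ_I)
    fix r :: real assume "r > 0"
    \<comment> \<open>Each of the two terms of \<open>bound\<close> is to be at most
      \<open>r / 2\<close>. The weight does this for the term with \<open>K\<close>, where adding 1
      covers \<open>K = 0\<close>; the threshold \<open>e * r\<close> for \<open>D k\<close> does it
      for the other.\<close>
    define e where "e = r / (K + 1)"
    have e: "e > 0" "e * K / 2 \<le> r / 2" using \<open>r > 0\<close> K by (auto simp: e_def field_simps)
    from LIMSEQ_D[OF f(3), of "e * r"] e \<open>r > 0\<close> obtain n where n: "\<And>k. k \<ge> n \<Longrightarrow> D k < e * r"
      by (auto simp: D_def)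
    have "norm ((\<integral>x. f k x \<bullet> h x \<partial>M) - (\<integral>x. F x \<bullet> h x \<partial>M)) < r" if "k \<ge> n" for k
    proof -
      have "D k / (2 * e) < r / 2" using n[OF that] e by (simp add: field_simps)
      then show ?thesis using bound[OF e(1), of k] e(2) by simp
    qed
    then show "\<exists>n. \<forall>k\<ge>n. norm ((\<integral>x. f k x \<bullet> h x \<partial>M) - (\<integral>x. F x \<bullet> h x \<partial>M)) < r" by blast
  qed
qed

subsection \<open>Continuously differentiable functions\<close>

lemma C1_with_gradient_continuous:
  assumes "C1_with_gradient \<psi> \<psi>'"
  shows "continuous_on UNIV \<psi>" "continuous_on UNIV \<psi>'"
proof -
  have "isCont \<psi> x" for x
    using assms by (metis C1_with_gradient_def gderiv_def has_derivative_continuous)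
  then show "continuous_on UNIV \<psi>" by (simp add: continuous_at_imp_continuous_on)
qed (use assms in \<open>simp add: C1_with_gradient_def\<close>)

lemma C1_with_gradient_measurable:
  assumes "C1_with_gradient \<psi> \<psi>'"
  shows "\<psi> \<in> borel_measurable borel" "\<psi>' \<in> borel_measurable borel"
  using C1_with_gradient_continuous[OF assms] by (auto intro: borel_measurable_continuous_onI)

lemma C1_with_gradient_const: "C1_with_gradient (\<lambda>x. c) (\<lambda>x. 0)"
  by (simp add: C1_with_gradient_def GDERIV_const)

lemma C1_with_gradient_inner: "C1_with_gradient (\<lambda>x. x \<bullet> e) (\<lambda>x. e)"
  by (auto simp: C1_with_gradient_def gderiv_def intro!: derivative_eq_intros)

lemma C1_with_gradient_mult:
  assumes "C1_with_gradient f f'" "C1_with_gradient g g'"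
  shows "C1_with_gradient (\<lambda>x. f x * g x) (\<lambda>x. f x *\<^sub>R g' x + g x *\<^sub>R f' x)"
  using assms C1_with_gradient_continuous[OF assms(1)] C1_with_gradient_continuous[OF assms(2)]
  by (auto simp: C1_with_gradient_def intro!: GDERIV_mult continuous_intros)

lemma C1_with_gradient_lincomb:
  assumes "C1_with_gradient f f'" "C1_with_gradient g g'"
  shows "C1_with_gradient (\<lambda>x. r * f x + t * g x) (\<lambda>x. r *\<^sub>R f' x + t *\<^sub>R g' x)"
proof -
  have "GDERIV (\<lambda>x. r * f x + t * g x) x :> r *\<^sub>R f' x + t *\<^sub>R g' x" for x
    using GDERIV_add[OF GDERIV_mult[OF GDERIV_const, of f x "f' x" r] GDERIV_mult[OF GDERIV_const, of g x "g' x" t]] assms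
    by (simp add: C1_with_gradient_def)
  then show ?thesis using assms
    by (auto simp: C1_with_gradient_def intro!: continuous_intros)
qed

lemma C1_with_gradient_compose:
  assumes "C1_with_gradient f f'" "\<And>t. DERIV g t :> g' t" "continuous_on UNIV g'"
  shows "C1_with_gradient (\<lambda>x. g (f x)) (\<lambda>x. g' (f x) *\<^sub>R f' x)"
proof -
  have "GDERIV (\<lambda>x. g (f x)) x :> g' (f x) *\<^sub>R f' x" for x
    using GDERIV_DERIV_compose[of f x "f' x" g "g' (f x)"] assms(1,2) by (simp add: C1_with_gradient_def)
  moreover have "continuous_on UNIV (\<lambda>x. g' (f x) *\<^sub>R f' x)"
    using continuous_on_compose2[OF assms(3) C1_with_gradient_continuous(1)[OF assms(1)] subset_UNIV]
      C1_with_gradient_continuous(2)[OF assms(1)]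
    by (rule continuous_on_scaleR)
  ultimately show ?thesis by (simp add: C1_with_gradient_def)
qed

text \<open>The gradient stays existential: its formula for a product over a basis is unwieldy, and
  a test function only has to come with some continuous gradient.\<close>

lemma C1_with_gradient_prod:
  assumes "finite I" "\<And>i. i \<in> I \<Longrightarrow> \<exists>f'. C1_with_gradient (f i) f'"
  shows "\<exists>f'. C1_with_gradient (\<lambda>x. \<Prod>i\<in>I. f i x) f'"
  using assms
proof (induction rule: finite_induct)
  case empty
  show ?case using exI[of "C1_with_gradient (\<lambda>x. 1)", OF C1_with_gradient_const] by (simp only: prod.empty)
next
  case (insert i I)
  have "\<exists>g'. C1_with_gradient (\<lambda>x. \<Prod>i\<in>I. f i x) g'"
    by (rule insert.IH, rule insert.prems, erule insertI2)
  then obtain g' where g': "C1_with_gradient (\<lambda>x. \<Prod>i\<in>I. f i x) g'" by (rule exE)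
  have "\<exists>f'. C1_with_gradient (f i) f'" by (rule insert.prems, rule insertI1)
  then obtain f' where f': "C1_with_gradient (f i) f'" by (rule exE)
  show ?case
    unfolding prod.insert[OF insert(1,2)]
    by (rule exI, rule C1_with_gradient_mult[OF f' g'])
qed

section \<open>C1 approximations of the indicator of a half line\<close>

lemma DERIV_pos_part_sq: "DERIV (\<lambda>t::real. (max 0 t)\<^sup>2) t :> 2 * max 0 t"
proof -
  consider "t > 0" | "t < 0" | "t = 0" by linarith
  then show ?thesis
  proof cases
    case 1
    have "DERIV (\<lambda>t::real. t\<^sup>2) t :> 2 * t" using DERIV_pow[of 2 t] by simp
    then have "DERIV (\<lambda>t::real. (max 0 t)\<^sup>2) t :> 2 * t"
      by (rule has_field_derivative_transform_within_open[where S="{0<..}"]) (use 1 in simp_all)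
    then show ?thesis using 1 by simp
  next
    case 2
    have "DERIV (\<lambda>t::real. (max 0 t)\<^sup>2) t :> 0"
      by (rule has_field_derivative_transform_within_open[OF DERIV_const[of 0], where S="{..<0}"]) (use 2 in simp_all)
    then show ?thesis using 2 by simp
  next
    case 3
    have "((\<lambda>h::real. (max 0 h)\<^sup>2 / h) \<longlongrightarrow> 0) (at 0)"
    proof (rule Lim_null_comparison)
      have "norm ((max 0 h)\<^sup>2 / h) \<le> \<bar>h\<bar>" for h :: real
        by (cases "h \<le> 0") (simp_all add: max_def power2_eq_square)
      then show "\<forall>\<^sub>F h in at 0. norm ((max 0 h)\<^sup>2 / h) \<le> \<bar>h\<bar>"
        by simp
      show "((\<lambda>h::real. \<bar>h\<bar>) \<longlongrightarrow> 0) (at 0)" by (rule tendsto_rabs_zero) (rule tendsto_ident_at)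
    qed
    then show ?thesis using 3 by (simp add: DERIV_def)
  qed
qed

text \<open>The form \<open>c / (1 + c)\<close> with \<open>c\<close> equal to \<open>k\<close>
  times the squared positive part stays in the unit interval and tends to 1 exactly where
  \<open>t\<close> is positive. Test functions are only required to be C1, so squaring the positive
  part gives enough smoothness at 0.\<close>

definition smooth_step :: "nat \<Rightarrow> real \<Rightarrow> real" where
  "smooth_step k t = real k * (max 0 t)\<^sup>2 / (1 + real k * (max 0 t)\<^sup>2)"

lemma smooth_step_bounds: "0 \<le> smooth_step k t" "smooth_step k t \<le> 1"
proof -
  define c where "c = real k * (max 0 t)\<^sup>2"
  have "c \<ge> 0" by (simp add: c_def)
  then show "0 \<le> smooth_step k t" "smooth_step k t \<le> 1"
    by (simp_all add: smooth_step_def c_def[symmetric] divide_le_eq)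
qed

lemma smooth_step_nonpos: "t \<le> 0 \<Longrightarrow> smooth_step k t = 0"
  by (simp add: smooth_step_def)

lemma smooth_step_tendsto: "(\<lambda>k. smooth_step k t) \<longlonglongrightarrow> (if t > 0 then 1 else 0)"
proof (cases "t > 0")
  case True
  have "(\<lambda>k. real k * c / (1 + real k * c)) \<longlonglongrightarrow> 1" if "c > 0" for c
  proof -
    have "filterlim (\<lambda>k. 1 + c * real k) at_top sequentially"
      by (rule filterlim_tendsto_add_at_top[OF tendsto_const])
        (rule filterlim_tendsto_pos_mult_at_top[OF tendsto_const that filterlim_real_sequentially])
    then have "(\<lambda>k. 1 / (1 + c * real k)) \<longlonglongrightarrow> 0"
      by (intro tendsto_divide_0[OF tendsto_const] filterlim_at_top_imp_at_infinity)
    then have "(\<lambda>k. 1 - 1 / (1 + c * real k)) \<longlonglongrightarrow> 1 - 0"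
      by (intro tendsto_intros)
    moreover have "1 - 1 / (1 + c * real k) = real k * c / (1 + real k * c)" for k
    proof -
      have "0 \<le> c * real k" using that by simp
      then have "1 + c * real k \<noteq> 0" by linarith
      then show ?thesis by (simp add: field_simps)
    qed
    ultimately show ?thesis by simp
  qed
  from this[of "t\<^sup>2"] True show ?thesis by (simp add: smooth_step_def)
qed (simp add: smooth_step_nonpos)

lemma smooth_step_C1: "\<exists>g'. (\<forall>t. DERIV (smooth_step k) t :> g' t) \<and> continuous_on UNIV g'"
proof (intro exI conjI allI)
  have nz: "1 + real k * (max 0 t)\<^sup>2 \<noteq> 0" for t :: real
    using mult_nonneg_nonneg[OF of_nat_0_le_iff[of k] zero_le_power2[of "max 0 t"]] by linarith
  show "DERIV (smooth_step k) t :> real k * (2 * max 0 t) / (1 + real k * (max 0 t)\<^sup>2)\<^sup>2" for t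
  proof -
    have "DERIV (\<lambda>u. real k * u / (1 + real k * u)) u :> real k / (1 + real k * u)\<^sup>2"
      if "1 + real k * u \<noteq> 0" for u
      using that by (auto intro!: derivative_eq_intros simp: power2_eq_square algebra_simps)
    from DERIV_chain2[OF this[OF nz[of t]] DERIV_pos_part_sq[of t]]
    show ?thesis unfolding smooth_step_def[abs_def] by simp
  qed
  show "continuous_on UNIV (\<lambda>t. real k * (2 * max 0 t) / (1 + real k * (max 0 t)\<^sup>2)\<^sup>2)"
    by (intro continuous_intros ballI power_not_zero nz)
qed

text \<open>By Lindelof's theorem countably many of the neighbourhoods cover \<open>A\<close>, and a
  countable union of null sets is null. Local estimates may therefore have constants that depend on
  the point.\<close>

lemma AE_local_open:
  fixes A :: "'a::second_countable_topology set"
  assumes "\<And>z. z \<in> A \<Longrightarrow> \<exists>U. open U \<and> z \<in> U \<and> (AE x in M. x \<in> U \<longrightarrow> P x)"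
  shows "AE x in M. x \<in> A \<longrightarrow> P x"
proof -
  define F where "F = {U. open U \<and> (AE x in M. x \<in> U \<longrightarrow> P x)}"
  obtain F' where F': "F' \<subseteq> F" "countable F'" "\<Union>F' = \<Union>F"
    using Lindelof[of F] by (auto simp: F_def)
  have "AE x in M. \<forall>U\<in>F'. x \<in> U \<longrightarrow> P x"
    using F' by (subst AE_ball_countable) (auto simp: F_def)
  then show ?thesis
  proof eventually_elim
    case (elim x)
    show ?case
    proof
      assume "x \<in> A"
      with assms obtain U where "U \<in> F" "x \<in> U" unfolding F_def by blast
      then have "x \<in> \<Union>F'" using F'(3) by blast
      then show "P x" using elim by blast
    qed
  qed
qed

subsection \<open>The fundamental lemma of the calculus of variations\<close>

text \<open>Products of smooth steps, one for each of the two faces in every coordinate direction,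
  are test functions supported in the closed box and converge to the indicator of the open box.
  Dominated convergence with majorant \<open>\<bar>w x\<bar>\<close> passes the zero integrals to
  the limit.\<close>

lemma integral_box_zero:
  fixes w :: "real^'n \<Rightarrow> real"
  assumes w: "integrable lborel w"
    and test: "\<And>\<phi> \<phi>'. test_function S \<phi> \<phi>' \<Longrightarrow> (\<integral>x. \<phi> x * w x \<partial>lborel) = 0"
    and ab: "cbox a b \<subseteq> S"
  shows "(\<integral>x. indicator (box a b) x * w x \<partial>lborel) = 0"
proof -
  define \<phi> where "\<phi> k x = (\<Prod>i\<in>Basis. smooth_step k (x \<bullet> i - a \<bullet> i) * smooth_step k (b \<bullet> i - x \<bullet> i))"
    for k and x :: "real^'n"
  have "\<exists>f'. C1_with_gradient (\<phi> k) f'" for k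
    unfolding \<phi>_def
  proof (rule C1_with_gradient_prod)
    fix i :: "real^'n"
    from smooth_step_C1[of k] obtain g' where
      g': "(\<forall>t. DERIV (smooth_step k) t :> g' t) \<and> continuous_on UNIV g'" by (rule exE)
    note g = g'[THEN conjunct1, rule_format] g'[THEN conjunct2]
    have l: "C1_with_gradient (\<lambda>x. x \<bullet> i - a \<bullet> i) (\<lambda>x. i)" "C1_with_gradient (\<lambda>x. b \<bullet> i - x \<bullet> i) (\<lambda>x. - i)"
      using C1_with_gradient_lincomb[OF C1_with_gradient_inner[of i] C1_with_gradient_const[of "a \<bullet> i"], of 1 "-1"]
        C1_with_gradient_lincomb[OF C1_with_gradient_inner[of i] C1_with_gradient_const[of "b \<bullet> i"], of "-1" 1]
      by (simp_all add: add.commute)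
    show "\<exists>f'. C1_with_gradient (\<lambda>x. smooth_step k (x \<bullet> i - a \<bullet> i) * smooth_step k (b \<bullet> i - x \<bullet> i)) f'"
      by (rule exI) (rule C1_with_gradient_mult[OF C1_with_gradient_compose[OF l(1) g] C1_with_gradient_compose[OF l(2) g]])
  qed simp
  note ex = this
  define \<phi>' where "\<phi>' k = (SOME f'. C1_with_gradient (\<phi> k) f')" for k
  have C1: "C1_with_gradient (\<phi> k) (\<phi>' k)" for k
    using someI_ex[OF ex[of k]] by (simp add: \<phi>'_def)
  note [measurable] = C1[THEN C1_with_gradient_measurable(1)]
  have outside: "\<phi> k x = 0" if "x \<notin> cbox a b" for k x
  proof -
    from that obtain i where "i \<in> Basis" "x \<bullet> i - a \<bullet> i \<le> 0 \<or> b \<bullet> i - x \<bullet> i \<le> 0"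
      by (force simp: mem_box)
    then have "smooth_step k (x \<bullet> i - a \<bullet> i) * smooth_step k (b \<bullet> i - x \<bullet> i) = 0"
      by (auto simp: smooth_step_nonpos)
    then show ?thesis unfolding \<phi>_def using \<open>i \<in> Basis\<close> by (intro prod_zero) auto
  qed
  have "test_function S (\<phi> k) (\<phi>' k)" for k
    unfolding test_function_def
    by (intro conjI C1 exI[of _ "cbox a b"] compact_cbox ab allI impI outside)
  then have zero: "(\<integral>x. \<phi> k x * w x \<partial>lborel) = 0" for k by (rule test)
  have bnd: "\<bar>\<phi> k x\<bar> \<le> 1" for k x
    unfolding \<phi>_def abs_prod
    by (intro prod_le_1 conjI abs_ge_zero) (simp add: abs_mult smooth_step_bounds mult_le_one)
  have lim: "(\<lambda>k. \<phi> k x) \<longlonglongrightarrow> indicator (box a b) x" for x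
  proof -
    have "(\<lambda>k. \<phi> k x) \<longlonglongrightarrow> (\<Prod>i\<in>Basis. (if x \<bullet> i - a \<bullet> i > 0 then 1 else 0) * (if b \<bullet> i - x \<bullet> i > 0 then 1 else 0))"
      unfolding \<phi>_def by (intro tendsto_prod tendsto_mult smooth_step_tendsto)
    moreover have "(\<Prod>i\<in>Basis. (if x \<bullet> i - a \<bullet> i > 0 then 1 else 0) * (if b \<bullet> i - x \<bullet> i > 0 then 1 else 0)) = (indicator (box a b) x :: real)"
    proof (cases "x \<in> box a b")
      case False
      then obtain i where "i \<in> Basis" "\<not> (a \<bullet> i < x \<bullet> i \<and> x \<bullet> i < b \<bullet> i)" by (auto simp: mem_box)
      with False show ?thesis by (subst prod_zero) (auto intro!: bexI[of _ i])
    qed (simp add: mem_box)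
    ultimately show ?thesis by simp
  qed
  have "(\<lambda>k. \<integral>x. \<phi> k x * w x \<partial>lborel) \<longlonglongrightarrow> (\<integral>x. indicator (box a b) x * w x \<partial>lborel)"
  proof (rule integral_dominated_convergence)
    show "integrable lborel (\<lambda>x. \<bar>w x\<bar>)" using w by simp
    show "AE x in lborel. (\<lambda>k. \<phi> k x * w x) \<longlonglongrightarrow> indicator (box a b) x * w x"
      by (intro AE_I2 tendsto_mult lim tendsto_const)
    show "AE x in lborel. norm (\<phi> k x * w x) \<le> \<bar>w x\<bar>" for k
      using bnd[of k] by (intro AE_I2) (simp add: abs_mult mult_left_le_one_le)
  qed (use w in auto)
  then show ?thesis by (simp add: zero LIMSEQ_const_iff)
qed

text \<open>Boxes form an intersection-stable generator of the Borel sets, so zero integrals over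
  boxes spread to all Borel sets by a Dynkin class argument. \<open>w\<close> is first cut down to a
  box with closure in \<open>S\<close>: the total integral of the cut function is then zero, as the
  step for complements requires. The local statements are joined by
  \<open>AE_local_open\<close>.\<close>

lemma fundamental_lemma_lborel:
  fixes w :: "real^'n \<Rightarrow> real"
  assumes S: "open S" and w: "integrable lborel w"
    and test: "\<And>\<phi> \<phi>'. test_function S \<phi> \<phi>' \<Longrightarrow> (\<integral>x. \<phi> x * w x \<partial>lborel) = 0"
  shows "AE x in lborel. x \<in> S \<longrightarrow> w x = 0"
proof -
  have box: "AE x in lborel. x \<in> box a b \<longrightarrow> w x = 0" if ab: "cbox a b \<subseteq> S" for a b
  proof -
    define v where "v x = indicator (box a b) x * w x" for x
    have v: "integrable lborel v"
      using integrable_mult_indicator[OF _ w, of "box a b"] by (simp add: v_def[abs_def])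
    have "set_lebesgue_integral lborel A v = 0" if "A \<in> sets borel" for A
    proof -
      define G where "G = range (\<lambda>(c, d). box c d :: (real^'n) set)"
      have gen: "Int_stable G" "G \<subseteq> Pow UNIV"
        by (auto simp: G_def Int_stable_def box_Int_box)
      have sigma: "sigma_sets UNIV G = sets borel"
        by (simp add: borel_eq_box G_def)
      have "A \<in> sigma_sets UNIV G"
        using that sigma by simp
      from gen this show ?thesis
      proof (induction rule: sigma_sets_induct_disjoint)
        case (basic A)
        then obtain c d where A: "A = box c d" by (auto simp: G_def)
        obtain a' b' where ab': "box c d \<inter> box a b = box a' b'" by (auto simp: box_Int_box)
        show ?case
        proof (cases "box a' b' = {}")
          case True
          then have "indicator A x *\<^sub>R v x = 0" for x
            using ab' by (auto simp: v_def A indicator_def)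
          then show ?thesis unfolding set_lebesgue_integral_def by (simp only: integral_zero)
        next
          case False
          \<comment> \<open>\<open>integral_box_zero\<close> asks for the closed box to lie in
            \<open>S\<close>. It does so as the closure of the open one, an identity that holds only
            for nonempty open boxes; hence the case distinction.\<close>
          have "cbox a' b' = closure (box a' b')" using False by simp
          also have "\<dots> \<subseteq> closure (box a b)" using ab' by (intro closure_mono) blast
          also have "\<dots> \<subseteq> S"
            using ab closure_minimal[OF box_subset_cbox closed_cbox, of a b] by blast
          finally have "(\<integral>x. indicator (box a' b') x * w x \<partial>lborel) = 0"
            by (intro integral_box_zero[OF w test])
          moreover have "indicator A x *\<^sub>R v x = indicator (box a' b') x * w x" for x
            by (simp add: v_def A ab'[symmetric] indicator_inter_arith)
          ultimately show ?thesis by (simp add: set_lebesgue_integral_def)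
        qed
      next
        case empty
        then show ?case by (simp add: set_lebesgue_integral_def)
      next
        case (compl A)
        then have A: "A \<in> sets lborel" by (simp add: sigma)
        have "(\<integral>x. v x \<partial>lborel) = 0"
          using integral_box_zero[OF w test ab] by (simp add: v_def)
        moreover have "set_lebesgue_integral lborel (UNIV - A) v = (\<integral>x. v x \<partial>lborel) - set_lebesgue_integral lborel A v"
        proof -
          have i: "integrable lborel (\<lambda>x. indicator A x *\<^sub>R v x)" using integrable_mult_indicator[OF A v] .
          have "set_lebesgue_integral lborel (UNIV - A) v = (\<integral>x. v x - indicator A x *\<^sub>R v x \<partial>lborel)"
            unfolding set_lebesgue_integral_def by (intro Bochner_Integration.integral_cong) (auto simp: indicator_def)
          also have "\<dots> = (\<integral>x. v x \<partial>lborel) - set_lebesgue_integral lborel A v"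
            using i v by (simp add: set_lebesgue_integral_def)
          finally show ?thesis .
        qed
        ultimately show ?case using compl by simp
      next
        case (union A)
        then have A: "A i \<in> sets lborel" for i by (auto simp: sigma)
        have "set_lebesgue_integral lborel (\<Union>i. A i) v = (\<Sum>i. set_lebesgue_integral lborel (A i) v)"
        proof (rule lebesgue_integral_countable_add)
          show "set_integrable lborel (\<Union>i. A i) v"
            unfolding set_integrable_def using A by (intro integrable_mult_indicator v) auto
        qed (use A union in \<open>auto simp: disjoint_family_on_def\<close>)
        then show ?case using union by simp
      qed
    qed
    then have "AE x in lborel. v x = 0" by (intro sigma_finite_measure.density_zero[OF sigma_finite_lborel] v) auto
    then show ?thesis by eventually_elim (auto simp: v_def)
  qed
  show ?thesis
  proof (rule AE_local_open)
    fix z assume "z \<in> S"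
    from open_contains_cbox[OF S this] obtain a b where "cbox a b \<subseteq> S" "z \<in> box a b" .
    then show "\<exists>U. open U \<and> z \<in> U \<and> (AE x in lborel. x \<in> U \<longrightarrow> w x = 0)"
      using box by blast
  qed
qed

text \<open>Extended by zero, the Lebesgue measurable \<open>w\<close> agrees almost everywhere with
  a Borel function, and the Borel version applies to that representative.\<close>

lemma fundamental_lemma:
  fixes w :: "real^'n \<Rightarrow> real"
  assumes S: "open S" and w: "integrable (lebesgue_on S) w"
    and test: "\<And>\<phi> \<phi>'. test_function S \<phi> \<phi>' \<Longrightarrow> (\<integral>x. \<phi> x * w x \<partial>lebesgue_on S) = 0"
  shows "AE x in lebesgue_on S. w x = 0"
proof -
  have Sm: "S \<in> sets lebesgue" using S by simp
  define W where "W x = indicator S x * w x" for x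
  have W: "integrable lebesgue W"
    using w Sm by (simp add: integrable_restrict_space W_def[abs_def])
  then have "W \<in> borel_measurable lebesgue" by simp
  from completion_ex_borel_measurable_real[OF this] obtain v where
    v: "v \<in> borel_measurable lborel" "AE x in lborel. W x = v x" by blast
  have v': "v \<in> borel_measurable lebesgue" "AE x in lebesgue. W x = v x"
    using v by (auto intro: measurable_completion AE_completion)
  have "integrable lebesgue v"
    using integrable_cong_AE_imp[OF W v'(1)] v'(2) by (auto simp: eq_commute)
  then have vi: "integrable lborel v"
    using v(1) by (simp add: integrable_completion)
  have "AE x in lborel. x \<in> S \<longrightarrow> v x = 0"
  proof (rule fundamental_lemma_lborel[OF S vi])
    fix \<phi> \<phi>' assume t: "test_function S \<phi> \<phi>'"
    then have [measurable]: "\<phi> \<in> borel_measurable borel"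
      by (auto simp: test_function_def intro: C1_with_gradient_measurable(1))
    have "(\<integral>x. \<phi> x * v x \<partial>lborel) = (\<integral>x. \<phi> x * v x \<partial>lebesgue)"
      using v(1) by (intro integral_completion[symmetric]) auto
    also have "\<dots> = (\<integral>x. \<phi> x * W x \<partial>lebesgue)"
    proof (rule integral_cong_AE)
      have \<phi>: "\<phi> \<in> borel_measurable lebesgue" by (intro measurable_completion) simp
      show "(\<lambda>x. \<phi> x * v x) \<in> borel_measurable lebesgue" using \<phi> v'(1) by measurable
      show "(\<lambda>x. \<phi> x * W x) \<in> borel_measurable lebesgue" using \<phi> W by measurable
    qed (use v'(2) in auto)
    also have "\<dots> = (\<integral>x. indicator S x *\<^sub>R (\<phi> x * w x) \<partial>lebesgue)"
      by (simp add: W_def mult.left_commute)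
    also have "\<dots> = (\<integral>x. \<phi> x * w x \<partial>lebesgue_on S)"
      using Sm by (intro integral_restrict_space[symmetric]) simp
    finally show "(\<integral>x. \<phi> x * v x \<partial>lborel) = 0" using test[OF t] by simp
  qed
  from AE_completion[OF this] v'(2) have "AE x in lebesgue. x \<in> S \<longrightarrow> w x = 0"
    by eventually_elim (auto simp: W_def)
  then show ?thesis using Sm by (simp add: AE_restrict_space_iff)
qed

subsection \<open>Facets and the prisms erected on them\<close>

definition facet :: "(real^'n) set \<Rightarrow> bool" where
  "facet P \<longleftrightarrow> polytope P \<and> aff_dim P = int CARD('n) - 1"

text \<open>The signed distance from the hyperplane of a facet. Differences of points of a facet are
  orthogonal to its normal, so the value does not depend on the selected base point.\<close>

definition facet_height :: "(real^'n) set \<Rightarrow> real^'n \<Rightarrow> real" where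
  "facet_height P y = (y - (SOME a. a \<in> P)) \<bullet> facet_normal P"

definition facet_proj :: "(real^'n) set \<Rightarrow> real^'n \<Rightarrow> real^'n" where
  "facet_proj P y = y - facet_height P y *\<^sub>R facet_normal P"

text \<open>The prism from \<open>surface_measure\<close>, written through the coordinates of a
  point (foot point and height) instead of as a set of sums, so that subsets of the facet correspond
  to preimages under \<open>facet_proj\<close>.\<close>

definition prism :: "(real^'n) set \<Rightarrow> (real^'n) set" where
  "prism P = {y. facet_proj P y \<in> P \<and> 0 \<le> facet_height P y \<and> facet_height P y \<le> 1}"

text \<open>The affine hull of a facet is a hyperplane \<open>a \<bullet> x = b\<close>, and
  \<open>a\<close> divided by its norm witnesses the choice made in
  \<open>facet_normal\<close>.\<close>

lemma facet_normal:
  fixes P :: "(real^'n) set"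
  assumes "facet P"
  shows "norm (facet_normal P) = 1" "\<And>x y. x \<in> P \<Longrightarrow> y \<in> P \<Longrightarrow> (x - y) \<bullet> facet_normal P = 0"
proof -
  have "aff_dim P = DIM(real^'n) - 1" using assms by (simp add: facet_def)
  then obtain a b where ab: "a \<noteq> 0" "affine hull P = {x. a \<bullet> x = b}"
    using aff_dim_eq_hyperplane[of P, THEN iffD1] by blast
  have "norm (a /\<^sub>R norm a) = 1 \<and> (\<forall>x\<in>P. \<forall>y\<in>P. (x - y) \<bullet> (a /\<^sub>R norm a) = 0)"
  proof (intro conjI ballI)
    fix x y assume "x \<in> P" "y \<in> P"
    then have "x \<in> affine hull P" "y \<in> affine hull P" by (auto intro: hull_inc)
    then show "(x - y) \<bullet> (a /\<^sub>R norm a) = 0" using ab(2) by (simp add: inner_diff_left inner_diff_right inner_commute[of _ a])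
  qed (use ab in simp)
  then have "norm (facet_normal P) = 1 \<and> (\<forall>x\<in>P. \<forall>y\<in>P. (x - y) \<bullet> facet_normal P = 0)"
    unfolding facet_normal_def by (rule someI)
  then show "norm (facet_normal P) = 1" "\<And>x y. x \<in> P \<Longrightarrow> y \<in> P \<Longrightarrow> (x - y) \<bullet> facet_normal P = 0" by blast+
qed

lemma facet_normal_inner_self: "facet P \<Longrightarrow> facet_normal P \<bullet> facet_normal P = 1"
  using facet_normal(1) by (simp add: norm_eq_1)

lemma facet_height_facet:
  assumes "facet P" "x \<in> P"
  shows "facet_height P x = 0"
  unfolding facet_height_def
  by (rule facet_normal(2)[OF assms]) (use assms in \<open>auto intro: someI\<close>)

lemma facet_height_add: "facet_height P (x + v) = facet_height P x + v \<bullet> facet_normal P"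
  by (simp add: facet_height_def algebra_simps inner_diff_left inner_add_left)

lemma facet_height_add_normal:
  "facet P \<Longrightarrow> facet_height P (x + t *\<^sub>R facet_normal P) = facet_height P x + t"
  by (simp add: facet_height_add facet_normal_inner_self)

lemma facet_proj_add_normal:
  "facet P \<Longrightarrow> facet_proj P (x + t *\<^sub>R facet_normal P) = facet_proj P x"
  by (simp add: facet_proj_def facet_height_add_normal algebra_simps)

lemma facet_proj_add_tangent:
  "v \<bullet> facet_normal P = 0 \<Longrightarrow> facet_proj P (x + v) = facet_proj P x + v"
  by (simp add: facet_proj_def facet_height_add)

lemma facet_proj_decompose: "facet_proj P y + facet_height P y *\<^sub>R facet_normal P = y"
  by (simp add: facet_proj_def)

lemma facet_height_proj: "facet P \<Longrightarrow> facet_height P (facet_proj P y) = 0"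
  using facet_height_add_normal[of P "facet_proj P y" "facet_height P y"] facet_proj_decompose[of P y] by simp

lemma facet_proj_height_zero: "facet_height P x = 0 \<Longrightarrow> facet_proj P x = x"
  by (simp add: facet_proj_def)

lemma continuous_on_facet_height [continuous_intros]: "continuous_on A (facet_height P)"
  unfolding facet_height_def by (intro continuous_intros)

lemma continuous_on_facet_proj [continuous_intros]: "continuous_on A (facet_proj P)"
  unfolding facet_proj_def by (intro continuous_intros)

lemma facet_height_measurable [measurable]: "facet_height P \<in> borel_measurable borel"
  by (intro borel_measurable_continuous_onI continuous_intros)

lemma facet_proj_measurable [measurable]: "facet_proj P \<in> borel_measurable borel"
  by (intro borel_measurable_continuous_onI continuous_intros)

text \<open>Turns the area formula of \<open>surface_measure\<close> into the volume of a preimage.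
  Each facet thus contributes the image under \<open>facet_proj\<close> of the volume on its
  prism.\<close>

lemma prism_eq_image:
  assumes "facet P"
  shows "{x + t *\<^sub>R facet_normal P | x t. x \<in> A \<inter> P \<and> 0 \<le> t \<and> t \<le> 1} = prism P \<inter> facet_proj P -` A"
proof (intro set_eqI iffI)
  fix y assume "y \<in> {x + t *\<^sub>R facet_normal P | x t. x \<in> A \<inter> P \<and> 0 \<le> t \<and> t \<le> 1}"
  then obtain x t where xt: "y = x + t *\<^sub>R facet_normal P" "x \<in> A" "x \<in> P" "0 \<le> t" "t \<le> 1" by blast
  have "facet_height P x = 0" using facet_height_facet[OF assms] xt by simp
  then show "y \<in> prism P \<inter> facet_proj P -` A"
    using xt assms by (simp add: prism_def facet_proj_add_normal facet_height_add_normal facet_proj_height_zero)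
next
  fix y assume "y \<in> prism P \<inter> facet_proj P -` A"
  then show "y \<in> {x + t *\<^sub>R facet_normal P | x t. x \<in> A \<inter> P \<and> 0 \<le> t \<and> t \<le> 1}"
    using facet_proj_decompose[of P y]
    by (auto simp: prism_def intro!: exI[of _ "facet_proj P y"] exI[of _ "facet_height P y"])
qed

lemma compact_prism:
  assumes "facet P" shows "compact (prism P)"
proof -
  have "prism P = {x + t *\<^sub>R facet_normal P | x t. x \<in> P \<and> 0 \<le> t \<and> t \<le> 1}"
    using prism_eq_image[OF assms, of UNIV] by simp
  also have "\<dots> = (\<lambda>(x, t). x + t *\<^sub>R facet_normal P) ` (P \<times> {0..1})"
    by (intro set_eqI) (simp add: image_def Bex_def, metis)
  finally have "prism P = (\<lambda>(x, t). x + t *\<^sub>R facet_normal P) ` (P \<times> {0..1})" .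
  moreover have "compact P" using assms by (simp add: facet_def polytope_imp_compact)
  ultimately show ?thesis
    by (auto intro!: compact_continuous_image compact_Times continuous_intros simp: split_beta')
qed

text \<open>The prism is the Minkowski sum of the facet and a segment. Convexity is wanted because
  convex sets have negligible frontier, which is how almost every point of the prism becomes an
  interior point.\<close>

lemma convex_prism:
  assumes "facet P" shows "convex (prism P)"
proof -
  have "prism P = {x + t *\<^sub>R facet_normal P | x t. x \<in> P \<and> 0 \<le> t \<and> t \<le> 1}"
    using prism_eq_image[OF assms, of UNIV] by simp
  also have "\<dots> = (\<Union>x\<in>P. \<Union>y\<in>(\<lambda>t. t *\<^sub>R facet_normal P) ` {0..1}. {x + y})"
    by (intro set_eqI) (simp add: Bex_def, metis)
  finally have "prism P = (\<Union>x\<in>P. \<Union>y\<in>(\<lambda>t. t *\<^sub>R facet_normal P) ` {0..1}. {x + y})" .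
  moreover have "convex P" using assms by (simp add: facet_def polytope_imp_convex)
  moreover have "convex ((\<lambda>t. t *\<^sub>R facet_normal P) ` {0..1::real})"
    by (intro convex_linear_image) (auto intro: bounded_linear.linear bounded_linear_scaleR_left)
  ultimately show ?thesis using convex_sums by metis
qed

lemma prism_sets [measurable]: "facet P \<Longrightarrow> prism P \<in> sets borel"
  by (simp add: borel_compact compact_prism)

lemma emeasure_prism_finite: "facet P \<Longrightarrow> emeasure lborel (prism P) < \<infinity>"
  by (intro emeasure_compact_finite compact_prism)

text \<open>Integrals over a facet are integrals over its prism of functions that are constant along the normal.\<close>

definition prism_measure :: "(real^'n) set \<Rightarrow> (real^'n) measure" where
  "prism_measure P = restrict_space lborel (prism P)"

lemma prism_measure_simps:
  "space (prism_measure P) = prism P"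
  by (simp add: prism_measure_def space_restrict_space)

lemma finite_measure_prism: "facet P \<Longrightarrow> finite_measure (prism_measure P)"
  using emeasure_prism_finite[of P] prism_sets[of P]
  by (intro finite_measureI) (simp add: prism_measure_def space_restrict_space emeasure_restrict_space)

lemma measurable_prism_measure: "f \<in> borel_measurable borel \<Longrightarrow> f \<in> borel_measurable (prism_measure P)"
  unfolding prism_measure_def by (intro measurable_restrict_space1) simp

lemma facet_proj_prism_measurable: "facet_proj P \<in> measurable (prism_measure P) borel"
  by (intro measurable_prism_measure) simp

lemma AE_prism_measure:
  "facet P \<Longrightarrow> (AE y in prism_measure P. Q y) \<longleftrightarrow> (AE y in lborel. y \<in> prism P \<longrightarrow> Q y)"
  unfolding prism_measure_def using prism_sets[of P] by (intro AE_restrict_space_iff) simp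

lemma emeasure_distr_prism:
  assumes "facet P" "A \<in> sets borel"
  shows "emeasure (distr (prism_measure P) borel (facet_proj P)) A = emeasure lborel (prism P \<inter> facet_proj P -` A)"
proof -
  have "facet_proj P -` A \<in> sets borel" using measurable_sets_borel[OF facet_proj_measurable assms(2)] .
  then show ?thesis
    using assms facet_proj_prism_measurable[of P] prism_sets[OF assms(1)]
    by (simp add: emeasure_distr prism_measure_simps Int_commute) 
      (simp add: prism_measure_def emeasure_restrict_space Int_commute)
qed

subsection \<open>The surface measure\<close>

lemma sets_surface_measure [simp, measurable_cong]: "sets (surface_measure F) = sets borel"
  using sets.sigma_sets_eq[of borel] by (simp add: surface_measure_def)

lemma space_surface_measure [simp]: "space (surface_measure F) = UNIV"
  by (simp add: surface_measure_def space_measure_of_conv)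

text \<open>\<open>measure_of\<close> returns the prescribed values only if they form a measure.
  Positivity and countable additivity are inherited from the image measures of the prisms, whose sum
  the prescribed set function is.\<close>

lemma emeasure_surface_measure:
  assumes "\<And>P. P \<in> F \<Longrightarrow> facet P" "A \<in> sets borel"
  shows "emeasure (surface_measure F) A = (\<Sum>P\<in>F. emeasure (distr (prism_measure P) borel (facet_proj P)) A)"
proof -
  define \<mu> where "\<mu> A = (\<Sum>P\<in>F. emeasure lborel {x + t *\<^sub>R facet_normal P | x t. x \<in> A \<inter> P \<and> 0 \<le> t \<and> t \<le> 1})" for A
  have \<mu>: "\<mu> A = (\<Sum>P\<in>F. emeasure (distr (prism_measure P) borel (facet_proj P)) A)" if "A \<in> sets borel" for A
    unfolding \<mu>_def using assms(1) that by (intro sum.cong refl) (simp only: emeasure_distr_prism prism_eq_image)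
  have "emeasure (surface_measure F) A = \<mu> A"
  proof (rule emeasure_measure_of)
    show "surface_measure F = measure_of UNIV (sets borel) \<mu>"
      by (simp add: surface_measure_def \<mu>_def[abs_def])
    show "positive (sets (surface_measure F)) \<mu>" by (simp add: positive_def \<mu>)
    show "countably_additive (sets (surface_measure F)) \<mu>"
    proof (rule countably_additiveI)
      fix A :: "nat \<Rightarrow> (real^'a) set"
      assume A: "range A \<subseteq> sets (surface_measure F)" "disjoint_family A" "(\<Union>i. A i) \<in> sets (surface_measure F)"
      then have Ai: "A i \<in> sets borel" for i by auto
      have "(\<Sum>i. \<mu> (A i)) = (\<Sum>P\<in>F. \<Sum>i. emeasure (distr (prism_measure P) borel (facet_proj P)) (A i))"
        by (simp add: \<mu>[OF Ai] suminf_sum)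
      also have "\<dots> = (\<Sum>P\<in>F. emeasure (distr (prism_measure P) borel (facet_proj P)) (\<Union>i. A i))"
        using A by (intro sum.cong refl suminf_emeasure) auto
      finally show "(\<Sum>i. \<mu> (A i)) = \<mu> (\<Union>i. A i)" using A by (simp add: \<mu>)
    qed
  qed (use assms in auto)
  then show ?thesis using \<mu> assms(2) by simp
qed

lemma AE_surface_measureI:
  assumes F: "\<And>P. P \<in> F \<Longrightarrow> facet P" "finite F" and Q: "{x. Q x} \<in> sets borel"
    and AE: "\<And>P. P \<in> F \<Longrightarrow> AE y in prism_measure P. Q (facet_proj P y)"
  shows "AE x in surface_measure F. Q x"
proof -
  have Q': "{x. \<not> Q x} \<in> sets borel" using borel_comp[OF Q] by (simp add: Collect_neg_eq)
  have "emeasure (distr (prism_measure P) borel (facet_proj P)) {x. \<not> Q x} = 0" if "P \<in> F" for P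
  proof -
    have "AE x in distr (prism_measure P) borel (facet_proj P). Q x"
      using AE[OF that] Q by (subst AE_distr_iff) (auto intro: facet_proj_prism_measurable)
    then show ?thesis using Q' by (subst (asm) AE_iff_measurable[OF _ refl]) auto
  qed
  then have "emeasure (surface_measure F) {x. \<not> Q x} = 0"
    using emeasure_surface_measure[OF F(1) Q'] by simp
  then show ?thesis using Q' by (intro AE_I[of _ _ "{x. \<not> Q x}"]) auto
qed

lemma finite_surface_measure:
  assumes F: "\<And>P. P \<in> F \<Longrightarrow> facet P" "finite F"
  shows "finite_measure (surface_measure F)"
proof (rule finite_measureI)
  have "emeasure (surface_measure F) UNIV < \<infinity>"
    using emeasure_prism_finite[OF F(1)] F(2)
    by (simp add: emeasure_surface_measure[OF F(1)] emeasure_distr_prism[OF F(1)])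
  then show "emeasure (surface_measure F) (space (surface_measure F)) \<noteq> \<infinity>" by simp
qed

text \<open>The image measure of one prism is a summand of the surface measure and hence lies below
  it. Square integrability and convergence on the boundary thereby pass to every single
  prism.\<close>

lemma nn_integral_prism_le:
  assumes F: "\<And>P. P \<in> F \<Longrightarrow> facet P" "finite F" "P \<in> F" and h: "h \<in> borel_measurable borel"
  shows "(\<integral>\<^sup>+ y. h (facet_proj P y) \<partial>prism_measure P) \<le> (\<integral>\<^sup>+ x. h x \<partial>surface_measure F)"
proof -
  have "(\<integral>\<^sup>+ y. h (facet_proj P y) \<partial>prism_measure P) = (\<integral>\<^sup>+ x. h x \<partial>distr (prism_measure P) borel (facet_proj P))"
    using h by (intro nn_integral_distr[symmetric] facet_proj_prism_measurable) simp
  also have "\<dots> \<le> (\<integral>\<^sup>+ x. h x \<partial>surface_measure F)"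
  proof (rule nn_integral_mono_measure)
    show "distr (prism_measure P) borel (facet_proj P) \<le> surface_measure F"
    proof (subst le_measure, simp, rule ballI)
      fix A assume "A \<in> sets (distr (prism_measure P) borel (facet_proj P))"
      then have A: "A \<in> sets borel" by simp
      show "emeasure (distr (prism_measure P) borel (facet_proj P)) A \<le> emeasure (surface_measure F) A"
        using F(2,3) by (subst emeasure_surface_measure[OF F(1) A]) (auto intro: member_le_sum)
    qed
  qed simp
  finally show ?thesis .
qed

lemma L2_prism:
  fixes g :: "real^'n \<Rightarrow> 'b::euclidean_space"
  assumes F: "\<And>P. P \<in> F \<Longrightarrow> facet P" "finite F" "P \<in> F" and g: "g \<in> L2 (surface_measure F)"
  shows "(\<lambda>y. g (facet_proj P y)) \<in> L2 (prism_measure P)"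
    "(\<integral>y. (norm (g (facet_proj P y)))\<^sup>2 \<partial>prism_measure P) \<le> (\<integral>x. (norm (g x))\<^sup>2 \<partial>surface_measure F)"
proof -
  have g': "g \<in> borel_measurable borel" using L2_measurable[OF g] measurable_cong_sets[OF sets_surface_measure refl] by blast
  note [measurable] = g'
  have gm: "(\<lambda>y. g (facet_proj P y)) \<in> borel_measurable (prism_measure P)"
    by (intro measurable_prism_measure) simp
  have le: "(\<integral>\<^sup>+ y. ennreal ((norm (g (facet_proj P y)))\<^sup>2) \<partial>prism_measure P) \<le> (\<integral>\<^sup>+ x. ennreal ((norm (g x))\<^sup>2) \<partial>surface_measure F)"
    by (rule nn_integral_prism_le[OF F]) (use g' in measurable)
  have eq: "(\<integral>\<^sup>+ x. ennreal ((norm (g x))\<^sup>2) \<partial>surface_measure F) = ennreal (\<integral>x. (norm (g x))\<^sup>2 \<partial>surface_measure F)"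
    by (intro nn_integral_eq_integral L2_integrable_sq g) simp
  have int: "integrable (prism_measure P) (\<lambda>y. (norm (g (facet_proj P y)))\<^sup>2)"
  proof (rule integrableI_bounded)
    show "(\<integral>\<^sup>+ y. ennreal (norm ((norm (g (facet_proj P y)))\<^sup>2)) \<partial>prism_measure P) < \<infinity>"
      using le eq by (simp add: le_less_trans)
  qed (use gm in measurable)
  then show "(\<lambda>y. g (facet_proj P y)) \<in> L2 (prism_measure P)"
    using gm by (simp add: L2_def)
  have "ennreal (\<integral>y. (norm (g (facet_proj P y)))\<^sup>2 \<partial>prism_measure P) \<le> ennreal (\<integral>x. (norm (g x))\<^sup>2 \<partial>surface_measure F)"
    using le int by (simp add: eq nn_integral_eq_integral)
  then show "(\<integral>y. (norm (g (facet_proj P y)))\<^sup>2 \<partial>prism_measure P) \<le> (\<integral>x. (norm (g x))\<^sup>2 \<partial>surface_measure F)"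
    by simp
qed

lemma L2_tendsto_prism:
  fixes g :: "real^'n \<Rightarrow> 'b::euclidean_space"
  assumes F: "\<And>P. P \<in> F \<Longrightarrow> facet P" "finite F" "P \<in> F" and g: "L2_tendsto (surface_measure F) f g"
  shows "L2_tendsto (prism_measure P) (\<lambda>k y. f k (facet_proj P y)) (\<lambda>y. g (facet_proj P y))"
proof -
  note f = L2_tendstoD[OF g]
  have "(\<lambda>k. \<integral>y. (norm (f k (facet_proj P y) - g (facet_proj P y)))\<^sup>2 \<partial>prism_measure P) \<longlonglongrightarrow> 0"
  proof (rule tendsto_sandwich[OF _ _ tendsto_const f(3)])
    show "\<forall>\<^sub>F k in sequentially. (\<integral>y. (norm (f k (facet_proj P y) - g (facet_proj P y)))\<^sup>2 \<partial>prism_measure P)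
      \<le> (\<integral>x. (norm (f k x - g x))\<^sup>2 \<partial>surface_measure F)"
      using L2_prism(2)[OF F L2_diff[OF f(1,2)]] by simp
  qed simp
  then show ?thesis
    unfolding L2_tendsto_def by (intro conjI allI L2_prism(1)[OF F] f)
qed

section \<open>Null sets of a prism: edges, other facets and the two bases\<close>

lemma AE_not_hyperplane:
  fixes c :: "'a::euclidean_space"
  assumes "c \<noteq> 0" shows "AE y in lborel. c \<bullet> y \<noteq> b"
proof -
  have "{y. c \<bullet> y = b} \<in> null_sets lebesgue"
    using negligible_hyperplane[of c b] assms negligible_iff_null_sets by blast
  then have "AE y in lebesgue. y \<notin> {y. c \<bullet> y = b}" by (rule AE_not_in)
  then show ?thesis by (simp add: AE_completion_iff)
qed

lemma AE_facet_height_neq: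
  assumes "facet P" shows "AE y in lborel. facet_height P y \<noteq> c"
  using AE_not_hyperplane[of "facet_normal P" "c + (SOME a. a \<in> P) \<bullet> facet_normal P"] facet_normal(1)[OF assms]
  by (force simp: facet_height_def inner_diff_left inner_diff_right inner_commute[of "facet_normal P"])

lemma AE_prism_interior:
  assumes "facet P" shows "AE y in prism_measure P. y \<in> interior (prism P)"
proof -
  have "frontier (prism P) \<in> null_sets lebesgue"
    using negligible_convex_frontier[OF convex_prism[OF assms]] negligible_iff_null_sets by blast
  then have "AE y in lebesgue. y \<notin> frontier (prism P)" by (rule AE_not_in)
  then have "AE y in lborel. y \<notin> frontier (prism P)" by (simp add: AE_completion_iff)
  then show ?thesis
    unfolding AE_prism_measure[OF assms]
    by eventually_elim (auto simp: frontier_def dest: closure_subset[THEN subsetD])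
qed

text \<open>A ball around an interior point of the prism, cut at the height of that point and
  lowered to height 0, is a disc contained in \<open>P\<close>. Interior points of the prism thus
  take over the role of the relative interior of the facet.\<close>

lemma AE_prism_relative_interior:
  assumes "facet P"
  shows "AE y in prism_measure P. \<exists>r>0. \<forall>z. facet_height P z = 0 \<longrightarrow> dist (facet_proj P y) z < r \<longrightarrow> z \<in> P"
  using AE_prism_interior[OF assms]
proof eventually_elim
  case (elim y)
  then obtain r where r: "r > 0" "ball y r \<subseteq> prism P" by (auto simp: mem_interior)
  have "z \<in> P" if "facet_height P z = 0" "dist (facet_proj P y) z < r" for z
  proof -
    \<comment> \<open>Lifting \<open>z\<close> to the height of \<open>y\<close> makes its distance
      to \<open>y\<close> equal to the distance of the foot points.\<close>
    let ?z = "z + facet_height P y *\<^sub>R facet_normal P"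
    have "dist y ?z = dist (facet_proj P y) z"
      using facet_proj_decompose[of P y] by (metis dist_add_cancel2)
    then have "?z \<in> prism P" using r that by auto
    then show "z \<in> P"
      using that(1) assms by (simp add: prism_def facet_proj_add_normal facet_proj_height_zero)
  qed
  then show ?case using r by blast
qed

text \<open>A point with foot point in \<open>P \<inter> Q\<close> lies in the affine hull of
  \<open>P \<inter> Q\<close> and one further point, a unit normal step away from some
  \<open>a\<close> in it. The extra point raises the dimension by at most one, so this hull is still
  contained in a hyperplane, which has volume zero.\<close>

lemma AE_prism_not_lowdim:
  fixes P Q :: "(real^'n) set"
  assumes P: "facet P" and Q: "aff_dim (P \<inter> Q) < int CARD('n) - 1" "closed Q"
  shows "AE y in prism_measure P. facet_proj P y \<notin> Q"
proof (cases "P \<inter> Q = {}")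
  case True
  have "\<And>y. y \<in> prism P \<Longrightarrow> facet_proj P y \<notin> Q" using True by (auto simp: prism_def)
  then show ?thesis by (intro AE_I2) (simp add: prism_measure_simps)
next
  case False
  then obtain a where a: "a \<in> P" "a \<in> Q" by blast
  let ?S = "insert (a + facet_normal P) (P \<inter> Q)"
  have "aff_dim ?S \<le> aff_dim (P \<inter> Q) + 1" by (simp add: aff_dim_insert)
  then have "aff_dim (affine hull ?S) < DIM(real^'n)" using Q by simp
  then obtain c b where cb: "c \<noteq> 0" "affine hull ?S \<subseteq> {x. c \<bullet> x = b}"
    by (rule aff_lowdim_subset_hyperplane)
  from AE_not_hyperplane[OF cb(1), of b] show ?thesis
    unfolding AE_prism_measure[OF P]
  proof eventually_elim
    case (elim y)
    show ?case
    proof (intro impI notI)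
      assume y: "y \<in> prism P" "facet_proj P y \<in> Q"
      have "facet_proj P y + facet_height P y *\<^sub>R ((a + facet_normal P) - a) \<in> affine hull ?S"
        using y a by (intro mem_affine_3_minus affine_affine_hull hull_inc) (auto simp: prism_def)
      then have "y \<in> affine hull ?S" using facet_proj_decompose[of P y] by simp
      then show False using cb elim by blast
    qed
  qed
qed

subsection \<open>Integrals of directional derivatives\<close>

lemma integral_lborel_translate:
  fixes f :: "'a::euclidean_space \<Rightarrow> real"
  assumes "f \<in> borel_measurable borel"
  shows "(\<integral>x. f (x + c) \<partial>lborel) = (\<integral>x. f x \<partial>lborel)"
proof -
  have "(\<integral>x. f x \<partial>lborel) = (\<integral>x. f x \<partial>distr lborel borel ((+) c))"
    by (simp add: lborel_distr_plus)
  also have "\<dots> = (\<integral>x. f (c + x) \<partial>lborel)"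
    using assms by (intro integral_distr) auto
  finally show ?thesis by (simp add: add.commute)
qed

lemma integrable_bounded_support:
  fixes f :: "'a::euclidean_space \<Rightarrow> real"
  assumes "f \<in> borel_measurable borel" "\<And>x. \<bar>f x\<bar> \<le> B" "\<And>x. norm x > R \<Longrightarrow> f x = 0"
  shows "integrable lborel f"
proof (rule Bochner_Integration.integrable_bound)
  show "integrable lborel (\<lambda>x. B * indicator (cball (0::'a) R) x)"
    using emeasure_compact_finite[of "cball (0::'a) R"] by (intro integrable_mult_right integrable_real_indicator) auto
  show "AE x in lborel. norm (f x) \<le> norm (B * indicator (cball 0 R) x)"
  proof (rule AE_I2)
    fix x
    show "norm (f x) \<le> norm (B * indicator (cball 0 R) x)"
      using assms(2)[of x] assms(3)[of x] by (cases "norm x > R") auto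
  qed
qed (use assms in auto)

lemma bounded_compact_support:
  fixes f :: "'a::topological_space \<Rightarrow> 'b::real_normed_vector"
  assumes "continuous_on UNIV f" "compact K" "\<And>x. x \<notin> K \<Longrightarrow> f x = 0"
  shows "\<exists>B. \<forall>x. norm (f x) \<le> B"
proof -
  have "bounded (f ` K)"
    by (intro compact_imp_bounded compact_continuous_image continuous_on_subset[OF assms(1)] assms(2) subset_UNIV)
  then obtain M where M: "\<forall>x\<in>K. norm (f x) \<le> M" by (auto simp: bounded_iff)
  have "norm (f x) \<le> max 0 M" for x using M assms(3)[of x] by (cases "x \<in> K") (auto simp: le_max_iff_disj)
  then show ?thesis by blast
qed

lemma integrable_compact_support:
  fixes f :: "'a::euclidean_space \<Rightarrow> real"
  assumes "continuous_on UNIV f" "compact K" "\<And>x. x \<notin> K \<Longrightarrow> f x = 0"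
  shows "integrable lborel f"
proof -
  obtain B where B: "\<forall>x. norm (f x) \<le> B" using bounded_compact_support[OF assms] by blast
  obtain R where R: "\<forall>x\<in>K. norm x \<le> R" using compact_imp_bounded[OF assms(2)] by (auto simp: bounded_iff)
  show ?thesis
  proof (rule integrable_bounded_support)
    show "f x = 0" if "norm x > R" for x using assms(3)[of x] R that by fastforce
  qed (use B assms(1) in \<open>auto intro: borel_measurable_continuous_onI\<close>)
qed

text \<open>The difference quotients of a function have integral zero by translation invariance, so dominated
  convergence gives the result without iterated integrals.\<close>

lemma integral_direction_derivative_zero:
  fixes E E' :: "'a::euclidean_space \<Rightarrow> real"
  assumes E: "E \<in> borel_measurable borel" "integrable lborel E"
    and E': "E' \<in> borel_measurable borel"
    and supp: "\<And>x. norm x > R \<Longrightarrow> E x = 0"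
    and lip: "\<And>x t. \<bar>E (x + t *\<^sub>R e) - E x\<bar> \<le> L * \<bar>t\<bar>"
    and deriv: "AE x in lborel. ((\<lambda>t. E (x + t *\<^sub>R e)) has_real_derivative E' x) (at 0)"
  shows "(\<integral>x. E' x \<partial>lborel) = 0"
proof -
  \<comment> \<open>Increments of size at most 1 keep all difference quotients supported in the one
    ball of radius \<open>R + norm e\<close>, which gives an integrable majorant.\<close>
  define h where "h k = inverse (real (Suc k))" for k
  have h: "h k > 0" "h k \<le> 1" for k by (auto simp: h_def field_simps)
  define D where "D k x = (E (x + h k *\<^sub>R e) - E x) / h k" for k x
  note [measurable] = E(1) E'
  have Dm: "D k \<in> borel_measurable borel" for k unfolding D_def by measurable
  have translated: "integrable lborel (\<lambda>x. E (x + c))" for c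
  proof -
    have "integrable (distr lborel borel ((+) c)) E" using E by (simp add: lborel_distr_plus)
    then show ?thesis by (subst (asm) integrable_distr_eq) (auto simp: add.commute)
  qed
  have D0: "(\<integral>x. D k x \<partial>lborel) = 0" for k
    unfolding D_def using translated E integral_lborel_translate[OF E(1)] by simp
  have bound: "\<bar>D k x\<bar> \<le> L" for k x
    using lip[of x "h k"] h[of k] by (simp add: D_def field_simps)
  have L: "L \<ge> 0" using bound[of 0 0] by linarith
  have D_supp: "D k x = 0" if "norm x > R + norm e" for k x
  proof -
    have "norm (h k *\<^sub>R e) \<le> 1 * norm e" using h[of k] unfolding norm_scaleR by (intro mult_right_mono) auto
    then have "norm (x + h k *\<^sub>R e) > R" using that norm_diff_ineq[of x "h k *\<^sub>R e"] by simp
    moreover have "norm x > R" using that norm_ge_zero[of e] by linarith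
    ultimately show ?thesis by (simp add: D_def supp)
  qed
  have "(\<lambda>k. \<integral>x. D k x \<partial>lborel) \<longlonglongrightarrow> (\<integral>x. E' x \<partial>lborel)"
  proof (rule integral_dominated_convergence)
    show "integrable lborel (\<lambda>x. L * indicator (cball (0::'a) (R + norm e)) x)"
      using emeasure_compact_finite[of "cball (0::'a) (R + norm e)"]
      by (intro integrable_mult_right integrable_real_indicator) auto
    show "AE x in lborel. norm (D k x) \<le> L * indicator (cball 0 (R + norm e)) x" for k
    proof (rule AE_I2)
      fix x :: 'a
      show "norm (D k x) \<le> L * indicator (cball 0 (R + norm e)) x"
        using bound[of k x] D_supp[of x k] by (cases "norm x > R + norm e") (auto simp: indicator_def)
    qed
    show "AE x in lborel. (\<lambda>k. D k x) \<longlonglongrightarrow> E' x"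
      using deriv
    proof eventually_elim
      case (elim x)
      then have "((\<lambda>t. (E (x + t *\<^sub>R e) - E x) / t) \<longlongrightarrow> E' x) (at 0)"
        by (simp add: has_field_derivative_iff)
      moreover have "filterlim h (at 0) sequentially"
        unfolding filterlim_at using h(1) LIMSEQ_inverse_real_of_nat
        by (auto simp: h_def[abs_def] intro!: always_eventually)
      ultimately show ?case
        unfolding D_def by (rule filterlim_compose)
    qed
  qed (use Dm in auto)
  then show ?thesis by (simp add: D0 LIMSEQ_const_iff)
qed

lemma line_derivative_lipschitz:
  fixes E E' :: "'a::real_normed_vector \<Rightarrow> real"
  assumes deriv: "\<And>x. ((\<lambda>t. E (x + t *\<^sub>R e)) has_real_derivative E' x) (at 0)"
    and bound: "\<And>x. \<bar>E' x\<bar> \<le> L"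
  shows "\<bar>E (x + t *\<^sub>R e) - E x\<bar> \<le> L * \<bar>t\<bar>"
proof -
  have d: "((\<lambda>t. E (x + t *\<^sub>R e)) has_real_derivative E' (x + t *\<^sub>R e)) (at t)" for t
    using DERIV_shift[of "\<lambda>t. E (x + t *\<^sub>R e)" "E' (x + t *\<^sub>R e)" 0 t] deriv[of "x + t *\<^sub>R e"]
    by (simp add: algebra_simps)
  have "norm (E (x + t *\<^sub>R e) - E (x + 0 *\<^sub>R e)) \<le> L * norm (t - 0)"
    by (rule field_differentiable_bound[of UNIV "\<lambda>t. E (x + t *\<^sub>R e)" "\<lambda>t. E' (x + t *\<^sub>R e)"])
      (use d bound in \<open>auto intro: has_field_derivative_at_within\<close>)
  then show ?thesis by simp
qed

lemma line_derivative_compact_support: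
  fixes E E' :: "'a::euclidean_space \<Rightarrow> real"
  assumes deriv: "\<And>x. ((\<lambda>t. E (x + t *\<^sub>R e)) has_real_derivative E' x) (at 0)"
    and cont: "continuous_on UNIV E'"
    and K: "compact K" "\<And>x. x \<notin> K \<Longrightarrow> E x = 0"
  obtains L where "\<And>x. \<bar>E' x\<bar> \<le> L" "\<And>x t. \<bar>E (x + t *\<^sub>R e) - E x\<bar> \<le> L * \<bar>t\<bar>"
proof -
  have "E' x = 0" if "x \<notin> K" for x
  proof -
    have "open (- K)" using K by (simp add: compact_imp_closed open_Compl)
    then have o: "open ((\<lambda>t. x + t *\<^sub>R e) -` (- K))"
      by (rule open_vimage) (intro continuous_intros)
    have "((\<lambda>t. E (x + t *\<^sub>R e)) has_real_derivative 0) (at 0)"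
      by (rule has_field_derivative_transform_within_open[OF DERIV_const[of 0] o]) (use that K(2) in auto)
    then show ?thesis using DERIV_unique[OF deriv] by blast
  qed
  then obtain L where "\<forall>x. norm (E' x) \<le> L"
    using bounded_compact_support[OF cont K(1)] by blast
  then have "\<bar>E' x\<bar> \<le> L" for x by simp
  then show ?thesis using line_derivative_lipschitz[of E e E', OF deriv] that by blast
qed

lemma integral_direction_derivative_compact_support:
  fixes E E' :: "'a::euclidean_space \<Rightarrow> real"
  assumes deriv: "\<And>x. ((\<lambda>t. E (x + t *\<^sub>R e)) has_real_derivative E' x) (at 0)"
    and cont: "continuous_on UNIV E" "continuous_on UNIV E'"
    and K: "compact K" "\<And>x. x \<notin> K \<Longrightarrow> E x = 0"
  shows "(\<integral>x. E' x \<partial>lborel) = 0"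
proof -
  obtain L where L: "\<And>x. \<bar>E' x\<bar> \<le> L" "\<And>x t. \<bar>E (x + t *\<^sub>R e) - E x\<bar> \<le> L * \<bar>t\<bar>"
    using line_derivative_compact_support[OF deriv cont(2) K] by metis
  obtain R where R: "\<And>x. x \<in> K \<Longrightarrow> norm x \<le> R"
    using compact_imp_bounded[OF K(1)] by (auto simp: bounded_iff)
  have supp: "E x = 0" if "norm x > R" for x using K(2) R that by fastforce
  have m: "E \<in> borel_measurable borel" "E' \<in> borel_measurable borel"
    using cont by (auto intro: borel_measurable_continuous_onI)
  show ?thesis
    by (rule integral_direction_derivative_zero[OF m(1) integrable_compact_support[OF cont(1) K] m(2) supp L(2)])
      (use deriv in auto)
qed

lemma C1_with_gradient_line_derivative:
  assumes "C1_with_gradient F F'"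
  shows "((\<lambda>t. F (x + t *\<^sub>R e)) has_real_derivative F' x \<bullet> e) (at 0)"
proof -
  have F: "(F has_derivative (\<lambda>h. h \<bullet> F' x)) (at (x + 0 *\<^sub>R e))"
    using assms by (simp add: C1_with_gradient_def gderiv_def)
  have "((\<lambda>t. x + t *\<^sub>R e) has_derivative (\<lambda>t. t *\<^sub>R e)) (at 0)"
    by (auto intro!: derivative_eq_intros)
  from has_derivative_compose[OF this F]
  show ?thesis by (simp add: has_field_derivative_def inner_commute mult_commute_abs)
qed

lemma C1_with_gradient_compact_support:
  assumes F: "C1_with_gradient F F'" and K: "compact K" "\<And>x. x \<notin> K \<Longrightarrow> F x = 0"
  shows "x \<notin> K \<Longrightarrow> F' x = 0" "integrable lborel (\<lambda>x. norm (F' x))"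
proof -
  have F'0: "F' x = 0" if "x \<notin> K" for x
  proof -
    have "open (- K)" using K by (simp add: compact_imp_closed open_Compl)
    then have "(F has_derivative (\<lambda>_. 0)) (at x)"
      by (rule has_derivative_transform_within_open[OF has_derivative_const[of 0]]) (use that K(2) in auto)
    moreover have "(F has_derivative (\<lambda>h. h \<bullet> F' x)) (at x)"
      using F by (simp add: C1_with_gradient_def gderiv_def)
    ultimately have "(\<lambda>h. h \<bullet> F' x) = (\<lambda>_. 0)" by (rule has_derivative_unique[rotated])
    then have "F' x \<bullet> F' x = 0" by meson
    then show ?thesis by simp
  qed
  then show "x \<notin> K \<Longrightarrow> F' x = 0" .
  show "integrable lborel (\<lambda>x. norm (F' x))"
    by (rule integrable_compact_support[OF _ K(1)]) (use F'0 C1_with_gradient_continuous[OF F] in \<open>auto intro: continuous_on_norm\<close>)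
qed

subsection \<open>The divergence theorem for a half space\<close>

text \<open>The flux through the hyperplane is expressed as the integral of \<open>F\<close>
  composed with the projection over a slab of height one, in the way \<open>surface_measure\<close>
  counts area. From \<open>F\<close> on the half space one subtracts its boundary values times a
  cutoff that decreases linearly in the height. The remainder vanishes on the hyperplane and extends
  by zero, and the integral of its normal derivative, which is zero, is the sum of the two integrals
  in question.\<close>

lemma half_space_divergence:
  assumes P: "facet P" and F: "C1_with_gradient F F'" and K: "compact K" "\<And>x. x \<notin> K \<Longrightarrow> F x = 0"
  shows "(\<integral>y. indicator {y. facet_height P y > 0} y * (F' y \<bullet> facet_normal P) \<partial>lborel)
    = - (\<integral>y. indicator {y. 0 < facet_height P y \<and> facet_height P y < 1} y * F (facet_proj P y) \<partial>lborel)"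
proof -
  define h \<pi> \<nu> where "h = facet_height P" and "\<pi> = facet_proj P" and "\<nu> = facet_normal P"
  have h_add: "h (y + t *\<^sub>R \<nu>) = h y + t" and pi_add: "\<pi> (y + t *\<^sub>R \<nu>) = \<pi> y" for y t
    using P by (simp_all add: h_def \<pi>_def \<nu>_def facet_height_add_normal facet_proj_add_normal)
  have decomp: "\<pi> y + h y *\<^sub>R \<nu> = y" for y by (simp add: h_def \<pi>_def \<nu>_def facet_proj_decompose)
  note Fc = C1_with_gradient_continuous[OF F]
  note [measurable] = C1_with_gradient_measurable[OF F]
  have [measurable]: "h \<in> borel_measurable borel" "\<pi> \<in> borel_measurable borel"
    by (simp_all add: h_def \<pi>_def)
  have dF: "((\<lambda>t. F (x + t *\<^sub>R \<nu>)) has_real_derivative F' x \<bullet> \<nu>) (at 0)" for x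
    by (rule C1_with_gradient_line_derivative[OF F])
  have "continuous_on UNIV (\<lambda>x. F' x \<bullet> \<nu>)" using Fc by (intro continuous_intros)
  then obtain L where L: "\<And>x. \<bar>F' x \<bullet> \<nu>\<bar> \<le> L" "\<And>x t. \<bar>F (x + t *\<^sub>R \<nu>) - F x\<bar> \<le> L * \<bar>t\<bar>"
    using line_derivative_compact_support[OF dF _ K] by metis
  obtain R where R: "\<And>x. x \<in> K \<Longrightarrow> norm x \<le> R"
    using compact_imp_bounded[OF K(1)] by (auto simp: bounded_iff)
  have F_supp: "F x = 0" if "norm x > R" for x using K(2) R that by fastforce
  obtain B where "\<forall>x. norm (F x) \<le> B" using bounded_compact_support[OF Fc(1) K] by blast
  then have B: "\<bar>F x\<bar> \<le> B" for x by simp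
  have B0: "B \<ge> 0" using B[of 0] by linarith
  have L0: "L \<ge> 0" using L(1)[of 0] by linarith
  \<comment> \<open>The cutoff \<open>max 0 (1 - h y)\<close> equals 1 on the hyperplane and has
    slope -1 below height 1, so in the normal derivative it produces exactly \<open>E2\<close>,
    while \<open>F\<close> produces \<open>E1\<close>.\<close>
  define E where "E y = (if h y > 0 then F y - max 0 (1 - h y) * F (\<pi> y) else 0)" for y
  define E1 where "E1 y = indicator {y. h y > 0} y * (F' y \<bullet> \<nu>)" for y
  define E2 where "E2 y = indicator {y. 0 < h y \<and> h y < 1} y * F (\<pi> y)" for y
  have norm_pi: "norm y \<le> norm (\<pi> y) + \<bar>h y\<bar>" for y
    using norm_triangle_ineq[of "\<pi> y" "h y *\<^sub>R \<nu>"] decomp[of y] facet_normal(1)[OF P] by (simp add: \<nu>_def)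
  have E_supp: "E y = 0" if "norm y > R + 1" for y
  proof -
    have "F y = 0" using that by (intro F_supp) simp
    moreover have "F (\<pi> y) = 0" if "0 < h y" "h y < 1"
      using norm_pi[of y] that \<open>norm y > R + 1\<close> by (intro F_supp) simp
    then have "0 < h y \<Longrightarrow> max 0 (1 - h y) * F (\<pi> y) = 0" by (cases "h y < 1") auto
    ultimately show ?thesis by (simp add: E_def)
  qed
  have E_bound: "\<bar>E y\<bar> \<le> B + B" for y
  proof (cases "h y > 0")
    case True
    have "\<bar>max 0 (1 - h y) * F (\<pi> y)\<bar> \<le> 1 * B"
      unfolding abs_mult using True B B0 by (intro mult_mono) auto
    then show ?thesis using B[of y] True unfolding E_def by simp
  qed (use B0 in \<open>simp add: E_def\<close>)
  have E_meas: "E \<in> borel_measurable borel" unfolding E_def by measurable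
  have E12_meas: "E1 \<in> borel_measurable borel" "E2 \<in> borel_measurable borel"
    unfolding E1_def E2_def by measurable
  text \<open>The subtracted extension of the boundary values makes \<open>E\<close> vanish on the hyperplane, so that \<open>E\<close> is
    Lipschitz across it; clamping the height shows this without a case distinction.\<close>
  have E_clamp: "E y = F (\<pi> y + max 0 (h y) *\<^sub>R \<nu>) - max 0 (1 - max 0 (h y)) * F (\<pi> y)" for y
    using decomp[of y] by (auto simp: E_def max_def)
  have lip: "\<bar>E (y + t *\<^sub>R \<nu>) - E y\<bar> \<le> (L + B) * \<bar>t\<bar>" for y t
  proof -
    define a b where "a = max 0 (h y + t)" and "b = max 0 (h y)"
    have ab: "\<bar>a - b\<bar> \<le> \<bar>t\<bar>" by (auto simp: a_def b_def)
    have "\<bar>F (\<pi> y + a *\<^sub>R \<nu>) - F (\<pi> y + b *\<^sub>R \<nu>)\<bar> \<le> L * \<bar>a - b\<bar>"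
      using L(2)[of "\<pi> y + b *\<^sub>R \<nu>" "a - b"] by (simp add: algebra_simps)
    also have "\<dots> \<le> L * \<bar>t\<bar>" using ab L0 by (rule mult_left_mono)
    finally have 1: "\<bar>F (\<pi> y + a *\<^sub>R \<nu>) - F (\<pi> y + b *\<^sub>R \<nu>)\<bar> \<le> L * \<bar>t\<bar>" .
    have "\<bar>max 0 (1 - a) * F (\<pi> y) - max 0 (1 - b) * F (\<pi> y)\<bar> = \<bar>max 0 (1 - a) - max 0 (1 - b)\<bar> * \<bar>F (\<pi> y)\<bar>"
      by (simp add: left_diff_distrib[symmetric] abs_mult)
    also have "\<dots> \<le> \<bar>t\<bar> * B" using ab B by (intro mult_mono) auto
    finally have 2: "\<bar>max 0 (1 - a) * F (\<pi> y) - max 0 (1 - b) * F (\<pi> y)\<bar> \<le> B * \<bar>t\<bar>" by (simp add: mult.commute)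
    have "E (y + t *\<^sub>R \<nu>) - E y = (F (\<pi> y + a *\<^sub>R \<nu>) - F (\<pi> y + b *\<^sub>R \<nu>))
        - (max 0 (1 - a) * F (\<pi> y) - max 0 (1 - b) * F (\<pi> y))"
      unfolding E_clamp h_add pi_add a_def b_def by simp
    then have "\<bar>E (y + t *\<^sub>R \<nu>) - E y\<bar> \<le> L * \<bar>t\<bar> + B * \<bar>t\<bar>" using 1 2 by linarith
    then show ?thesis by (simp add: algebra_simps)
  qed
  have "(\<integral>y. E1 y + E2 y \<partial>lborel) = 0"
  proof (rule integral_direction_derivative_zero[OF E_meas integrable_bounded_support[OF E_meas E_bound E_supp] _ E_supp lip])
    \<comment> \<open>\<open>E\<close> can fail to be differentiable in the normal direction only at
      heights 0 and 1, two hyperplanes of volume zero; the three open regions between and beside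
      them are treated separately.\<close>
    show "AE y in lborel. ((\<lambda>t. E (y + t *\<^sub>R \<nu>)) has_real_derivative E1 y + E2 y) (at 0)"
      using AE_facet_height_neq[OF P, of 0] AE_facet_height_neq[OF P, of 1]
    proof eventually_elim
      case (elim y)
      then consider "h y < 0" | "0 < h y" "h y < 1" | "h y > 1" by (fastforce simp: h_def)
      then show ?case
      proof cases
        case 1
        have "((\<lambda>t. E (y + t *\<^sub>R \<nu>)) has_real_derivative 0) (at 0)"
          by (rule has_field_derivative_transform_within_open[OF DERIV_const[of 0], where S="{..<- h y}"])
            (use 1 in \<open>auto simp: E_def h_add\<close>)
        then show ?thesis using 1 by (simp add: E1_def E2_def)
      next
        case 2
        have "((\<lambda>t. F (y + t *\<^sub>R \<nu>) - (1 - (h y + t)) * F (\<pi> y)) has_real_derivative F' y \<bullet> \<nu> - (0 - (0 + 1)) * F (\<pi> y)) (at 0)"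
          by (intro DERIV_diff dF DERIV_cmult_right DERIV_add DERIV_const DERIV_ident)
        then have "((\<lambda>t. E (y + t *\<^sub>R \<nu>)) has_real_derivative F' y \<bullet> \<nu> - (0 - (0 + 1)) * F (\<pi> y)) (at 0)"
          by (rule has_field_derivative_transform_within_open[where S="{- h y<..<1 - h y}"])
            (use 2 in \<open>auto simp: E_def h_add pi_add\<close>)
        then show ?thesis using 2 by (simp add: E1_def E2_def)
      next
        case 3
        have "((\<lambda>t. E (y + t *\<^sub>R \<nu>)) has_real_derivative F' y \<bullet> \<nu>) (at 0)"
          by (rule has_field_derivative_transform_within_open[OF dF, where S="{1 - h y<..}"])
            (use 3 in \<open>auto simp: E_def h_add\<close>)
        then show ?thesis using 3 by (simp add: E1_def E2_def)
      qed
    qed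
  qed (use E12_meas in measurable)
  moreover have "integrable lborel E1"
  proof -
    have "integrable lborel (\<lambda>y. F' y \<bullet> \<nu>)"
      by (rule integrable_compact_support[OF _ K(1)])
        (use C1_with_gradient_compact_support(1)[OF F K] Fc in \<open>auto intro: continuous_on_inner\<close>)
    moreover have "{y. h y > 0} \<in> sets lborel" by measurable
    ultimately show ?thesis
      unfolding E1_def[abs_def] using integrable_mult_indicator[of _ lborel "\<lambda>y. F' y \<bullet> \<nu>"] by force
  qed
  moreover have "integrable lborel E2"
  proof (rule integrable_bounded_support[OF E12_meas(2)])
    show "\<bar>E2 y\<bar> \<le> B" for y using B[of "\<pi> y"] B0 by (simp add: E2_def indicator_def)
    show "E2 y = 0" if "norm y > R + 1" for y
      using norm_pi[of y] that F_supp[of "\<pi> y"] by (auto simp: E2_def indicator_def)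
  qed
  ultimately have "(\<integral>y. E1 y \<partial>lborel) = - (\<integral>y. E2 y \<partial>lborel)" by simp
  then show ?thesis by (simp add: E1_def E2_def h_def \<pi>_def \<nu>_def)
qed

subsection \<open>Uniqueness of traces\<close>

text \<open>The facet normal may point into the domain or out of it, and \<open>\<sigma>\<close>
  selects the side. The lower side follows from the upper one because the normal derivative of a
  compactly supported function has integral zero over the whole space, so that the two half space
  integrals are opposite.\<close>

lemma prism_integral_le_half_space:
  assumes P: "facet P" and F: "C1_with_gradient F F'" and K: "compact K" "\<And>x. x \<notin> K \<Longrightarrow> F x = 0"
    and FP: "\<And>z. facet_height P z = 0 \<Longrightarrow> F z \<noteq> 0 \<Longrightarrow> z \<in> P"
    and \<sigma>: "\<sigma> = 1 \<or> \<sigma> = -1"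
  shows "(\<integral>y. F (facet_proj P y) \<partial>prism_measure P)
    \<le> (\<integral>y. indicator {y. \<sigma> * facet_height P y > 0} y * norm (F' y) \<partial>lborel)"
proof -
  define h \<pi> \<nu> where "h = facet_height P" and "\<pi> = facet_proj P" and "\<nu> = facet_normal P"
  have h_pi: "h (\<pi> y) = 0" for y using P by (simp add: h_def \<pi>_def facet_height_proj)
  note [measurable] = C1_with_gradient_measurable[OF F] prism_sets[OF P]
  have [measurable]: "h \<in> borel_measurable borel" "\<pi> \<in> borel_measurable borel"
    by (simp_all add: h_def \<pi>_def)
  note F'int = C1_with_gradient_compact_support(2)[OF F K]
  have le: "\<bar>indicator S y * (F' y \<bullet> \<nu>)\<bar> \<le> indicator S y * norm (F' y)" for S y
    using Cauchy_Schwarz_ineq2[of "F' y" \<nu>] facet_normal(1)[OF P] by (simp add: indicator_def \<nu>_def)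
  have int: "integrable lborel (\<lambda>y. indicator S y * norm (F' y))" if "S \<in> sets borel" for S
    using integrable_mult_indicator[OF _ F'int, of S] that by simp
  have int': "integrable lborel (\<lambda>y. indicator S y * (F' y \<bullet> \<nu>))" if [measurable]: "S \<in> sets borel" for S
    by (rule Bochner_Integration.integrable_bound[OF int[OF that]]) (use le in \<open>auto intro!: AE_I2 order_trans[OF le]\<close>)
  have half: "{y. \<sigma> * h y > 0} \<in> sets borel" "{y. h y > 0} \<in> sets borel" by measurable
  have "(\<integral>y. F (\<pi> y) \<partial>prism_measure P) = (\<integral>y. indicator (prism P) y *\<^sub>R F (\<pi> y) \<partial>lborel)"
    unfolding prism_measure_def using prism_sets[OF P] by (intro integral_restrict_space) simp
  \<comment> \<open>By \<open>FP\<close> a foot point where \<open>F\<close> is nonzero belongs to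
    the facet. There the prism and the slab differ only at heights 0 and 1.\<close>
  also have "\<dots> = (\<integral>y. indicator {y. 0 < h y \<and> h y < 1} y * F (\<pi> y) \<partial>lborel)"
  proof (rule integral_cong_AE)
    show "AE y in lborel. indicator (prism P) y *\<^sub>R F (\<pi> y) = indicator {y. 0 < h y \<and> h y < 1} y * F (\<pi> y)"
      using AE_facet_height_neq[OF P, of 0] AE_facet_height_neq[OF P, of 1]
    proof eventually_elim
      case (elim y)
      show ?case
      proof (cases "F (\<pi> y) = 0")
        case False
        then have "\<pi> y \<in> P" using FP h_pi by (simp add: h_def)
        then have "y \<in> prism P \<longleftrightarrow> 0 < h y \<and> h y < 1"
          using elim by (auto simp: prism_def h_def \<pi>_def)
        then show ?thesis by (simp add: indicator_def)
      qed simp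
    qed
  qed measurable
  also have "\<dots> = - (\<integral>y. indicator {y. h y > 0} y * (F' y \<bullet> \<nu>) \<partial>lborel)"
    using half_space_divergence[OF P F K] by (simp add: h_def \<pi>_def \<nu>_def)
  also have "\<dots> = - \<sigma> * (\<integral>y. indicator {y. \<sigma> * h y > 0} y * (F' y \<bullet> \<nu>) \<partial>lborel)"
  proof (cases "\<sigma> = 1")
    case False
    with \<sigma> have \<sigma>: "\<sigma> = -1" by simp
    have "(\<integral>y. F' y \<bullet> \<nu> \<partial>lborel) = 0"
      by (rule integral_direction_derivative_compact_support[OF C1_with_gradient_line_derivative[OF F] _ _ K])
        (intro continuous_intros C1_with_gradient_continuous[OF F])+
    moreover have "(\<integral>y. F' y \<bullet> \<nu> \<partial>lborel)
        = (\<integral>y. indicator {y. h y > 0} y * (F' y \<bullet> \<nu>) + indicator {y. \<sigma> * h y > 0} y * (F' y \<bullet> \<nu>) \<partial>lborel)"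
    proof (rule integral_cong_AE)
      show "AE y in lborel. F' y \<bullet> \<nu> = indicator {y. h y > 0} y * (F' y \<bullet> \<nu>) + indicator {y. \<sigma> * h y > 0} y * (F' y \<bullet> \<nu>)"
        using AE_facet_height_neq[OF P, of 0] by eventually_elim (auto simp: indicator_def \<sigma> h_def)
    qed measurable
    ultimately show ?thesis
      using int'[OF half(1)] int'[OF half(2)] \<sigma> by simp
  qed simp
  also have "\<dots> \<le> \<bar>\<integral>y. indicator {y. \<sigma> * h y > 0} y * (F' y \<bullet> \<nu>) \<partial>lborel\<bar>"
    using \<sigma> by auto
  also have "\<dots> \<le> (\<integral>y. \<bar>indicator {y. \<sigma> * h y > 0} y * (F' y \<bullet> \<nu>)\<bar> \<partial>lborel)" by (rule integral_abs_bound)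
  also have "\<dots> \<le> (\<integral>y. indicator {y. \<sigma> * h y > 0} y * norm (F' y) \<partial>lborel)"
    by (intro integral_mono integrable_abs int int' half le)
  finally show ?thesis by (simp add: h_def \<pi>_def)
qed

section \<open>A local trace estimate at a flat boundary point\<close>

definition bump :: "real^'n \<Rightarrow> real \<Rightarrow> real^'n \<Rightarrow> real" where
  "bump z r x = (max 0 (r\<^sup>2 - (x - z) \<bullet> (x - z)))\<^sup>2"

lemma bump_outside: "r > 0 \<Longrightarrow> x \<notin> ball z r \<Longrightarrow> r\<^sup>2 - (x - z) \<bullet> (x - z) \<le> 0"
  by (simp add: dist_norm norm_minus_commute power_mono flip: power2_norm_eq_inner)

lemma bump_pos: "r > 0 \<Longrightarrow> x \<in> ball z r \<Longrightarrow> bump z r x > 0"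
  using power_strict_mono[of "norm (x - z)" r 2]
  by (simp add: bump_def dist_norm norm_minus_commute flip: power2_norm_eq_inner)

text \<open>Squaring the positive part removes its kink at the sphere, and the chain rule with
  \<open>DERIV_pos_part_sq\<close> gives the explicit gradient.\<close>

lemma bump_C1: "C1_with_gradient (bump z r) (\<lambda>x. (2 * max 0 (r\<^sup>2 - (x - z) \<bullet> (x - z))) *\<^sub>R (- 2 *\<^sub>R (x - z)))"
proof -
  have "GDERIV (\<lambda>x. r\<^sup>2 - (x - z) \<bullet> (x - z)) x :> - 2 *\<^sub>R (x - z)" for x
    unfolding gderiv_def by (rule derivative_eq_intros refl)+ (simp add: inner_commute algebra_simps)
  then have "C1_with_gradient (\<lambda>x. r\<^sup>2 - (x - z) \<bullet> (x - z)) (\<lambda>x. - 2 *\<^sub>R (x - z))"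
    unfolding C1_with_gradient_def by (intro conjI allI continuous_intros)
  note base = this
  have "continuous_on UNIV (\<lambda>t::real. 2 * max 0 t)" by (intro continuous_intros)
  from C1_with_gradient_compose[OF base DERIV_pos_part_sq this]
  show ?thesis unfolding bump_def[abs_def] .
qed

lemma integral_lebesgue_on_borel:
  fixes f :: "'a::euclidean_space \<Rightarrow> real"
  assumes "f \<in> borel_measurable borel" "S \<in> sets borel"
  shows "(\<integral>x. f x \<partial>lebesgue_on S) = (\<integral>x. indicator S x * f x \<partial>lborel)"
    "integrable (lebesgue_on S) f \<longleftrightarrow> integrable lborel (\<lambda>x. indicator S x * f x)"
proof -
  have S: "S \<inter> space lebesgue \<in> sets lebesgue" using assms(2) by simp
  have m: "(\<lambda>x. indicator S x * f x) \<in> borel_measurable lborel" using assms by simp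
  show "(\<integral>x. f x \<partial>lebesgue_on S) = (\<integral>x. indicator S x * f x \<partial>lborel)"
    using integral_restrict_space[OF S, of f] integral_completion[OF m] by simp
  show "integrable (lebesgue_on S) f \<longleftrightarrow> integrable lborel (\<lambda>x. indicator S x * f x)"
    using integrable_restrict_space[OF S, of f] integrable_completion[OF m] by simp
qed

text \<open>Apply \<open>prism_integral_le_half_space\<close> to the bump times
  \<open>\<psi>\<^sup>2\<close>. By the product rule the gradient is bounded by the squares of
  \<open>\<psi>\<close> and \<open>\<psi>'\<close>, and it vanishes outside the ball, so that only
  the half ball inside \<open>\<Omega>\<close> contributes. The order of quantifiers matters: one
  constant serves all members of an approximating sequence.\<close>

lemma local_trace_estimate:
  assumes P: "facet P" and r: "r > 0" and \<sigma>: "\<sigma> = 1 \<or> \<sigma> = -1" and \<Omega>: "open \<Omega>"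
    and BP: "\<And>y. y \<in> ball z r \<Longrightarrow> facet_height P y = 0 \<Longrightarrow> y \<in> P"
    and B\<Omega>: "\<And>y. y \<in> ball z r \<Longrightarrow> \<sigma> * facet_height P y > 0 \<Longrightarrow> y \<in> \<Omega>"
  shows "\<exists>C. \<forall>\<psi> \<psi>'. C1_with_gradient \<psi> \<psi>' \<longrightarrow> \<psi> \<in> L2 (lebesgue_on \<Omega>) \<longrightarrow> \<psi>' \<in> L2 (lebesgue_on \<Omega>) \<longrightarrow>
    (\<integral>y. bump z r (facet_proj P y) * (\<psi> (facet_proj P y))\<^sup>2 \<partial>prism_measure P)
    \<le> C * ((\<integral>x. (norm (\<psi> x))\<^sup>2 \<partial>lebesgue_on \<Omega>) + (\<integral>x. (norm (\<psi>' x))\<^sup>2 \<partial>lebesgue_on \<Omega>))"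
proof -
  define b b' where "b = bump z r" and "b' x = (2 * max 0 (r\<^sup>2 - (x - z) \<bullet> (x - z))) *\<^sub>R (- 2 *\<^sub>R (x - z))" for x
  have bC1: "C1_with_gradient b b'" unfolding b_def b'_def[abs_def] by (rule bump_C1)
  have b0: "b x = 0" "b' x = 0" if "x \<notin> ball z r" for x
    using bump_outside[OF r that] by (simp_all add: b_def b'_def bump_def)
  have b_nonneg: "b x \<ge> 0" for x by (simp add: b_def bump_def)
  have bc: "compact (cball z r)" "\<And>x. x \<notin> cball z r \<Longrightarrow> b x = 0" using b0(1) by auto
  have bc': "\<And>x. x \<notin> cball z r \<Longrightarrow> b' x = 0" using b0(2) by auto
  obtain M1 where M1: "\<forall>x. norm (b x) \<le> M1"
    using bounded_compact_support[OF C1_with_gradient_continuous(1)[OF bC1] bc] by blast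
  obtain M2 where M2: "\<forall>x. norm (b' x) \<le> M2"
    using bounded_compact_support[OF C1_with_gradient_continuous(2)[OF bC1] bc(1) bc'] by blast
  have M: "b x \<le> M1" "norm (b' x) \<le> M2" for x
    using M1[rule_format, of x] M2[rule_format, of x] unfolding real_norm_def by linarith+
  have M_nonneg: "M1 \<ge> 0" "M2 \<ge> 0"
    using M1[rule_format, of z] M2[rule_format, of z] norm_ge_zero order_trans by blast+
  \<comment> \<open>\<open>M1\<close> bounds the bump, which multiplies twice the product of
    \<open>\<psi>\<close> and its gradient; \<open>M2\<close> bounds the gradient of the bump, which
    multiplies \<open>\<psi>\<^sup>2\<close>.\<close>
  define C where "C = M1 + M2"
  have "(\<integral>y. b (facet_proj P y) * (\<psi> (facet_proj P y))\<^sup>2 \<partial>prism_measure P)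
    \<le> C * ((\<integral>x. (norm (\<psi> x))\<^sup>2 \<partial>lebesgue_on \<Omega>) + (\<integral>x. (norm (\<psi>' x))\<^sup>2 \<partial>lebesgue_on \<Omega>))"
    if \<psi>: "C1_with_gradient \<psi> \<psi>'" "\<psi> \<in> L2 (lebesgue_on \<Omega>)" "\<psi>' \<in> L2 (lebesgue_on \<Omega>)" for \<psi> \<psi>'
  proof -
    note [measurable] = C1_with_gradient_measurable[OF \<psi>(1)]
    have \<Omega>m [measurable]: "\<Omega> \<in> sets borel" using \<Omega> by simp
    define F F' where "F x = b x * (\<psi> x * \<psi> x)"
      and "F' x = b x *\<^sub>R (\<psi> x *\<^sub>R \<psi>' x + \<psi> x *\<^sub>R \<psi>' x) + (\<psi> x * \<psi> x) *\<^sub>R b' x" for x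
    have FC1: "C1_with_gradient F F'"
      unfolding F_def[abs_def] F'_def[abs_def]
      by (rule C1_with_gradient_mult[OF bC1 C1_with_gradient_mult[OF \<psi>(1) \<psi>(1)]])
    have F0: "F x = 0" if "x \<notin> cball z r" for x using bc(2)[OF that] by (simp add: F_def)
    have F'_le: "norm (F' x) \<le> C * ((norm (\<psi> x))\<^sup>2 + (norm (\<psi>' x))\<^sup>2)" for x
    proof -
      have "norm (F' x) \<le> b x * (2 * \<bar>\<psi> x\<bar> * norm (\<psi>' x)) + (\<psi> x)\<^sup>2 * norm (b' x)"
        unfolding F'_def using b_nonneg[of x]
        by (intro order_trans[OF norm_triangle_ineq]) (simp add: power2_eq_square abs_mult flip: scaleR_2)
      also have "\<dots> \<le> M1 * ((norm (\<psi> x))\<^sup>2 + (norm (\<psi>' x))\<^sup>2) + ((norm (\<psi> x))\<^sup>2 + (norm (\<psi>' x))\<^sup>2) * M2"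
        using sum_squares_bound[of "\<bar>\<psi> x\<bar>" "norm (\<psi>' x)"] M[of x] M_nonneg
        by (intro add_mono mult_mono) auto
      finally show ?thesis by (simp add: C_def algebra_simps)
    qed
    have int1: "integrable lborel (\<lambda>x. indicator \<Omega> x * (norm (\<psi> x))\<^sup>2)" 
      using L2_integrable_sq[OF \<psi>(2)] by (subst (asm) integral_lebesgue_on_borel) auto
    have int2: "integrable lborel (\<lambda>x. indicator \<Omega> x * (norm (\<psi>' x))\<^sup>2)"
      using L2_integrable_sq[OF \<psi>(3)] by (subst (asm) integral_lebesgue_on_borel) auto
    have "(\<integral>y. F (facet_proj P y) \<partial>prism_measure P)
      \<le> (\<integral>y. indicator {y. \<sigma> * facet_height P y > 0} y * norm (F' y) \<partial>lborel)"
    proof (rule prism_integral_le_half_space[OF P FC1 bc(1) F0 _ \<sigma>])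
      show "y \<in> P" if "facet_height P y = 0" "F y \<noteq> 0" for y
        using that b0(1)[of y] BP[of y] by (auto simp: F_def)
    qed
    also have "\<dots> \<le> (\<integral>y. C * (indicator \<Omega> y * (norm (\<psi> y))\<^sup>2 + indicator \<Omega> y * (norm (\<psi>' y))\<^sup>2) \<partial>lborel)"
    proof (rule integral_mono)
      have "{y. \<sigma> * facet_height P y > 0} \<in> sets lborel" by measurable
      from integrable_mult_indicator[OF this C1_with_gradient_compact_support(2)[OF FC1 bc(1) F0]]
      show "integrable lborel (\<lambda>y. indicator {y. \<sigma> * facet_height P y > 0} y * norm (F' y))" by simp
      show "integrable lborel (\<lambda>y. C * (indicator \<Omega> y * (norm (\<psi> y))\<^sup>2 + indicator \<Omega> y * (norm (\<psi>' y))\<^sup>2))"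
        using int1 int2 by simp
      show "indicator {y. \<sigma> * facet_height P y > 0} y * norm (F' y)
        \<le> C * (indicator \<Omega> y * (norm (\<psi> y))\<^sup>2 + indicator \<Omega> y * (norm (\<psi>' y))\<^sup>2)" for y
      proof (cases "y \<in> ball z r \<and> \<sigma> * facet_height P y > 0")
        case True
        then show ?thesis using B\<Omega>[of y] F'_le[of y] by simp
      next
        case False
        then have "indicator {y. \<sigma> * facet_height P y > 0} y * norm (F' y) = 0"
          using b0[of y] by (cases "y \<in> ball z r") (simp_all add: F'_def)
        moreover have "C * (indicator \<Omega> y * (norm (\<psi> y))\<^sup>2 + indicator \<Omega> y * (norm (\<psi>' y))\<^sup>2) \<ge> 0"
          using M_nonneg by (simp add: C_def)
        ultimately show ?thesis by (simp only:)
      qed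
    qed
    also have "\<dots> = C * ((\<integral>x. (norm (\<psi> x))\<^sup>2 \<partial>lebesgue_on \<Omega>) + (\<integral>x. (norm (\<psi>' x))\<^sup>2 \<partial>lebesgue_on \<Omega>))"
      using int1 int2 by (simp add: integral_lebesgue_on_borel)
    finally show ?thesis by (simp add: F_def power2_eq_square)
  qed
  then show ?thesis unfolding b_def by blast
qed

text \<open>In a small ball around a point that is relatively interior to one facet and on no other,
  the frontier lies in a flat disc. The open half balls miss the frontier, and a connected set that
  misses the frontier and meets \<open>\<Omega>\<close> lies in \<open>\<Omega>\<close>.\<close>

lemma facet_half_ball:
  assumes \<Omega>: "open \<Omega>" and F: "finite F" "\<And>P. P \<in> F \<Longrightarrow> facet P" "\<Union>F = frontier \<Omega>"
    and P: "P \<in> F" and z: "z \<in> P" "\<And>Q. Q \<in> F \<Longrightarrow> Q \<noteq> P \<Longrightarrow> z \<notin> Q"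
    and rel: "r0 > 0" "\<And>y. facet_height P y = 0 \<Longrightarrow> dist z y < r0 \<Longrightarrow> y \<in> P"
  shows "\<exists>r>0. \<exists>\<sigma>::real. (\<sigma> = 1 \<or> \<sigma> = -1) \<and> (\<forall>y\<in>ball z r. facet_height P y = 0 \<longrightarrow> y \<in> P) \<and>
    (\<forall>y\<in>ball z r. \<sigma> * facet_height P y > 0 \<longrightarrow> y \<in> \<Omega>)"
proof -
  define U where "U = - \<Union>(F - {P})"
  have "closed (\<Union>(F - {P}))"
    using F by (intro closed_Union) (auto simp: facet_def polytope_imp_closed)
  then have "open U" by (simp add: U_def open_Compl)
  moreover have "z \<in> U" using z by (auto simp: U_def)
  ultimately obtain r1 where r1: "r1 > 0" "ball z r1 \<subseteq> U" by (auto simp: open_contains_ball)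
  define r where "r = min r0 r1"
  have r: "r > 0" using rel r1 by (simp add: r_def)
  have fr: "y \<in> P" if "y \<in> ball z r" "y \<in> frontier \<Omega>" for y
  proof -
    have "y \<in> U" using that r1 by (auto simp: r_def)
    moreover have "y \<in> \<Union>F" using that F(3) by simp
    ultimately show ?thesis by (auto simp: U_def)
  qed
  have inP: "y \<in> P" if "y \<in> ball z r" "facet_height P y = 0" for y
    using that rel(2) by (simp add: r_def)
  have "z \<in> frontier \<Omega>" using z P F(3) by blast
  then have "z \<in> closure \<Omega>" by (simp add: frontier_def)
  \<comment> \<open>A point of the open set \<open>\<Omega>\<close> is not on the frontier, so
    \<open>w\<close> lies off the hyperplane; its side fixes \<open>\<sigma>\<close>.\<close>
  then obtain w where w: "w \<in> \<Omega>" "dist w z < r" using r by (meson closure_approachable)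
  have "facet_height P w \<noteq> 0"
  proof
    assume "facet_height P w = 0"
    then have "w \<in> frontier \<Omega>" using inP[of w] w P F(3) by (auto simp: dist_commute)
    then show False using w \<Omega> by (simp add: frontier_def interior_open)
  qed
  define \<sigma> where "\<sigma> = sgn (facet_height P w)"
  have \<sigma>: "\<sigma> = 1 \<or> \<sigma> = -1" "\<sigma> * facet_height P w > 0"
    using \<open>facet_height P w \<noteq> 0\<close> by (auto simp: \<sigma>_def sgn_if)
  define H where "H = ball z r \<inter> {y. \<sigma> * facet_height P y > 0}"
  have "{y. \<sigma> * facet_height P y > 0} = {y. (\<sigma> *\<^sub>R facet_normal P) \<bullet> y > \<sigma> * ((SOME a. a \<in> P) \<bullet> facet_normal P)}"
    by (auto simp: facet_height_def inner_diff_left inner_diff_right inner_commute[of "facet_normal P"] algebra_simps)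
  then have "connected H"
    unfolding H_def by (intro convex_connected convex_Int convex_ball) (simp only: convex_halfspace_gt)
  moreover have "H \<inter> frontier \<Omega> = {}"
    using fr facet_height_facet[OF F(2)[OF P]] by (fastforce simp: H_def)
  moreover have "w \<in> H \<inter> \<Omega>" using w \<sigma> by (simp add: H_def dist_commute)
  ultimately have "H \<subseteq> \<Omega>" using connected_Int_frontier[of H \<Omega>] by blast
  then have "\<forall>y\<in>ball z r. \<sigma> * facet_height P y > 0 \<longrightarrow> y \<in> \<Omega>" by (auto simp: H_def)
  then show ?thesis using r \<sigma>(1) inP by blast
qed

definition polyhedral_boundary :: "(real^'n) set \<Rightarrow> (real^'n) set set \<Rightarrow> bool" where
  "polyhedral_boundary \<Omega> F \<longleftrightarrow> open \<Omega> \<and> bounded \<Omega> \<and> facet_decomposition \<Omega> F"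

lemma polyhedral_boundaryD:
  fixes \<Omega> :: "(real^'n) set"
  assumes "polyhedral_boundary \<Omega> F"
  shows "open \<Omega>" "bounded \<Omega>" "finite F" "\<Union>F = frontier \<Omega>" "\<And>P. P \<in> F \<Longrightarrow> facet P"
    "\<And>P Q. P \<in> F \<Longrightarrow> Q \<in> F \<Longrightarrow> P \<noteq> Q \<Longrightarrow> aff_dim (P \<inter> Q) < int CARD('n) - 1"
  using assms by (auto simp: polyhedral_boundary_def facet_decomposition_def facet_def)

text \<open>Distinct facets overlap only in lower dimension. This makes the facet selected in
  \<open>tangential_part\<close> unambiguous almost everywhere and excludes the edges from the local
  analysis.\<close>

lemma AE_prism_unique_facet:
  assumes "polyhedral_boundary \<Omega> F" "P \<in> F"
  shows "AE y in prism_measure P. \<forall>Q\<in>F. facet_proj P y \<in> Q \<longrightarrow> Q = P"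
proof -
  note F = polyhedral_boundaryD[OF assms(1)]
  have "AE y in prism_measure P. facet_proj P y \<in> Q \<longrightarrow> Q = P" if "Q \<in> F" for Q
  proof (cases "Q = P")
    case False
    then have "AE y in prism_measure P. facet_proj P y \<notin> Q"
      using F(5,6) assms(2) that by (intro AE_prism_not_lowdim) (auto simp: facet_def polytope_imp_closed)
    then show ?thesis by eventually_elim simp
  qed simp
  then show ?thesis using F(3) by (intro AE_finite_allI) auto
qed

text \<open>Near a good boundary point the local trace estimate forces the bump-weighted integral of
  \<open>\<psi>\<^sup>2\<close> to zero along the sequence, since both the functions and their
  gradients tend to zero on \<open>\<Omega>\<close>. The weighted integral of the square of
  \<open>g\<close> is therefore zero, and \<open>g\<close> vanishes where the bump is positive.
  Almost every foot point is good, so these neighbourhoods suffice.\<close>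

lemma trace_zero:
  assumes \<Omega>: "polyhedral_boundary \<Omega> F" and C1: "\<And>k. C1_with_gradient (\<psi> k) (\<psi>' k)"
    and \<psi>: "L2_tendsto (lebesgue_on \<Omega>) \<psi> (\<lambda>_. 0)" "L2_tendsto (lebesgue_on \<Omega>) \<psi>' (\<lambda>_. 0)"
    and g: "L2_tendsto (surface_measure F) \<psi> g"
  shows "AE x in surface_measure F. g x = 0"
proof (rule AE_surface_measureI)
  note F = polyhedral_boundaryD[OF \<Omega>]
  show "facet P" if "P \<in> F" for P using F(5)[OF that] .
  show "finite F" by fact
  have gm [measurable]: "g \<in> borel_measurable borel"
    using L2_measurable[OF L2_tendstoD(2)[OF g]] measurable_cong_sets[OF sets_surface_measure refl] by blast
  show "{x. g x = 0} \<in> sets borel" by measurable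
  fix P assume P: "P \<in> F"
  note fP = F(5)[OF P]
  define good where "good = {y. facet_proj P y \<in> P \<and> (\<forall>Q\<in>F. facet_proj P y \<in> Q \<longrightarrow> Q = P) \<and>
     (\<exists>r>0. \<forall>z. facet_height P z = 0 \<longrightarrow> dist (facet_proj P y) z < r \<longrightarrow> z \<in> P)}"
  have "AE y in prism_measure P. facet_proj P y \<in> P"
    by (rule AE_I2) (simp add: prism_measure_simps prism_def)
  then have AE_good: "AE y in prism_measure P. y \<in> good"
    using AE_prism_unique_facet[OF \<Omega> P] AE_prism_relative_interior[OF fP]
    by eventually_elim (simp add: good_def)
  have "AE y in prism_measure P. y \<in> good \<longrightarrow> g (facet_proj P y) = 0"
  proof (rule AE_local_open)
    fix y assume y: "y \<in> good"
    define z where "z = facet_proj P y"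
    from y obtain r0 where r0: "r0 > 0" "\<And>y. facet_height P y = 0 \<Longrightarrow> dist z y < r0 \<Longrightarrow> y \<in> P"
      by (auto simp: good_def z_def)
    have zP: "z \<in> P" "\<And>Q. Q \<in> F \<Longrightarrow> Q \<noteq> P \<Longrightarrow> z \<notin> Q" using y by (auto simp: good_def z_def)
    obtain r \<sigma> where r: "r > 0" "\<sigma> = 1 \<or> \<sigma> = -1"
      "\<And>y. y \<in> ball z r \<Longrightarrow> facet_height P y = 0 \<Longrightarrow> y \<in> P"
      "\<And>y. y \<in> ball z r \<Longrightarrow> \<sigma> * facet_height P y > 0 \<Longrightarrow> y \<in> \<Omega>"
      using facet_half_ball[OF F(1,3,5,4) P zP r0] by blast
    define M where "M = prism_measure P"
    define b where "b y = bump z r (facet_proj P y)" for y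
    define \<psi>P gP where "\<psi>P k y = \<psi> k (facet_proj P y)" and "gP y = g (facet_proj P y)" for k y
    from local_trace_estimate[OF fP r(1,2) F(1) r(3,4)] obtain C where C':
      "\<forall>\<psi> \<psi>'. C1_with_gradient \<psi> \<psi>' \<longrightarrow> \<psi> \<in> L2 (lebesgue_on \<Omega>) \<longrightarrow> \<psi>' \<in> L2 (lebesgue_on \<Omega>) \<longrightarrow>
        (\<integral>y. bump z r (facet_proj P y) * (\<psi> (facet_proj P y))\<^sup>2 \<partial>prism_measure P)
        \<le> C * ((\<integral>x. (norm (\<psi> x))\<^sup>2 \<partial>lebesgue_on \<Omega>) + (\<integral>x. (norm (\<psi>' x))\<^sup>2 \<partial>lebesgue_on \<Omega>))"
      by (rule exE)
    have C: "(\<integral>y. b y * (\<psi>P k y)\<^sup>2 \<partial>M)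
      \<le> C * ((\<integral>x. (norm (\<psi> k x))\<^sup>2 \<partial>lebesgue_on \<Omega>) + (\<integral>x. (norm (\<psi>' k x))\<^sup>2 \<partial>lebesgue_on \<Omega>))" for k
      unfolding b_def \<psi>P_def M_def
      by (rule C'[rule_format, OF C1 L2_tendstoD(1)[OF \<psi>(1)] L2_tendstoD(1)[OF \<psi>(2)]])
    have lim: "L2_tendsto M \<psi>P gP"
      unfolding M_def \<psi>P_def[abs_def] gP_def[abs_def] by (rule L2_tendsto_prism[OF F(5,3) P g])
    note L = L2_tendstoD[OF lim]
    have b: "0 \<le> b y" "b y \<le> (r\<^sup>2)\<^sup>2" for y
      unfolding b_def bump_def by (simp, intro power_mono) auto
    have bm: "b \<in> borel_measurable M"
      unfolding M_def b_def[abs_def]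
      by (intro measurable_prism_measure measurable_compose[OF facet_proj_measurable] C1_with_gradient_measurable(1)[OF bump_C1])
    have bint: "integrable M (\<lambda>y. b y * (norm (f y))\<^sup>2)" if "f \<in> L2 M" for f :: "_ \<Rightarrow> real"
    proof (rule Bochner_Integration.integrable_bound)
      show "integrable M (\<lambda>y. (r\<^sup>2)\<^sup>2 * (norm (f y))\<^sup>2)" using L2_integrable_sq[OF that] by simp
      show "(\<lambda>y. b y * (norm (f y))\<^sup>2) \<in> borel_measurable M" using bm L2_measurable[OF that] by measurable
      show "AE y in M. norm (b y * (norm (f y))\<^sup>2) \<le> norm ((r\<^sup>2)\<^sup>2 * (norm (f y))\<^sup>2)"
        using b by (intro AE_I2) (simp add: abs_mult mult_right_mono)
    qed
    \<comment> \<open>\<open>gP\<close> is compared with \<open>\<psi>P k\<close>: the square of a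
      sum is at most twice the sum of the squares, the weight in front of the difference is bounded
      by the maximum \<open>(r\<^sup>2)\<^sup>2\<close> of the bump, and the other term is bounded
      by the trace estimate. The right side tends to 0 while the left side does not depend on
      \<open>k\<close>.\<close>
    have ineq: "(\<integral>y. b y * (gP y)\<^sup>2 \<partial>M) \<le> 2 * (r\<^sup>2)\<^sup>2 * (\<integral>y. (norm (\<psi>P k y - gP y))\<^sup>2 \<partial>M)
       + 2 * (C * ((\<integral>x. (norm (\<psi> k x - 0))\<^sup>2 \<partial>lebesgue_on \<Omega>) + (\<integral>x. (norm (\<psi>' k x - 0))\<^sup>2 \<partial>lebesgue_on \<Omega>)))" for k
    proof -
      have d: "integrable M (\<lambda>y. (norm (\<psi>P k y - gP y))\<^sup>2)"
        using L2_diff[OF L(1,2)] by (rule L2_integrable_sq)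
      have "(\<integral>y. b y * (gP y)\<^sup>2 \<partial>M) \<le> (\<integral>y. 2 * (r\<^sup>2)\<^sup>2 * (norm (\<psi>P k y - gP y))\<^sup>2 + 2 * (b y * (\<psi>P k y)\<^sup>2) \<partial>M)"
      proof (rule integral_mono)
        show "integrable M (\<lambda>y. b y * (gP y)\<^sup>2)" using bint[OF L(2)] by simp
        show "integrable M (\<lambda>y. 2 * (r\<^sup>2)\<^sup>2 * (norm (\<psi>P k y - gP y))\<^sup>2 + 2 * (b y * (\<psi>P k y)\<^sup>2))"
          using bint[OF L(1)] d by simp
        show "b y * (gP y)\<^sup>2 \<le> 2 * (r\<^sup>2)\<^sup>2 * (norm (\<psi>P k y - gP y))\<^sup>2 + 2 * (b y * (\<psi>P k y)\<^sup>2)" for y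
        proof -
          have "(gP y)\<^sup>2 \<le> 2 * (norm (\<psi>P k y - gP y))\<^sup>2 + 2 * (\<psi>P k y)\<^sup>2"
            using norm_lincomb_sq_le[of "-1" "\<psi>P k y - gP y" 1 "\<psi>P k y"] by simp
          then have "b y * (gP y)\<^sup>2 \<le> b y * (2 * (norm (\<psi>P k y - gP y))\<^sup>2 + 2 * (\<psi>P k y)\<^sup>2)"
            using b by (intro mult_left_mono) auto
          also have "\<dots> \<le> (r\<^sup>2)\<^sup>2 * (2 * (norm (\<psi>P k y - gP y))\<^sup>2) + b y * (2 * (\<psi>P k y)\<^sup>2)"
            using b[of y] mult_right_mono[OF b(2), of "2 * (norm (\<psi>P k y - gP y))\<^sup>2" y] by (simp add: distrib_left)
          finally show ?thesis by simp
        qed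
      qed
      also have "\<dots> = 2 * (r\<^sup>2)\<^sup>2 * (\<integral>y. (norm (\<psi>P k y - gP y))\<^sup>2 \<partial>M) + 2 * (\<integral>y. b y * (\<psi>P k y)\<^sup>2 \<partial>M)"
        using bint[OF L(1)] d by simp
      finally show ?thesis using C[of k] by simp
    qed
    have "(\<lambda>k. 2 * (r\<^sup>2)\<^sup>2 * (\<integral>y. (norm (\<psi>P k y - gP y))\<^sup>2 \<partial>M)
       + 2 * (C * ((\<integral>x. (norm (\<psi> k x - 0))\<^sup>2 \<partial>lebesgue_on \<Omega>) + (\<integral>x. (norm (\<psi>' k x - 0))\<^sup>2 \<partial>lebesgue_on \<Omega>))))
       \<longlonglongrightarrow> 2 * (r\<^sup>2)\<^sup>2 * 0 + 2 * (C * (0 + 0))"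
      by (intro tendsto_intros L(3) L2_tendstoD(3)[OF \<psi>(1)] L2_tendstoD(3)[OF \<psi>(2)])
    then have "(\<integral>y. b y * (gP y)\<^sup>2 \<partial>M) \<le> 2 * (r\<^sup>2)\<^sup>2 * 0 + 2 * (C * (0 + 0))"
      using ineq by (intro LIMSEQ_le_const) auto
    moreover have nonneg: "AE y in M. 0 \<le> b y * (gP y)\<^sup>2" using b by (intro AE_I2) simp
    ultimately have "(\<integral>y. b y * (gP y)\<^sup>2 \<partial>M) = 0" using integral_nonneg_AE[OF nonneg] by simp
    then have "AE y in M. b y * (gP y)\<^sup>2 = 0"
      using bint[OF L(2)] nonneg by (subst (asm) integral_nonneg_eq_0_iff_AE) auto
    then have "AE y in M. y \<in> facet_proj P -` ball z r \<longrightarrow> gP y = 0"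
    proof eventually_elim
      case (elim y)
      then show ?case using bump_pos[OF r(1), of "facet_proj P y" z] by (auto simp: b_def)
    qed
    moreover have "open (facet_proj P -` ball z r)"
      by (intro open_vimage open_ball continuous_intros)
    moreover have "y \<in> facet_proj P -` ball z r" using r(1) by (simp add: z_def)
    ultimately show "\<exists>U. open U \<and> y \<in> U \<and> (AE x in prism_measure P. x \<in> U \<longrightarrow> g (facet_proj P x) = 0)"
      unfolding M_def gP_def by blast
  qed
  with AE_good show "AE y in prism_measure P. g (facet_proj P y) = 0"
    by eventually_elim simp
qed

lemma finite_measure_lebesgue_on_bounded:
  fixes S :: "'a::euclidean_space set"
  assumes "open S" "bounded S" shows "finite_measure (lebesgue_on S)"
proof (rule finite_measureI)
  have "S \<in> lmeasurable" using assms by (rule lmeasurable_open[rotated])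
  then have "emeasure lebesgue S < \<infinity>" "S \<in> sets lebesgue" by (auto simp: fmeasurable_def)
  then show "emeasure (lebesgue_on S) (space (lebesgue_on S)) \<noteq> \<infinity>"
    by (simp add: space_restrict_space emeasure_restrict_space del: emeasure_completion)
qed

lemma test_function_bounded:
  assumes "test_function S \<phi> \<phi>'"
  shows "\<exists>B. \<forall>x. \<bar>\<phi> x\<bar> \<le> B \<and> norm (\<phi>' x) \<le> B"
proof -
  obtain K where K: "compact K" "K \<subseteq> S" "\<And>x. x \<notin> K \<Longrightarrow> \<phi> x = 0" and C1: "C1_with_gradient \<phi> \<phi>'"
    using assms unfolding test_function_def by blast
  obtain B1 where B1: "\<forall>x. norm (\<phi> x) \<le> B1"
    using bounded_compact_support[OF C1_with_gradient_continuous(1)[OF C1] K(1,3)] by blast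
  obtain B2 where B2: "\<forall>x. norm (\<phi>' x) \<le> B2"
    using bounded_compact_support[OF C1_with_gradient_continuous(2)[OF C1] K(1) C1_with_gradient_compact_support(1)[OF C1 K(1,3)]] by blast
  have "\<bar>\<phi> x\<bar> \<le> max B1 B2 \<and> norm (\<phi>' x) \<le> max B1 B2" for x
    using B1[rule_format, of x] B2[rule_format, of x] unfolding real_norm_def by linarith
  then show ?thesis by (intro exI allI)
qed

subsection \<open>Uniqueness of the tangential gradient\<close>

lemma tangential_part_unique:
  assumes "P \<in> F" "x \<in> P" "\<forall>Q\<in>F. x \<in> Q \<longrightarrow> Q = P"
  shows "tangential_part F x w = w - (w \<bullet> facet_normal P) *\<^sub>R facet_normal P"
proof -
  have "(SOME P. P \<in> F \<and> x \<in> P) = P" by (rule some_equality) (use assms in blast)+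
  then show ?thesis by (simp add: tangential_part_def Let_def)
qed

lemma tangential_part_lincomb:
  "tangential_part F x (r *\<^sub>R v + t *\<^sub>R w) = r *\<^sub>R tangential_part F x v + t *\<^sub>R tangential_part F x w"
proof -
  have "(r *\<^sub>R v + t *\<^sub>R w) - ((r *\<^sub>R v + t *\<^sub>R w) \<bullet> \<nu>) *\<^sub>R \<nu>
    = r *\<^sub>R (v - (v \<bullet> \<nu>) *\<^sub>R \<nu>) + t *\<^sub>R (w - (w \<bullet> \<nu>) *\<^sub>R \<nu>)" for \<nu>
    by (simp add: inner_add_left scaleR_add_left scaleR_diff_right)
  then show ?thesis by (simp only: tangential_part_def Let_def)
qed

text \<open>Moving a point along a tangential vector moves its foot point by the same vector, so
  \<open>\<psi>\<close> composed with the projection has derivative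
  \<open>\<psi>' \<bullet> \<tau>\<close> at the foot point. The product with \<open>\<eta>\<close>
  has compact support inside the prism, and its derivative along \<open>\<tau>\<close> has integral
  zero.\<close>

lemma tangential_integration_by_parts:
  fixes P :: "(real^'n) set"
  assumes P: "facet P" and \<psi>: "C1_with_gradient \<psi> \<psi>'" and \<tau>: "\<tau> \<bullet> facet_normal P = 0"
    and \<eta>: "test_function (interior (prism P)) \<eta> \<eta>'"
  shows "(\<integral>y. (\<psi>' (facet_proj P y) \<bullet> \<tau>) * \<eta> y \<partial>prism_measure P) = - (\<integral>y. \<psi> (facet_proj P y) * (\<eta>' y \<bullet> \<tau>) \<partial>prism_measure P)"
proof -
  obtain K where K: "compact K" "K \<subseteq> interior (prism P)" "\<And>x. x \<notin> K \<Longrightarrow> \<eta> x = 0" and C1: "C1_with_gradient \<eta> \<eta>'"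
    using \<eta> by (auto simp: test_function_def)
  have KP: "K \<subseteq> prism P" using K(2) interior_subset by blast
  define E where "E y = \<psi> (facet_proj P y) * \<eta> y" for y
  define E1 where "E1 y = (\<psi>' (facet_proj P y) \<bullet> \<tau>) * \<eta> y" for y
  define E2 where "E2 y = \<psi> (facet_proj P y) * (\<eta>' y \<bullet> \<tau>)" for y
  note c = C1_with_gradient_continuous[OF \<psi>] C1_with_gradient_continuous[OF C1]
  have c\<pi>: "continuous_on UNIV (\<lambda>y. \<psi> (facet_proj P y))" "continuous_on UNIV (\<lambda>y. \<psi>' (facet_proj P y))"
    using continuous_on_compose2[OF c(1) continuous_on_facet_proj subset_UNIV]
      continuous_on_compose2[OF c(2) continuous_on_facet_proj subset_UNIV] .
  have cE: "continuous_on UNIV E" "continuous_on UNIV E1" "continuous_on UNIV E2"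
    unfolding E_def E1_def E2_def by (intro continuous_on_mult continuous_on_inner c\<pi> c continuous_on_const)+
  have E0: "E y = 0" "E1 y = 0" "E2 y = 0" if "y \<notin> K" for y
    using K(3)[OF that] C1_with_gradient_compact_support(1)[OF C1 K(1,3) that] by (simp_all add: E_def E1_def E2_def)
  have deriv: "((\<lambda>t. E (y + t *\<^sub>R \<tau>)) has_real_derivative E1 y + E2 y) (at 0)" for y
  proof -
    have "facet_proj P (y + t *\<^sub>R \<tau>) = facet_proj P y + t *\<^sub>R \<tau>" for t
      using \<tau> by (intro facet_proj_add_tangent) simp
    then have E: "E (y + t *\<^sub>R \<tau>) = \<psi> (facet_proj P y + t *\<^sub>R \<tau>) * \<eta> (y + t *\<^sub>R \<tau>)" for t
      by (simp add: E_def)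
    show ?thesis
      unfolding E using DERIV_mult[OF C1_with_gradient_line_derivative[OF \<psi>, of "facet_proj P y" \<tau>]
          C1_with_gradient_line_derivative[OF C1, of y \<tau>]]
      by (simp add: E1_def E2_def add.commute mult.commute)
  qed
  have restrict: "(\<integral>y. f y \<partial>prism_measure P) = (\<integral>y. f y \<partial>lborel)" if "\<And>y. y \<notin> K \<Longrightarrow> f y = 0" for f :: "real^'n \<Rightarrow> real"
  proof -
    have "(\<integral>y. f y \<partial>prism_measure P) = (\<integral>y. indicator (prism P) y *\<^sub>R f y \<partial>lborel)"
      unfolding prism_measure_def using prism_sets[OF P] by (intro integral_restrict_space) simp
    also have "\<dots> = (\<integral>y. f y \<partial>lborel)"
      by (intro Bochner_Integration.integral_cong refl) (use that KP in \<open>auto simp: indicator_def\<close>)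
    finally show ?thesis .
  qed
  have "(\<integral>y. E1 y + E2 y \<partial>lborel) = 0"
    by (rule integral_direction_derivative_compact_support[OF deriv cE(1) _ K(1) E0(1)])
      (intro continuous_on_add cE)
  then have "(\<integral>y. E1 y \<partial>lborel) = - (\<integral>y. E2 y \<partial>lborel)"
    using integrable_compact_support[OF cE(2) K(1) E0(2)] integrable_compact_support[OF cE(3) K(1) E0(3)] by simp
  then show ?thesis
    using restrict[OF E0(2)] restrict[OF E0(3)] by (simp add: E1_def E2_def)
qed

lemma has_tangential_gradient_lincomb:
  assumes "has_tangential_gradient F g q" "has_tangential_gradient F h p"
  shows "has_tangential_gradient F (\<lambda>x. r * g x + t * h x) (\<lambda>x. r *\<^sub>R q x + t *\<^sub>R p x)"
proof -
  from assms(1) obtain \<psi> \<psi>' where \<psi>': "(\<forall>k. C1_with_gradient (\<psi> k) (\<psi>' k)) \<and> L2_tendsto (surface_measure F) \<psi> g \<and>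
    L2_tendsto (surface_measure F) (\<lambda>k x. tangential_part F x (\<psi>' k x)) q"
    unfolding has_tangential_gradient_def by (elim exE)
  note \<psi> = \<psi>'[THEN conjunct1, rule_format] \<psi>'[THEN conjunct2, THEN conjunct1] \<psi>'[THEN conjunct2, THEN conjunct2]
  from assms(2) obtain \<xi> \<xi>' where \<xi>': "(\<forall>k. C1_with_gradient (\<xi> k) (\<xi>' k)) \<and> L2_tendsto (surface_measure F) \<xi> h \<and>
    L2_tendsto (surface_measure F) (\<lambda>k x. tangential_part F x (\<xi>' k x)) p"
    unfolding has_tangential_gradient_def by (elim exE)
  note \<xi> = \<xi>'[THEN conjunct1, rule_format] \<xi>'[THEN conjunct2, THEN conjunct1] \<xi>'[THEN conjunct2, THEN conjunct2]
  show ?thesis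
    unfolding has_tangential_gradient_def
  proof (rule exI[of _ "\<lambda>k x. r * \<psi> k x + t * \<xi> k x"], rule exI[of _ "\<lambda>k x. r *\<^sub>R \<psi>' k x + t *\<^sub>R \<xi>' k x"], intro conjI allI)
    show "C1_with_gradient (\<lambda>x. r * \<psi> k x + t * \<xi> k x) (\<lambda>x. r *\<^sub>R \<psi>' k x + t *\<^sub>R \<xi>' k x)" for k
      by (rule C1_with_gradient_lincomb[OF \<psi>(1) \<xi>(1)])
    show "L2_tendsto (surface_measure F) (\<lambda>k x. r * \<psi> k x + t * \<xi> k x) (\<lambda>x. r * g x + t * h x)"
      using L2_tendsto_lincomb[OF \<psi>(2) \<xi>(2), of r t] by simp
    show "L2_tendsto (surface_measure F) (\<lambda>k x. tangential_part F x (r *\<^sub>R \<psi>' k x + t *\<^sub>R \<xi>' k x)) (\<lambda>x. r *\<^sub>R q x + t *\<^sub>R p x)"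
      unfolding tangential_part_lincomb by (rule L2_tendsto_lincomb[OF \<psi>(3) \<xi>(3)])
  qed
qed

text \<open>Integration by parts moves the derivative from the approximants to the test function. In
  the limit one side is zero because the approximants tend to zero, and the fundamental lemma on the
  interior of the prism then kills every component of \<open>q\<close>.\<close>

lemma tangential_gradient_zero:
  assumes \<Omega>: "polyhedral_boundary \<Omega> F" and q: "has_tangential_gradient F (\<lambda>_. 0) q"
  shows "AE x in surface_measure F. q x = 0"
proof (rule AE_surface_measureI)
  note F = polyhedral_boundaryD[OF \<Omega>]
  show "facet P" if "P \<in> F" for P using F(5)[OF that] .
  show "finite F" by fact
  from q obtain \<psi> \<psi>' where \<psi>': "(\<forall>k. C1_with_gradient (\<psi> k) (\<psi>' k)) \<and> L2_tendsto (surface_measure F) \<psi> (\<lambda>_. 0) \<and>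
    L2_tendsto (surface_measure F) (\<lambda>k x. tangential_part F x (\<psi>' k x)) q"
    unfolding has_tangential_gradient_def by (elim exE)
  note \<psi> = \<psi>'[THEN conjunct1, rule_format] \<psi>'[THEN conjunct2, THEN conjunct1] \<psi>'[THEN conjunct2, THEN conjunct2]
  have qm [measurable]: "q \<in> borel_measurable borel"
    using L2_measurable[OF L2_tendstoD(2)[OF \<psi>(3)]] measurable_cong_sets[OF sets_surface_measure refl] by blast
  show "{x. q x = 0} \<in> sets borel" by measurable
  fix P assume P: "P \<in> F"
  note fP = F(5)[OF P]
  define M where "M = prism_measure P"
  define \<nu> where "\<nu> = facet_normal P"
  have fin: "finite_measure M" unfolding M_def by (rule finite_measure_prism[OF fP])
  have lim\<psi>: "L2_tendsto M (\<lambda>k y. \<psi> k (facet_proj P y)) (\<lambda>_. 0)"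
    unfolding M_def using L2_tendsto_prism[OF F(5,3) P \<psi>(2)] .
  have limq: "L2_tendsto M (\<lambda>k y. tangential_part F (facet_proj P y) (\<psi>' k (facet_proj P y))) (\<lambda>y. q (facet_proj P y))"
    unfolding M_def using L2_tendsto_prism[OF F(5,3) P \<psi>(3)] .
  have comp: "AE y in M. q (facet_proj P y) \<bullet> c = 0" for c
  proof -
    \<comment> \<open>Pairing a tangential part with \<open>c\<close> is pairing the full gradient
      with the tangential vector \<open>\<tau>\<close>. For normal \<open>c\<close> it is zero, so
      the normal component of \<open>q\<close> is covered as well.\<close>
    define \<tau> where "\<tau> = c - (c \<bullet> \<nu>) *\<^sub>R \<nu>"
    have \<tau>: "\<tau> \<bullet> facet_normal P = 0"
      using facet_normal_inner_self[OF fP] by (simp add: \<tau>_def \<nu>_def inner_diff_left)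
    define w where "w y = indicator (prism P) y * (q (facet_proj P y) \<bullet> c)" for y
    have "integrable M (\<lambda>y. q (facet_proj P y) \<bullet> c)"
      by (rule L2_integrable[OF fin L2_inner_const[OF L2_tendstoD(2)[OF limq]]])
    then have w: "integrable lborel w"
      unfolding M_def prism_measure_def w_def[abs_def] using prism_sets[OF fP] by (simp add: integrable_restrict_space)
    have "AE y in lborel. y \<in> interior (prism P) \<longrightarrow> w y = 0"
    proof (rule fundamental_lemma_lborel[OF open_interior w])
      fix \<eta> \<eta>' assume \<eta>: "test_function (interior (prism P)) \<eta> \<eta>'"
      obtain B where B: "\<And>x. \<bar>\<eta> x\<bar> \<le> B" "\<And>x. norm (\<eta>' x) \<le> B"
        using test_function_bounded[OF \<eta>] by blast
      have m: "\<eta> \<in> borel_measurable M" "\<eta>' \<in> borel_measurable M"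
        using C1_with_gradient_measurable[OF \<eta>[unfolded test_function_def, THEN conjunct1]] unfolding M_def
        by (auto intro: measurable_prism_measure)
      have L: "(\<lambda>y. \<eta> y *\<^sub>R c) \<in> L2 M" "(\<lambda>y. \<eta>' y \<bullet> \<tau>) \<in> L2 M"
      proof -
        have "\<bar>\<eta> x\<bar> * norm c \<le> B * norm c" for x using B(1)[of x] by (intro mult_right_mono) auto
        then show "(\<lambda>y. \<eta> y *\<^sub>R c) \<in> L2 M"
          by (intro bounded_L2[OF fin, where B="B * norm c"]) (use m in auto)
        have "\<eta>' \<in> L2 M" by (rule bounded_L2[OF fin m(2), where B=B]) (rule B)
        then show "(\<lambda>y. \<eta>' y \<bullet> \<tau>) \<in> L2 M" by (rule L2_inner_const)
      qed
      have "(\<integral>y. tangential_part F (facet_proj P y) (\<psi>' k (facet_proj P y)) \<bullet> (\<eta> y *\<^sub>R c) \<partial>M)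
        = - (\<integral>y. \<psi> k (facet_proj P y) * (\<eta>' y \<bullet> \<tau>) \<partial>M)" for k
      proof -
        have tm: "(\<lambda>y. tangential_part F (facet_proj P y) (\<psi>' k (facet_proj P y))) \<in> borel_measurable M"
          using L2_measurable[OF L2_tendstoD(1)[OF limq]] .
        have "AE y in M. facet_proj P y \<in> P"
          unfolding M_def by (rule AE_I2) (simp add: prism_measure_simps prism_def)
        then have ae: "AE y in M. tangential_part F (facet_proj P y) (\<psi>' k (facet_proj P y)) \<bullet> (\<eta> y *\<^sub>R c)
          = (\<psi>' k (facet_proj P y) \<bullet> \<tau>) * \<eta> y"
          using AE_prism_unique_facet[OF \<Omega> P, folded M_def]
        proof eventually_elim
          case (elim y)
          have "tangential_part F (facet_proj P y) v \<bullet> c = v \<bullet> \<tau>" for v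
            unfolding tangential_part_unique[OF P elim] \<tau>_def \<nu>_def
            by (simp add: inner_diff_left inner_diff_right inner_commute[of c "facet_normal P"])
          then show ?case by simp
        qed
        have "(\<integral>y. tangential_part F (facet_proj P y) (\<psi>' k (facet_proj P y)) \<bullet> (\<eta> y *\<^sub>R c) \<partial>M)
          = (\<integral>y. (\<psi>' k (facet_proj P y) \<bullet> \<tau>) * \<eta> y \<partial>M)"
        proof (rule integral_cong_AE[OF _ _ ae])
          have "(\<lambda>y. \<psi>' k (facet_proj P y)) \<in> borel_measurable M"
            unfolding M_def
            by (rule measurable_prism_measure, rule measurable_compose[OF facet_proj_measurable C1_with_gradient_measurable(2)[OF \<psi>(1)]])
          then show "(\<lambda>y. (\<psi>' k (facet_proj P y) \<bullet> \<tau>) * \<eta> y) \<in> borel_measurable M" using m by measurable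
        qed (use tm m in measurable)
        also have "\<dots> = - (\<integral>y. \<psi> k (facet_proj P y) * (\<eta>' y \<bullet> \<tau>) \<partial>M)"
          unfolding M_def by (rule tangential_integration_by_parts[OF fP \<psi>(1) \<tau> \<eta>])
        finally show ?thesis .
      qed
      moreover have "(\<lambda>k. \<integral>y. tangential_part F (facet_proj P y) (\<psi>' k (facet_proj P y)) \<bullet> (\<eta> y *\<^sub>R c) \<partial>M)
          \<longlonglongrightarrow> (\<integral>y. q (facet_proj P y) \<bullet> (\<eta> y *\<^sub>R c) \<partial>M)"
        by (rule L2_tendsto_inner[OF limq L(1)])
      moreover have "(\<lambda>k. - (\<integral>y. \<psi> k (facet_proj P y) * (\<eta>' y \<bullet> \<tau>) \<partial>M)) \<longlonglongrightarrow> 0"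
        using tendsto_minus[OF L2_tendsto_inner[OF lim\<psi> L(2)]] by simp
      ultimately have "(\<integral>y. q (facet_proj P y) \<bullet> (\<eta> y *\<^sub>R c) \<partial>M) = 0"
        using LIMSEQ_unique by simp
      moreover have "(\<integral>y. q (facet_proj P y) \<bullet> (\<eta> y *\<^sub>R c) \<partial>M) = (\<integral>y. indicator (prism P) y *\<^sub>R (q (facet_proj P y) \<bullet> (\<eta> y *\<^sub>R c)) \<partial>lborel)"
        unfolding M_def prism_measure_def using prism_sets[OF fP] by (intro integral_restrict_space) simp
      ultimately show "(\<integral>y. \<eta> y * w y \<partial>lborel) = 0"
        by (simp add: w_def mult.left_commute)
    qed
    then have "AE y in M. y \<in> interior (prism P) \<longrightarrow> w y = 0"
      unfolding M_def AE_prism_measure[OF fP] by (rule eventually_mono) simp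
    moreover have "AE y in M. y \<in> interior (prism P)"
      unfolding M_def by (rule AE_prism_interior[OF fP])
    ultimately show ?thesis
    proof eventually_elim
      case (elim y)
      then have "w y = 0" by simp
      moreover have "y \<in> prism P" using elim(2) interior_subset[of "prism P"] by (rule subsetD[rotated])
      ultimately show ?case by (simp add: w_def)
    qed
  qed
  have "AE y in M. \<forall>c\<in>Basis. q (facet_proj P y) \<bullet> c = 0"
    by (rule AE_finite_allI[OF finite_Basis comp])
  then show "AE y in prism_measure P. q (facet_proj P y) = 0"
    unfolding M_def
  proof eventually_elim
    case (elim y)
    then show ?case by (simp add: euclidean_all_zero_iff)
  qed
qed

subsection \<open>Linear structure of weak gradients, traces and Poisson problems\<close>

lemma L2_scaleR_integrable:
  fixes f :: "'a \<Rightarrow> real" and g :: "'a \<Rightarrow> 'b::euclidean_space"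
  assumes f: "f \<in> L2 M" and g: "g \<in> L2 M"
  shows "integrable M (\<lambda>x. f x *\<^sub>R g x)"
proof (rule Bochner_Integration.integrable_bound)
  note [measurable] = L2_measurable[OF f] L2_measurable[OF g]
  show "integrable M (\<lambda>x. (norm (f x))\<^sup>2 + (norm (g x))\<^sup>2)"
    using L2_integrable_sq[OF f] L2_integrable_sq[OF g] by simp
  show "(\<lambda>x. f x *\<^sub>R g x) \<in> borel_measurable M" by measurable
  show "AE x in M. norm (f x *\<^sub>R g x) \<le> norm ((norm (f x))\<^sup>2 + (norm (g x))\<^sup>2)"
  proof (rule AE_I2)
    fix x
    have "0 \<le> \<bar>f x\<bar> * norm (g x)" by simp
    then have "\<bar>f x\<bar> * norm (g x) \<le> (norm (f x))\<^sup>2 + (norm (g x))\<^sup>2"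
      using sum_squares_bound[of "\<bar>f x\<bar>" "norm (g x)"] unfolding real_norm_def power2_abs by linarith
    then show "norm (f x *\<^sub>R g x) \<le> norm ((norm (f x))\<^sup>2 + (norm (g x))\<^sup>2)" by simp
  qed
qed

lemma test_function_L2_lebesgue:
  assumes \<Omega>: "open \<Omega>" "bounded \<Omega>" and \<phi>: "test_function \<Omega> \<phi> \<phi>'"
  shows "\<phi> \<in> L2 (lebesgue_on \<Omega>)" "\<phi>' \<in> L2 (lebesgue_on \<Omega>)"
proof -
  obtain B where B: "\<And>x. \<bar>\<phi> x\<bar> \<le> B" "\<And>x. norm (\<phi>' x) \<le> B"
    using test_function_bounded[OF \<phi>] by blast
  have m: "\<phi> \<in> borel_measurable borel" "\<phi>' \<in> borel_measurable borel"
    using C1_with_gradient_measurable[OF \<phi>[unfolded test_function_def, THEN conjunct1]] .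
  then have "\<phi> \<in> borel_measurable lborel" "\<phi>' \<in> borel_measurable lborel" by simp_all
  then have "\<phi> \<in> borel_measurable (lebesgue_on \<Omega>)" "\<phi>' \<in> borel_measurable (lebesgue_on \<Omega>)"
    by (auto intro!: measurable_restrict_space1 measurable_completion)
  then show "\<phi> \<in> L2 (lebesgue_on \<Omega>)" "\<phi>' \<in> L2 (lebesgue_on \<Omega>)"
    using B by (auto intro!: bounded_L2[where B=B] finite_measure_lebesgue_on_bounded[OF \<Omega>])
qed

lemma has_weak_gradientD:
  assumes "has_weak_gradient \<Omega> v p"
  shows "v \<in> L2 (lebesgue_on \<Omega>)" "p \<in> L2 (lebesgue_on \<Omega>)"
    "test_function \<Omega> \<phi> \<phi>' \<Longrightarrow> (\<integral>x. v x *\<^sub>R \<phi>' x \<partial>lebesgue_on \<Omega>) = - (\<integral>x. \<phi> x *\<^sub>R p x \<partial>lebesgue_on \<Omega>)"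
  using assms by (simp_all add: has_weak_gradient_def)

lemma has_weak_gradient_lincomb:
  assumes \<Omega>: "open \<Omega>" "bounded \<Omega>" and v: "has_weak_gradient \<Omega> v p" and w: "has_weak_gradient \<Omega> w q"
  shows "has_weak_gradient \<Omega> (\<lambda>x. r * v x + t * w x) (\<lambda>x. r *\<^sub>R p x + t *\<^sub>R q x)"
  unfolding has_weak_gradient_def
proof (intro conjI allI impI)
  note v = has_weak_gradientD[OF v] and w = has_weak_gradientD[OF w]
  show "(\<lambda>x. r * v x + t * w x) \<in> L2 (lebesgue_on \<Omega>)"
    using L2_lincomb[OF v(1) w(1), of r t] by simp
  show "(\<lambda>x. r *\<^sub>R p x + t *\<^sub>R q x) \<in> L2 (lebesgue_on \<Omega>)"
    by (rule L2_lincomb[OF v(2) w(2)])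
  fix \<phi> \<phi>' assume \<phi>: "test_function \<Omega> \<phi> \<phi>'"
  note L = test_function_L2_lebesgue[OF \<Omega> \<phi>]
  note int = L2_scaleR_integrable
  have "(\<integral>x. (r * v x + t * w x) *\<^sub>R \<phi>' x \<partial>lebesgue_on \<Omega>)
    = (\<integral>x. r *\<^sub>R (v x *\<^sub>R \<phi>' x) + t *\<^sub>R (w x *\<^sub>R \<phi>' x) \<partial>lebesgue_on \<Omega>)"
    by (simp add: scaleR_add_left)
  also have "\<dots> = r *\<^sub>R (\<integral>x. v x *\<^sub>R \<phi>' x \<partial>lebesgue_on \<Omega>) + t *\<^sub>R (\<integral>x. w x *\<^sub>R \<phi>' x \<partial>lebesgue_on \<Omega>)"
    using int[OF v(1) L(2)] int[OF w(1) L(2)] by (simp del: scaleR_scaleR)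
  also have "\<dots> = - (r *\<^sub>R (\<integral>x. \<phi> x *\<^sub>R p x \<partial>lebesgue_on \<Omega>) + t *\<^sub>R (\<integral>x. \<phi> x *\<^sub>R q x \<partial>lebesgue_on \<Omega>))"
    using v(3)[OF \<phi>] w(3)[OF \<phi>] by simp
  also have "r *\<^sub>R (\<integral>x. \<phi> x *\<^sub>R p x \<partial>lebesgue_on \<Omega>) + t *\<^sub>R (\<integral>x. \<phi> x *\<^sub>R q x \<partial>lebesgue_on \<Omega>)
    = (\<integral>x. r *\<^sub>R (\<phi> x *\<^sub>R p x) + t *\<^sub>R (\<phi> x *\<^sub>R q x) \<partial>lebesgue_on \<Omega>)"
    using int[OF L(1) v(2)] int[OF L(1) w(2)] by (simp del: scaleR_scaleR)
  also have "\<dots> = (\<integral>x. \<phi> x *\<^sub>R (r *\<^sub>R p x + t *\<^sub>R q x) \<partial>lebesgue_on \<Omega>)"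
    by (simp add: scaleR_add_right mult.commute)
  finally show "(\<integral>x. (r * v x + t * w x) *\<^sub>R \<phi>' x \<partial>lebesgue_on \<Omega>)
    = - (\<integral>x. \<phi> x *\<^sub>R (r *\<^sub>R p x + t *\<^sub>R q x) \<partial>lebesgue_on \<Omega>)" .
qed

lemma weak_gradient_unique:
  assumes \<Omega>: "open \<Omega>" "bounded \<Omega>" and p: "has_weak_gradient \<Omega> v p" and q: "has_weak_gradient \<Omega> v q"
  shows "AE x in lebesgue_on \<Omega>. p x = q x"
proof -
  have fin: "finite_measure (lebesgue_on \<Omega>)" by (rule finite_measure_lebesgue_on_bounded[OF \<Omega>])
  define D where "D x = p x - q x" for x
  have "has_weak_gradient \<Omega> (\<lambda>_. 0) D"
    using has_weak_gradient_lincomb[OF \<Omega> p q, of 1 "-1"] by (simp add: D_def[abs_def])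
  note D = has_weak_gradientD[OF this]
  have "AE x in lebesgue_on \<Omega>. D x \<bullet> c = 0" for c
  proof (rule fundamental_lemma[OF \<Omega>(1)])
    show "integrable (lebesgue_on \<Omega>) (\<lambda>x. D x \<bullet> c)"
      by (rule L2_integrable[OF fin L2_inner_const[OF D(2)]])
    fix \<phi> \<phi>' assume \<phi>: "test_function \<Omega> \<phi> \<phi>'"
    have int: "integrable (lebesgue_on \<Omega>) (\<lambda>x. \<phi> x *\<^sub>R D x)"
      by (rule L2_scaleR_integrable[OF test_function_L2_lebesgue(1)[OF \<Omega> \<phi>] D(2)])
    have "(\<integral>x. \<phi> x * (D x \<bullet> c) \<partial>lebesgue_on \<Omega>) = (\<integral>x. (\<phi> x *\<^sub>R D x) \<bullet> c \<partial>lebesgue_on \<Omega>)" by simp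
    also have "\<dots> = (\<integral>x. \<phi> x *\<^sub>R D x \<partial>lebesgue_on \<Omega>) \<bullet> c"
      by (rule integral_inner_left) (rule int)
    also have "\<dots> = 0" using D(3)[OF \<phi>] by simp
    finally show "(\<integral>x. \<phi> x * (D x \<bullet> c) \<partial>lebesgue_on \<Omega>) = 0" .
  qed
  then have "AE x in lebesgue_on \<Omega>. \<forall>c\<in>Basis. D x \<bullet> c = 0"
    by (rule AE_finite_allI[OF finite_Basis])
  then show ?thesis
  proof eventually_elim
    case (elim x)
    then have "D x = 0" by (simp add: euclidean_all_zero_iff)
    then show ?case by (simp add: D_def)
  qed
qed

lemma poisson_solution_lincomb:
  assumes \<Omega>: "open \<Omega>" "bounded \<Omega>" and u: "poisson_solution \<Omega> f u" and w: "poisson_solution \<Omega> g w"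
  shows "poisson_solution \<Omega> (\<lambda>v. r * f v + t * g v) (\<lambda>x. r * u x + t * w x)"
proof -
  obtain p where p: "has_weak_gradient \<Omega> u p"
    "\<And>v q. v \<in> H1_zero \<Omega> \<Longrightarrow> has_weak_gradient \<Omega> v q \<Longrightarrow> (\<integral>x. p x \<bullet> q x \<partial>lebesgue_on \<Omega>) = f v"
    using u unfolding poisson_solution_def by blast
  obtain p' where p': "has_weak_gradient \<Omega> w p'"
    "\<And>v q. v \<in> H1_zero \<Omega> \<Longrightarrow> has_weak_gradient \<Omega> v q \<Longrightarrow> (\<integral>x. p' x \<bullet> q x \<partial>lebesgue_on \<Omega>) = g v"
    using w unfolding poisson_solution_def by blast
  show ?thesis
    unfolding poisson_solution_def
  proof (intro exI[of _ "\<lambda>x. r *\<^sub>R p x + t *\<^sub>R p' x"] conjI ballI allI impI)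
    show "has_weak_gradient \<Omega> (\<lambda>x. r * u x + t * w x) (\<lambda>x. r *\<^sub>R p x + t *\<^sub>R p' x)"
      by (rule has_weak_gradient_lincomb[OF \<Omega> p(1) p'(1)])
    fix v q assume v: "v \<in> H1_zero \<Omega>" "has_weak_gradient \<Omega> v q"
    have "integrable (lebesgue_on \<Omega>) (\<lambda>x. p x \<bullet> q x)" "integrable (lebesgue_on \<Omega>) (\<lambda>x. p' x \<bullet> q x)"
      using has_weak_gradientD(2) p(1) p'(1) v(2) by (auto intro!: L2_inner_integrable)
    then show "(\<integral>x. (r *\<^sub>R p x + t *\<^sub>R p' x) \<bullet> q x \<partial>lebesgue_on \<Omega>) = r * f v + t * g v"
      by (simp add: inner_add_left p(2)[OF v] p'(2)[OF v])
  qed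
qed

lemma has_boundary_trace_lincomb:
  assumes \<Omega>: "open \<Omega>" "bounded \<Omega>" and v: "has_boundary_trace \<Omega> F v g" and w: "has_boundary_trace \<Omega> F w h"
  shows "has_boundary_trace \<Omega> F (\<lambda>x. r * v x + t * w x) (\<lambda>x. r * g x + t * h x)"
proof -
  from v obtain p \<psi> \<psi>' where 1: "has_weak_gradient \<Omega> v p \<and> (\<forall>k. C1_with_gradient (\<psi> k) (\<psi>' k)) \<and>
     L2_tendsto (lebesgue_on \<Omega>) \<psi> v \<and> L2_tendsto (lebesgue_on \<Omega>) \<psi>' p \<and> L2_tendsto (surface_measure F) \<psi> g"
    unfolding has_boundary_trace_def by (elim exE)
  from w obtain q \<xi> \<xi>' where 2: "has_weak_gradient \<Omega> w q \<and> (\<forall>k. C1_with_gradient (\<xi> k) (\<xi>' k)) \<and>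
     L2_tendsto (lebesgue_on \<Omega>) \<xi> w \<and> L2_tendsto (lebesgue_on \<Omega>) \<xi>' q \<and> L2_tendsto (surface_measure F) \<xi> h"
    unfolding has_boundary_trace_def by (elim exE)
  show ?thesis
    unfolding has_boundary_trace_def
  proof (rule exI[of _ "\<lambda>x. r *\<^sub>R p x + t *\<^sub>R q x"], rule exI[of _ "\<lambda>k x. r * \<psi> k x + t * \<xi> k x"],
      rule exI[of _ "\<lambda>k x. r *\<^sub>R \<psi>' k x + t *\<^sub>R \<xi>' k x"], intro conjI allI)
    show "has_weak_gradient \<Omega> (\<lambda>x. r * v x + t * w x) (\<lambda>x. r *\<^sub>R p x + t *\<^sub>R q x)"
      using 1 2 by (intro has_weak_gradient_lincomb \<Omega>) simp_all
    show "C1_with_gradient (\<lambda>x. r * \<psi> k x + t * \<xi> k x) (\<lambda>x. r *\<^sub>R \<psi>' k x + t *\<^sub>R \<xi>' k x)" for k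
      using 1 2 by (intro C1_with_gradient_lincomb) simp_all
    show "L2_tendsto (lebesgue_on \<Omega>) (\<lambda>k x. r * \<psi> k x + t * \<xi> k x) (\<lambda>x. r * v x + t * w x)"
      using 1 2 L2_tendsto_lincomb[of "lebesgue_on \<Omega>" \<psi> v \<xi> w r t] by simp
    show "L2_tendsto (lebesgue_on \<Omega>) (\<lambda>k x. r *\<^sub>R \<psi>' k x + t *\<^sub>R \<xi>' k x) (\<lambda>x. r *\<^sub>R p x + t *\<^sub>R q x)"
      using 1 2 L2_tendsto_lincomb[of "lebesgue_on \<Omega>" \<psi>' p \<xi>' q r t] by simp
    show "L2_tendsto (surface_measure F) (\<lambda>k x. r * \<psi> k x + t * \<xi> k x) (\<lambda>x. r * g x + t * h x)"
      using 1 2 L2_tendsto_lincomb[of "surface_measure F" \<psi> g \<xi> h r t] by simp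
  qed
qed

text \<open>The weak gradient inside \<open>has_boundary_trace\<close> is existential. By uniqueness
  of weak gradients it is zero almost everywhere here, so the approximating gradients tend to zero,
  as \<open>trace_zero\<close> requires.\<close>

lemma has_boundary_trace_zero_unique:
  assumes \<Omega>: "polyhedral_boundary \<Omega> F" and v: "has_boundary_trace \<Omega> F (\<lambda>_. 0) g"
  shows "AE x in surface_measure F. g x = 0"
proof -
  note F = polyhedral_boundaryD[OF \<Omega>]
  from v obtain p \<psi> \<psi>' where 1: "has_weak_gradient \<Omega> (\<lambda>_. 0) p \<and> (\<forall>k. C1_with_gradient (\<psi> k) (\<psi>' k)) \<and>
     L2_tendsto (lebesgue_on \<Omega>) \<psi> (\<lambda>_. 0) \<and> L2_tendsto (lebesgue_on \<Omega>) \<psi>' p \<and> L2_tendsto (surface_measure F) \<psi> g"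
    unfolding has_boundary_trace_def by (elim exE)
  have "has_weak_gradient \<Omega> (\<lambda>_. 0) (\<lambda>_. 0)"
    by (simp add: has_weak_gradient_def L2_def)
  then have "AE x in lebesgue_on \<Omega>. p x = 0"
    using weak_gradient_unique[OF F(1,2)] 1 by blast
  then have "L2_tendsto (lebesgue_on \<Omega>) \<psi>' (\<lambda>_. 0)"
    using L2_tendsto_cong_AE[of "lebesgue_on \<Omega>" \<psi>' p "\<lambda>_. 0"] 1 by simp
  then show ?thesis
    using trace_zero[OF \<Omega>, of \<psi> \<psi>' g] 1 by simp
qed

lemma boundary_trace_unique:
  assumes \<Omega>: "polyhedral_boundary \<Omega> F" and "has_boundary_trace \<Omega> F v g" "has_boundary_trace \<Omega> F v h"
  shows "AE x in surface_measure F. g x = h x"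
proof -
  note F = polyhedral_boundaryD[OF \<Omega>]
  have "has_boundary_trace \<Omega> F (\<lambda>_. 0) (\<lambda>x. g x - h x)"
    using has_boundary_trace_lincomb[OF F(1,2) assms(2,3), of 1 "-1"] by simp
  then have "AE x in surface_measure F. g x - h x = 0" by (rule has_boundary_trace_zero_unique[OF \<Omega>])
  then show ?thesis by simp
qed

lemma has_boundary_trace_L2:
  assumes "has_boundary_trace \<Omega> F v g" shows "g \<in> L2 (surface_measure F)"
  using assms unfolding has_boundary_trace_def L2_tendsto_def by (elim exE conjE)

text \<open>The test functions that define membership in \<open>H1_zero\<close> also serve as the
  approximants of the trace: they vanish off \<open>\<Omega>\<close>, hence on the frontier, where
  the surface measure is concentrated.\<close>

lemma H1_zero_has_boundary_trace:
  assumes \<Omega>: "polyhedral_boundary \<Omega> F" and u: "u \<in> H1_zero \<Omega>"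
  shows "has_boundary_trace \<Omega> F u (\<lambda>_. 0)"
proof -
  note F = polyhedral_boundaryD[OF \<Omega>]
  from u obtain p \<phi> \<phi>' where 1: "has_weak_gradient \<Omega> u p \<and> (\<forall>k. test_function \<Omega> (\<phi> k) (\<phi>' k)) \<and>
     L2_tendsto (lebesgue_on \<Omega>) \<phi> u \<and> L2_tendsto (lebesgue_on \<Omega>) \<phi>' p"
    unfolding H1_zero_def by (elim CollectE exE)
  have C1: "C1_with_gradient (\<phi> k) (\<phi>' k)" for k
    using 1 by (simp add: test_function_def)
  have AE: "AE x in surface_measure F. x \<in> frontier \<Omega>"
  proof (rule AE_surface_measureI[OF F(5,3)])
    show "{x. x \<in> frontier \<Omega>} \<in> sets borel" by simp
    show "AE y in prism_measure P. facet_proj P y \<in> frontier \<Omega>" if "P \<in> F" for P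
      using that F(4) by (intro AE_I2) (auto simp: prism_measure_simps prism_def)
  qed
  have zero: "AE x in surface_measure F. \<phi> k x = 0" for k
    using AE
  proof eventually_elim
    case (elim x)
    then have "x \<notin> \<Omega>" using F(1) by (simp add: frontier_def interior_open)
    moreover obtain K where "K \<subseteq> \<Omega>" "\<And>x. x \<notin> K \<Longrightarrow> \<phi> k x = 0"
      using 1 by (auto simp: test_function_def)
    ultimately show "\<phi> k x = 0" by blast
  qed
  have m: "\<phi> k \<in> borel_measurable (surface_measure F)" for k
    using C1_with_gradient_measurable(1)[OF C1] measurable_cong_sets[OF sets_surface_measure refl] by blast
  have z: "(\<lambda>_. 0) \<in> L2 (surface_measure F)" by (simp add: L2_def)
  have "L2_tendsto (surface_measure F) \<phi> (\<lambda>_. 0)"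
    unfolding L2_tendsto_def
  proof (intro conjI allI z)
    show "\<phi> k \<in> L2 (surface_measure F)" for k
      by (rule L2_cong_AE[OF z m]) (use zero in simp)
    have "(\<integral>x. (norm (\<phi> k x - 0))\<^sup>2 \<partial>surface_measure F) = 0" for k
      using zero[of k] by (intro integral_eq_zero_AE) auto
    then show "(\<lambda>k. \<integral>x. (norm (\<phi> k x - 0))\<^sup>2 \<partial>surface_measure F) \<longlonglongrightarrow> 0" by simp
  qed
  then show ?thesis
    unfolding has_boundary_trace_def
    by (intro exI[of _ p] exI[of _ \<phi>] exI[of _ \<phi>']) (use 1 C1 in simp)
qed

subsection \<open>The inner product of the boundary space\<close>

lemma AE_pair_measure_both:
  assumes M: "finite_measure M" and P: "AE x in M. P x"
  shows "AE z in M \<Otimes>\<^sub>M M. P (fst z) \<and> P (snd z)"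
proof -
  interpret finite_measure M by fact
  from P obtain N where N: "{x \<in> space M. \<not> P x} \<subseteq> N" "N \<in> sets M" "emeasure M N = 0"
    by (auto elim!: AE_E)
  have "N \<times> space M \<in> null_sets (M \<Otimes>\<^sub>M M)" "space M \<times> N \<in> null_sets (M \<Otimes>\<^sub>M M)"
    using N by (auto simp: null_sets_def emeasure_pair_measure_Times)
  then have "(N \<times> space M) \<union> (space M \<times> N) \<in> null_sets (M \<Otimes>\<^sub>M M)" by (rule null_sets.Un)
  then show ?thesis
    by (rule AE_I') (use N(1) in \<open>auto simp: space_pair_measure\<close>)
qed

section \<open>The Slobodeckij form\<close>

lemma slobodeckij_integrand_measurable:
  fixes g h :: "real^'n \<Rightarrow> 'b::euclidean_space"
  assumes "g \<in> borel_measurable (surface_measure F)" "h \<in> borel_measurable (surface_measure F)"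
  shows "slobodeckij_integrand \<sigma> g h \<in> borel_measurable (surface_measure F \<Otimes>\<^sub>M surface_measure F)"
proof -
  note [measurable] = assms
  have [measurable]: "fst \<in> measurable (surface_measure F \<Otimes>\<^sub>M surface_measure F) (borel :: (real^'n) measure)"
    "snd \<in> measurable (surface_measure F \<Otimes>\<^sub>M surface_measure F) (borel :: (real^'n) measure)"
    using measurable_fst[of "surface_measure F" "surface_measure F"] measurable_snd[of "surface_measure F" "surface_measure F"]
    by (simp_all add: measurable_cong_sets[OF refl sets_surface_measure])
  have [measurable]: "(\<lambda>z. dist (fst z) (snd z)) \<in> borel_measurable (surface_measure F \<Otimes>\<^sub>M surface_measure F)"
    by (intro borel_measurable_dist) measurable
  show ?thesis
    unfolding slobodeckij_integrand_def split_beta' by measurable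
qed

lemma slobodeckij_integrand_lincomb:
  "slobodeckij_integrand \<sigma> (\<lambda>x. r *\<^sub>R g x + t *\<^sub>R h x) k z
    = r * slobodeckij_integrand \<sigma> g k z + t * slobodeckij_integrand \<sigma> h k z"
proof -
  obtain x y where z: "z = (x, y)" by (cases z)
  have "(r *\<^sub>R g x + t *\<^sub>R h x) - (r *\<^sub>R g y + t *\<^sub>R h y) = r *\<^sub>R (g x - g y) + t *\<^sub>R (h x - h y)"
    by (simp add: algebra_simps)
  then show ?thesis
    by (simp add: slobodeckij_integrand_def z inner_add_left add_divide_distrib)
qed

lemma slobodeckij_integrand_commute: "slobodeckij_integrand \<sigma> g h = slobodeckij_integrand \<sigma> h g"
  by (auto simp: slobodeckij_integrand_def inner_commute)

lemma slobodeckij_integrand_le: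
  "\<bar>slobodeckij_integrand \<sigma> g h z\<bar> \<le> slobodeckij_integrand \<sigma> g g z + slobodeckij_integrand \<sigma> h h z"
proof -
  obtain x y where z: "z = (x, y)" by (cases z)
  define a b w where "a = g x - g y" and "b = h x - h y" and "w = dist x y powr (real CARD('a) - 1 + 2 * \<sigma>)"
  \<comment> \<open>On the diagonal \<open>w\<close> is 0 and all quotients are 0 by convention, so
    a nonnegative denominator is enough for monotonicity of division.\<close>
  have w: "w \<ge> 0" by (simp add: w_def)
  have "\<bar>a \<bullet> b\<bar> \<le> (norm a)\<^sup>2 / (2 * 1) + 1 * (norm b)\<^sup>2 / 2" by (rule abs_inner_le_sq) simp
  also have "\<dots> \<le> a \<bullet> a + b \<bullet> b"
    using inner_ge_zero[of a] inner_ge_zero[of b] unfolding power2_norm_eq_inner by linarith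
  finally have "\<bar>a \<bullet> b\<bar> / w \<le> (a \<bullet> a + b \<bullet> b) / w" using w by (rule divide_right_mono)
  then show ?thesis
    using w by (simp add: slobodeckij_integrand_def z a_def b_def w_def add_divide_distrib)
qed

lemma slobodeckij_integrable:
  fixes g h :: "real^'n \<Rightarrow> 'b::euclidean_space"
  assumes "g \<in> borel_measurable (surface_measure F)" "h \<in> borel_measurable (surface_measure F)"
    and "slobodeckij_finite F \<sigma> g" "slobodeckij_finite F \<sigma> h"
  shows "integrable (surface_measure F \<Otimes>\<^sub>M surface_measure F) (slobodeckij_integrand \<sigma> g h)"
proof (rule Bochner_Integration.integrable_bound)
  show "integrable (surface_measure F \<Otimes>\<^sub>M surface_measure F)
      (\<lambda>z. slobodeckij_integrand \<sigma> g g z + slobodeckij_integrand \<sigma> h h z)"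
    using assms(3,4) unfolding slobodeckij_finite_def by (rule Bochner_Integration.integrable_add)
  show "AE z in surface_measure F \<Otimes>\<^sub>M surface_measure F. norm (slobodeckij_integrand \<sigma> g h z)
      \<le> norm (slobodeckij_integrand \<sigma> g g z + slobodeckij_integrand \<sigma> h h z)"
    using slobodeckij_integrand_le[of \<sigma> g h] by (intro AE_I2) (simp add: order_trans[OF _ abs_ge_self])
qed (rule slobodeckij_integrand_measurable[OF assms(1,2)])

lemma slobodeckij_form_lincomb:
  fixes g h k :: "real^'n \<Rightarrow> 'b::euclidean_space"
  assumes "g \<in> borel_measurable (surface_measure F)" "h \<in> borel_measurable (surface_measure F)"
    "k \<in> borel_measurable (surface_measure F)"
    and "slobodeckij_finite F \<sigma> g" "slobodeckij_finite F \<sigma> h" "slobodeckij_finite F \<sigma> k"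
  shows "slobodeckij_form F \<sigma> (\<lambda>x. r *\<^sub>R g x + t *\<^sub>R h x) k = r * slobodeckij_form F \<sigma> g k + t * slobodeckij_form F \<sigma> h k"
  unfolding slobodeckij_form_def slobodeckij_integrand_lincomb
  using slobodeckij_integrable[OF assms(1,3,4,6)] slobodeckij_integrable[OF assms(2,3,5,6)] by simp

lemma slobodeckij_finite_lincomb:
  fixes g h :: "real^'n \<Rightarrow> 'b::euclidean_space"
  assumes "g \<in> borel_measurable (surface_measure F)" "h \<in> borel_measurable (surface_measure F)"
    and "slobodeckij_finite F \<sigma> g" "slobodeckij_finite F \<sigma> h"
  shows "slobodeckij_finite F \<sigma> (\<lambda>x. r *\<^sub>R g x + t *\<^sub>R h x)"
proof -
  let ?c = "\<lambda>x. r *\<^sub>R g x + t *\<^sub>R h x"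
  have eq: "slobodeckij_integrand \<sigma> ?c ?c z = r * (r * slobodeckij_integrand \<sigma> g g z + t * slobodeckij_integrand \<sigma> h g z)
      + t * (r * slobodeckij_integrand \<sigma> g h z + t * slobodeckij_integrand \<sigma> h h z)" for z
    using slobodeckij_integrand_lincomb[of \<sigma> r g t h ?c z] slobodeckij_integrand_lincomb[of \<sigma> r g t h g z]
      slobodeckij_integrand_lincomb[of \<sigma> r g t h h z]
    by (simp add: slobodeckij_integrand_commute[of \<sigma> g ?c] slobodeckij_integrand_commute[of \<sigma> h ?c])
  show ?thesis
    unfolding slobodeckij_finite_def eq
    by (intro Bochner_Integration.integrable_add integrable_mult_right slobodeckij_integrable assms)
qed

lemma slobodeckij_integrand_cong_AE:
  fixes g h :: "real^'n \<Rightarrow> 'b::euclidean_space"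
  assumes M: "finite_measure (surface_measure F)"
    and "AE x in surface_measure F. g x = g' x" "AE x in surface_measure F. h x = h' x"
  shows "AE z in surface_measure F \<Otimes>\<^sub>M surface_measure F. slobodeckij_integrand \<sigma> g h z = slobodeckij_integrand \<sigma> g' h' z"
  using AE_pair_measure_both[OF M assms(2)] AE_pair_measure_both[OF M assms(3)]
  by eventually_elim (simp add: slobodeckij_integrand_def split_beta')

lemma slobodeckij_form_cong_AE:
  fixes g h :: "real^'n \<Rightarrow> 'b::euclidean_space"
  assumes M: "finite_measure (surface_measure F)"
    and m: "g \<in> borel_measurable (surface_measure F)" "g' \<in> borel_measurable (surface_measure F)"
    "h \<in> borel_measurable (surface_measure F)" "h' \<in> borel_measurable (surface_measure F)"
    and ae: "AE x in surface_measure F. g x = g' x" "AE x in surface_measure F. h x = h' x"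
  shows "slobodeckij_form F \<sigma> g h = slobodeckij_form F \<sigma> g' h'"
  unfolding slobodeckij_form_def
  by (rule integral_cong_AE[OF slobodeckij_integrand_measurable[OF m(1,3)] slobodeckij_integrand_measurable[OF m(2,4)]
      slobodeckij_integrand_cong_AE[OF M ae]])

lemma slobodeckij_finite_cong_AE:
  fixes g :: "real^'n \<Rightarrow> 'b::euclidean_space"
  assumes M: "finite_measure (surface_measure F)"
    and m: "g \<in> borel_measurable (surface_measure F)" "g' \<in> borel_measurable (surface_measure F)"
    and ae: "AE x in surface_measure F. g x = g' x" and g: "slobodeckij_finite F \<sigma> g"
  shows "slobodeckij_finite F \<sigma> g'"
  using g unfolding slobodeckij_finite_def
  by (rule integrable_cong_AE_imp[OF _ slobodeckij_integrand_measurable[OF m(2,2)]])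
    (use slobodeckij_integrand_cong_AE[OF M ae ae, of \<sigma>] in \<open>simp add: eq_commute\<close>)

lemma slobodeckij_form_commute: "slobodeckij_form F \<sigma> g h = slobodeckij_form F \<sigma> h g"
  by (simp add: slobodeckij_form_def slobodeckij_integrand_commute[of \<sigma> g h])

section \<open>Tangential gradients and the boundary space modulo null sets\<close>

lemma has_tangential_gradient_cong_AE:
  assumes "has_tangential_gradient F g q" "h \<in> borel_measurable (surface_measure F)" "AE x in surface_measure F. g x = h x"
  shows "has_tangential_gradient F h q"
proof -
  from assms(1) obtain \<psi> \<psi>' where 1: "(\<forall>k. C1_with_gradient (\<psi> k) (\<psi>' k)) \<and> L2_tendsto (surface_measure F) \<psi> g \<and>
    L2_tendsto (surface_measure F) (\<lambda>k x. tangential_part F x (\<psi>' k x)) q"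
    unfolding has_tangential_gradient_def by (elim exE)
  then have "L2_tendsto (surface_measure F) \<psi> h"
    using L2_tendsto_cong_AE[OF _ assms(2,3)] by simp
  with 1 show ?thesis
    unfolding has_tangential_gradient_def by (intro exI[of _ \<psi>] exI[of _ \<psi>']) simp
qed

lemma has_tangential_gradient_L2:
  assumes "has_tangential_gradient F g q" shows "q \<in> L2 (surface_measure F)"
  using assms unfolding has_tangential_gradient_def L2_tendsto_def by (elim exE conjE)

lemma has_tangential_gradient_unique:
  assumes \<Omega>: "polyhedral_boundary \<Omega> F" and "has_tangential_gradient F g q" "has_tangential_gradient F g p"
  shows "AE x in surface_measure F. q x = p x"
proof -
  have "has_tangential_gradient F (\<lambda>_. 0) (\<lambda>x. q x - p x)"
    using has_tangential_gradient_lincomb[OF assms(2,3), of 1 "-1"] by simp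
  then have "AE x in surface_measure F. q x - p x = 0" by (rule tangential_gradient_zero[OF \<Omega>])
  then show ?thesis by simp
qed

lemma tangential_gradient:
  "has_tangential_gradient F g q \<Longrightarrow> has_tangential_gradient F g (tangential_gradient F g)"
  unfolding tangential_gradient_def by (rule someI[where P="has_tangential_gradient F g"])

text \<open>Membership in \<open>Hs_boundary\<close> speaks of some tangential gradient, whereas the
  inner product uses the one selected by \<open>tangential_gradient\<close>. Uniqueness up to null
  sets carries the finiteness over to the selected one.\<close>

lemma Hs_boundaryD:
  assumes \<Omega>: "polyhedral_boundary \<Omega> F" and g: "g \<in> Hs_boundary F s"
  shows "g \<in> L2 (surface_measure F)" "g \<in> borel_measurable (surface_measure F)"
    "s < 1 \<Longrightarrow> slobodeckij_finite F s g"
    "s \<ge> 1 \<Longrightarrow> has_tangential_gradient F g (tangential_gradient F g)"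
    "s \<ge> 1 \<Longrightarrow> tangential_gradient F g \<in> L2 (surface_measure F)"
    "s \<ge> 1 \<Longrightarrow> tangential_gradient F g \<in> borel_measurable (surface_measure F)"
    "s > 1 \<Longrightarrow> slobodeckij_finite F (s - 1) (tangential_gradient F g)"
proof -
  note F = polyhedral_boundaryD[OF \<Omega>]
  have fin: "finite_measure (surface_measure F)" by (rule finite_surface_measure[OF F(5,3)])
  show "g \<in> L2 (surface_measure F)" using g by (simp add: Hs_boundary_def)
  then show "g \<in> borel_measurable (surface_measure F)" by (rule L2_measurable)
  show "s < 1 \<Longrightarrow> slobodeckij_finite F s g" using g by (simp add: Hs_boundary_def)
  show tg: "has_tangential_gradient F g (tangential_gradient F g)" if "s \<ge> 1"
    using g that tangential_gradient by (auto simp: Hs_boundary_def)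
  show L: "tangential_gradient F g \<in> L2 (surface_measure F)" if "s \<ge> 1"
    using has_tangential_gradient_L2[OF tg[OF that]] .
  show "tangential_gradient F g \<in> borel_measurable (surface_measure F)" if "s \<ge> 1"
    using L2_measurable[OF L[OF that]] .
  show "slobodeckij_finite F (s - 1) (tangential_gradient F g)" if "s > 1"
  proof -
    have "\<not> s < 1" using that by simp
    then obtain q where q: "has_tangential_gradient F g q" "slobodeckij_finite F (s - 1) q"
      using g \<open>s > 1\<close> unfolding Hs_boundary_def by auto
    show ?thesis
      by (rule slobodeckij_finite_cong_AE[OF fin _ _ _ q(2)])
        (use that tg L has_tangential_gradient_L2[OF q(1)] has_tangential_gradient_unique[OF \<Omega> q(1)] in \<open>simp_all add: L2_measurable\<close>)
  qed
qed

lemma Hs_boundary_lincomb: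
  assumes \<Omega>: "polyhedral_boundary \<Omega> F" and g: "g \<in> Hs_boundary F s" and h: "h \<in> Hs_boundary F s"
  shows "(\<lambda>x. r * g x + t * h x) \<in> Hs_boundary F s"
proof -
  note G = Hs_boundaryD[OF \<Omega> g] and H = Hs_boundaryD[OF \<Omega> h]
  have L: "(\<lambda>x. r * g x + t * h x) \<in> L2 (surface_measure F)"
    using L2_lincomb[OF G(1) H(1), of r t] by simp
  show ?thesis
  proof (cases "s < 1")
    case True
    then show ?thesis
      using slobodeckij_finite_lincomb[OF G(2) H(2) G(3) H(3), of r t] L by (simp add: Hs_boundary_def)
  next
    case False
    let ?q = "\<lambda>x. r *\<^sub>R tangential_gradient F g x + t *\<^sub>R tangential_gradient F h x"
    have "has_tangential_gradient F (\<lambda>x. r * g x + t * h x) ?q"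
      using False by (intro has_tangential_gradient_lincomb G(4) H(4)) simp_all
    moreover have "slobodeckij_finite F (s - 1) ?q" if "s > 1"
      using that by (intro slobodeckij_finite_lincomb G H) simp_all
    ultimately show ?thesis using L False by (auto simp: Hs_boundary_def intro!: exI[of _ ?q])
  qed
qed

lemma tangential_gradient_lincomb:
  assumes \<Omega>: "polyhedral_boundary \<Omega> F" and g: "g \<in> Hs_boundary F s" and h: "h \<in> Hs_boundary F s" and s: "s \<ge> 1"
  shows "AE x in surface_measure F. tangential_gradient F (\<lambda>x. r * g x + t * h x) x
    = r *\<^sub>R tangential_gradient F g x + t *\<^sub>R tangential_gradient F h x"
  by (rule has_tangential_gradient_unique[OF \<Omega>
      Hs_boundaryD(4)[OF \<Omega> Hs_boundary_lincomb[OF \<Omega> g h] s]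
      has_tangential_gradient_lincomb[OF Hs_boundaryD(4)[OF \<Omega> g s] Hs_boundaryD(4)[OF \<Omega> h s]]])

text \<open>The selected tangential gradients are linear only up to null sets. Each part of the
  inner product is an integral that ignores such sets, and square integrability or finiteness of the
  seminorm allows the integrals to be split.\<close>

lemma Hs_boundary_inner_lincomb:
  assumes \<Omega>: "polyhedral_boundary \<Omega> F"
    and g: "g \<in> Hs_boundary F s" and h: "h \<in> Hs_boundary F s" and k: "k \<in> Hs_boundary F s"
  shows "Hs_boundary_inner F s (\<lambda>x. r * g x + t * h x) k = r * Hs_boundary_inner F s g k + t * Hs_boundary_inner F s h k"
proof -
  note F = polyhedral_boundaryD[OF \<Omega>]
  have fin: "finite_measure (surface_measure F)" by (rule finite_surface_measure[OF F(5,3)])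
  note G = Hs_boundaryD[OF \<Omega> g] and H = Hs_boundaryD[OF \<Omega> h] and K = Hs_boundaryD[OF \<Omega> k]
    and GH = Hs_boundaryD[OF \<Omega> Hs_boundary_lincomb[OF \<Omega> g h, of r t]]
  let ?S = "surface_measure F" and ?T = "tangential_gradient F"
  let ?c = "\<lambda>x. r * g x + t * h x" and ?q = "\<lambda>x. r *\<^sub>R ?T g x + t *\<^sub>R ?T h x"
  have "(\<integral>x. ?c x * k x \<partial>?S) = (\<integral>x. r * (g x * k x) + t * (h x * k x) \<partial>?S)"
    by (simp add: algebra_simps)
  also have "\<dots> = r * (\<integral>x. g x * k x \<partial>?S) + t * (\<integral>x. h x * k x \<partial>?S)"
    using L2_mult_integrable[OF G(1) K(1)] L2_mult_integrable[OF H(1) K(1)] by simp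
  finally have 1: "(\<integral>x. ?c x * k x \<partial>?S) = r * (\<integral>x. g x * k x \<partial>?S) + t * (\<integral>x. h x * k x \<partial>?S)" .
  have 2: "slobodeckij_form F s ?c k = r * slobodeckij_form F s g k + t * slobodeckij_form F s h k" if "s < 1"
    using slobodeckij_form_lincomb[OF G(2) H(2) K(2) G(3) H(3) K(3), of r t] that by simp
  have ae: "AE x in ?S. ?T ?c x = ?q x" if "s \<ge> 1"
    by (rule tangential_gradient_lincomb[OF \<Omega> g h that])
  have 3: "(\<integral>x. ?T ?c x \<bullet> ?T k x \<partial>?S) = r * (\<integral>x. ?T g x \<bullet> ?T k x \<partial>?S) + t * (\<integral>x. ?T h x \<bullet> ?T k x \<partial>?S)" if s: "s \<ge> 1"
  proof -
    note [measurable] = G(6)[OF s] H(6)[OF s] K(6)[OF s] GH(6)[OF s]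
    have "(\<integral>x. ?T ?c x \<bullet> ?T k x \<partial>?S) = (\<integral>x. r * (?T g x \<bullet> ?T k x) + t * (?T h x \<bullet> ?T k x) \<partial>?S)"
    proof (rule integral_cong_AE)
      show "AE x in ?S. ?T ?c x \<bullet> ?T k x = r * (?T g x \<bullet> ?T k x) + t * (?T h x \<bullet> ?T k x)"
        using ae[OF s] by eventually_elim (simp add: inner_add_left)
    qed measurable
    also have "\<dots> = r * (\<integral>x. ?T g x \<bullet> ?T k x \<partial>?S) + t * (\<integral>x. ?T h x \<bullet> ?T k x \<partial>?S)"
      using L2_inner_integrable[OF G(5)[OF s] K(5)[OF s]] L2_inner_integrable[OF H(5)[OF s] K(5)[OF s]] by simp
    finally show ?thesis .
  qed
  have 4: "slobodeckij_form F (s - 1) (?T ?c) (?T k)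
      = r * slobodeckij_form F (s - 1) (?T g) (?T k) + t * slobodeckij_form F (s - 1) (?T h) (?T k)" if s: "s > 1"
  proof -
    have s': "s \<ge> 1" using s by simp
    have "?q \<in> borel_measurable ?S" using G(6)[OF s'] H(6)[OF s'] by measurable
    then have "slobodeckij_form F (s - 1) (?T ?c) (?T k) = slobodeckij_form F (s - 1) ?q (?T k)"
      by (intro slobodeckij_form_cong_AE[OF fin] GH(6)[OF s'] K(6)[OF s'] ae[OF s']) simp_all
    also have "\<dots> = r * slobodeckij_form F (s - 1) (?T g) (?T k) + t * slobodeckij_form F (s - 1) (?T h) (?T k)"
      by (intro slobodeckij_form_lincomb G(6)[OF s'] H(6)[OF s'] K(6)[OF s'] G(7)[OF s] H(7)[OF s] K(7)[OF s])
    finally show ?thesis .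
  qed
  consider (lt) "s < 1" | (eq) "s = 1" | (gt) "s > 1" by linarith
  then show ?thesis
  proof cases
    case lt
    then show ?thesis unfolding Hs_boundary_inner_def 1 using 2 by (simp add: algebra_simps)
  next
    case eq
    then show ?thesis unfolding Hs_boundary_inner_def 1 using 3 by (simp add: algebra_simps)
  next
    case gt
    then show ?thesis unfolding Hs_boundary_inner_def 1 using 3 4 by (simp add: algebra_simps)
  qed
qed

lemma Hs_boundary_inner_commute: "Hs_boundary_inner F s g h = Hs_boundary_inner F s h g"
  by (simp add: Hs_boundary_inner_def slobodeckij_form_commute[of F _ g] inner_commute mult.commute
      slobodeckij_form_commute[of F _ "tangential_gradient F g"])

text \<open>Functions that agree almost everywhere admit the same tangential gradients, so the
  choice operator is applied to equal predicates and returns literally the same function.\<close>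

lemma tangential_gradient_cong_AE:
  assumes "g \<in> borel_measurable (surface_measure F)" "h \<in> borel_measurable (surface_measure F)"
    and "AE x in surface_measure F. g x = h x"
  shows "tangential_gradient F g = tangential_gradient F h"
proof -
  have "AE x in surface_measure F. h x = g x" using assms(3) by (simp add: eq_commute)
  then have "has_tangential_gradient F g = has_tangential_gradient F h"
    using assms by (intro ext iffI)
      (rule has_tangential_gradient_cong_AE[of F g], simp_all, rule has_tangential_gradient_cong_AE[of F h], simp_all)
  then show ?thesis by (simp add: tangential_gradient_def)
qed

lemma Hs_boundary_inner_cong_AE:
  assumes M: "finite_measure (surface_measure F)"
    and m: "g \<in> borel_measurable (surface_measure F)" "g' \<in> borel_measurable (surface_measure F)"
    "h \<in> borel_measurable (surface_measure F)" "h' \<in> borel_measurable (surface_measure F)"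
    and ae: "AE x in surface_measure F. g x = g' x" "AE x in surface_measure F. h x = h' x"
  shows "Hs_boundary_inner F s g h = Hs_boundary_inner F s g' h'"
proof -
  have "(\<integral>x. g x * h x \<partial>surface_measure F) = (\<integral>x. g' x * h' x \<partial>surface_measure F)"
  proof (rule integral_cong_AE)
    show "AE x in surface_measure F. g x * h x = g' x * h' x" using ae by eventually_elim simp
  qed (use m in measurable)
  then show ?thesis
    using slobodeckij_form_cong_AE[OF M m ae]
    by (simp add: Hs_boundary_inner_def tangential_gradient_cong_AE[OF m(1,2) ae(1)] tangential_gradient_cong_AE[OF m(3,4) ae(2)])
qed

lemma Hs_boundary_cong_AE:
  assumes M: "finite_measure (surface_measure F)" and g: "g \<in> Hs_boundary F s"
    and h: "h \<in> borel_measurable (surface_measure F)" and ae: "AE x in surface_measure F. g x = h x"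
  shows "h \<in> Hs_boundary F s"
proof -
  have gL: "g \<in> L2 (surface_measure F)" using g by (simp add: Hs_boundary_def)
  have "h \<in> L2 (surface_measure F)" by (rule L2_cong_AE[OF gL h ae])
  moreover have "slobodeckij_finite F s g \<Longrightarrow> slobodeckij_finite F s h"
    by (rule slobodeckij_finite_cong_AE[OF M L2_measurable[OF gL] h ae])
  moreover have "has_tangential_gradient F g q \<Longrightarrow> has_tangential_gradient F h q" for q
    by (rule has_tangential_gradient_cong_AE[OF _ h ae])
  ultimately show ?thesis using g by (auto simp: Hs_boundary_def split: if_splits)
qed

subsection \<open>The semi-inner product space of harmonic functions\<close>

lemma boundary_trace: "has_boundary_trace \<Omega> F v g \<Longrightarrow> has_boundary_trace \<Omega> F v (boundary_trace \<Omega> F v)"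
  unfolding boundary_trace_def by (rule someI[where P="has_boundary_trace \<Omega> F v"])

text \<open>The norm may be computed from any trace in place of the selected one. This connects the
  bound on \<open>g\<close> in \<open>model_class\<close> with \<open>harmonic_norm\<close>.\<close>

lemma boundary_trace_Hs:
  assumes \<Omega>: "polyhedral_boundary \<Omega> F" and v: "has_boundary_trace \<Omega> F v g" and g: "g \<in> Hs_boundary F s"
  shows "boundary_trace \<Omega> F v \<in> Hs_boundary F s"
    "harmonic_norm \<Omega> F s v = Hs_boundary_norm F s g"
proof -
  note F = polyhedral_boundaryD[OF \<Omega>]
  have fin: "finite_measure (surface_measure F)" by (rule finite_surface_measure[OF F(5,3)])
  note bt = boundary_trace[OF v]
  have ae: "AE x in surface_measure F. g x = boundary_trace \<Omega> F v x"
    by (rule boundary_trace_unique[OF \<Omega> v bt])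
  have m: "g \<in> borel_measurable (surface_measure F)" "boundary_trace \<Omega> F v \<in> borel_measurable (surface_measure F)"
    using has_boundary_trace_L2[OF v] has_boundary_trace_L2[OF bt] by (simp_all add: L2_measurable)
  show "boundary_trace \<Omega> F v \<in> Hs_boundary F s" by (rule Hs_boundary_cong_AE[OF fin g m(2) ae])
  show "harmonic_norm \<Omega> F s v = Hs_boundary_norm F s g"
    unfolding harmonic_norm_def harmonic_inner_def Hs_boundary_norm_def
    using Hs_boundary_inner_cong_AE[OF fin m(1,2,1,2) ae ae] by simp
qed

lemma harmonic_HsD:
  assumes \<Omega>: "polyhedral_boundary \<Omega> F" and v: "v \<in> harmonic_Hs \<Omega> F s"
  shows "continuous_on \<Omega> v" "poisson_solution \<Omega> (\<lambda>_. 0) v"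
    "has_boundary_trace \<Omega> F v (boundary_trace \<Omega> F v)" "boundary_trace \<Omega> F v \<in> Hs_boundary F s"
proof -
  obtain g where g: "g \<in> Hs_boundary F s" "has_boundary_trace \<Omega> F v g"
    using v by (auto simp: harmonic_Hs_def)
  show "has_boundary_trace \<Omega> F v (boundary_trace \<Omega> F v)" "boundary_trace \<Omega> F v \<in> Hs_boundary F s"
    using boundary_trace[OF g(2)] boundary_trace_Hs(1)[OF \<Omega> g(2,1)] .
qed (use v in \<open>simp_all add: harmonic_Hs_def\<close>)

lemma harmonic_Hs_lincomb:
  assumes \<Omega>: "polyhedral_boundary \<Omega> F" and v: "v \<in> harmonic_Hs \<Omega> F s" and w: "w \<in> harmonic_Hs \<Omega> F s"
  shows "(\<lambda>x. r * v x + t * w x) \<in> harmonic_Hs \<Omega> F s"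
proof -
  note F = polyhedral_boundaryD[OF \<Omega>]
  note V = harmonic_HsD[OF \<Omega> v] and W = harmonic_HsD[OF \<Omega> w]
  have "continuous_on \<Omega> (\<lambda>x. r * v x + t * w x)" by (intro continuous_intros V(1) W(1))
  moreover have "poisson_solution \<Omega> (\<lambda>_. 0) (\<lambda>x. r * v x + t * w x)"
    using poisson_solution_lincomb[OF F(1,2) V(2) W(2), of r t] by simp
  moreover note has_boundary_trace_lincomb[OF F(1,2) V(3) W(3), of r t] Hs_boundary_lincomb[OF \<Omega> V(4) W(4), of r t]
  ultimately show ?thesis unfolding harmonic_Hs_def by blast
qed

lemma harmonic_inner_commute: "harmonic_inner \<Omega> F s v w = harmonic_inner \<Omega> F s w v"
  by (simp add: harmonic_inner_def Hs_boundary_inner_commute)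

lemma harmonic_inner_lincomb:
  assumes \<Omega>: "polyhedral_boundary \<Omega> F" and v: "v \<in> harmonic_Hs \<Omega> F s" and w: "w \<in> harmonic_Hs \<Omega> F s"
    and u: "u \<in> harmonic_Hs \<Omega> F s"
  shows "harmonic_inner \<Omega> F s (\<lambda>x. r * v x + t * w x) u = r * harmonic_inner \<Omega> F s v u + t * harmonic_inner \<Omega> F s w u"
proof -
  note F = polyhedral_boundaryD[OF \<Omega>]
  have fin: "finite_measure (surface_measure F)" by (rule finite_surface_measure[OF F(5,3)])
  note V = harmonic_HsD[OF \<Omega> v] and W = harmonic_HsD[OF \<Omega> w] and U = harmonic_HsD[OF \<Omega> u]
    and VW = harmonic_HsD[OF \<Omega> harmonic_Hs_lincomb[OF \<Omega> v w, of r t]]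
  let ?b = "boundary_trace \<Omega> F"
  have tr: "has_boundary_trace \<Omega> F (\<lambda>x. r * v x + t * w x) (\<lambda>x. r * ?b v x + t * ?b w x)"
    by (rule has_boundary_trace_lincomb[OF F(1,2) V(3) W(3)])
  have ae: "AE x in surface_measure F. ?b (\<lambda>x. r * v x + t * w x) x = r * ?b v x + t * ?b w x"
    by (rule boundary_trace_unique[OF \<Omega> VW(3) tr])
  have m: "f \<in> borel_measurable (surface_measure F)" if "has_boundary_trace \<Omega> F z f" for z f
    using has_boundary_trace_L2[OF that] by (rule L2_measurable)
  have "harmonic_inner \<Omega> F s (\<lambda>x. r * v x + t * w x) u
      = Hs_boundary_inner F s (\<lambda>x. r * ?b v x + t * ?b w x) (?b u)"
    unfolding harmonic_inner_def
    by (rule Hs_boundary_inner_cong_AE[OF fin m[OF VW(3)] m[OF tr] m[OF U(3)] m[OF U(3)] ae]) simp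
  also have "\<dots> = r * Hs_boundary_inner F s (?b v) (?b u) + t * Hs_boundary_inner F s (?b w) (?b u)"
    by (rule Hs_boundary_inner_lincomb[OF \<Omega> V(4) W(4) U(4)])
  finally show ?thesis by (simp add: harmonic_inner_def)
qed

subsection \<open>The operator norm induced by the sum norm\<close>

lemma l1_norm_nonneg: "l1_norm v \<ge> 0"
  by (simp add: l1_norm_def sum_nonneg)

lemma l1_norm_zero [simp]: "l1_norm 0 = 0"
  by (simp add: l1_norm_def)

lemma l1_norm_zero_iff: "l1_norm v = 0 \<longleftrightarrow> v = 0"
  by (simp add: l1_norm_def sum_nonneg_eq_0_iff vec_eq_iff)

lemma l1_norm_scaleR: "l1_norm (c *\<^sub>R v) = \<bar>c\<bar> * l1_norm v"
  by (simp add: l1_norm_def abs_mult sum_distrib_left)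

lemma l1_norm_add_le: "l1_norm (v + w) \<le> l1_norm v + l1_norm w"
  by (simp add: l1_norm_def sum.distrib[symmetric] sum_mono)

lemma l1_norm_le_card:
  fixes v :: "real^'m"
  assumes "\<And>i. \<bar>v $ i\<bar> \<le> B" shows "l1_norm v \<le> real CARD('m) * B"
  unfolding l1_norm_def using sum_bounded_above[of UNIV "\<lambda>i. \<bar>v $ i\<bar>" B] assms by simp

text \<open>Every component of the image is at most \<open>B * l1_norm v\<close>, and summing over
  all components contributes the number of rows. This and \<open>l1_norm_le_card\<close> are where
  the factors \<open>m\<close> in the budget come from.\<close>

lemma l1_norm_matrix_le:
  fixes A :: "real^'m^'m"
  assumes "\<And>i j. \<bar>A $ i $ j\<bar> \<le> B" shows "l1_norm (A *v v) \<le> real CARD('m) * B * l1_norm v"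
proof -
  have "\<bar>(A *v v) $ i\<bar> \<le> B * l1_norm v" for i
  proof -
    have "\<bar>(A *v v) $ i\<bar> \<le> (\<Sum>j\<in>UNIV. \<bar>A $ i $ j * v $ j\<bar>)"
      by (simp add: matrix_vector_mult_def sum_abs)
    also have "\<dots> \<le> (\<Sum>j\<in>UNIV. B * \<bar>v $ j\<bar>)"
      by (intro sum_mono) (simp add: abs_mult assms mult_right_mono)
    finally show ?thesis by (simp add: l1_norm_def sum_distrib_left)
  qed
  from l1_norm_le_card[OF this] show ?thesis by (simp add: mult.assoc)
qed

text \<open>\<open>l1_opnorm\<close> is a supremum of reals, which bounds its members only once the
  set is known to be bounded above; the sum of all absolute entries gives a crude bound. The
  estimate then follows by scaling to the unit sphere.\<close>

lemma l1_norm_le_l1_opnorm: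
  fixes A :: "real^'m^'m"
  shows "l1_norm (A *v v) \<le> l1_opnorm A * l1_norm v"
proof (cases "v = 0")
  case False
  then have v: "l1_norm v > 0" using l1_norm_nonneg[of v] l1_norm_zero_iff[of v] by linarith
  define B where "B = (\<Sum>i\<in>UNIV. \<Sum>j\<in>UNIV. \<bar>A $ i $ j\<bar>)"
  have B: "\<bar>A $ i $ j\<bar> \<le> B" for i j
  proof -
    have "\<bar>A $ i $ j\<bar> \<le> (\<Sum>j\<in>UNIV. \<bar>A $ i $ j\<bar>)" by (rule member_le_sum) auto
    also have "\<dots> \<le> B" unfolding B_def
      by (rule member_le_sum[of i UNIV "\<lambda>i. \<Sum>j\<in>UNIV. \<bar>A $ i $ j\<bar>"]) (auto intro: sum_nonneg)
    finally show ?thesis .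
  qed
  have B0: "B \<ge> 0" by (simp add: B_def sum_nonneg)
  have bdd: "bdd_above ((\<lambda>v. l1_norm (A *v v)) ` {v. l1_norm v \<le> 1})"
  proof (rule bdd_aboveI2)
    fix w :: "real^'m" assume "w \<in> {v. l1_norm v \<le> 1}"
    then have "real CARD('m) * B * l1_norm w \<le> real CARD('m) * B * 1"
      using B0 by (intro mult_left_mono) auto
    then show "l1_norm (A *v w) \<le> real CARD('m) * B" using l1_norm_matrix_le[OF B, of w] by linarith
  qed
  have "l1_norm (A *v ((1 / l1_norm v) *\<^sub>R v)) \<le> l1_opnorm A"
    unfolding l1_opnorm_def by (rule cSUP_upper[OF _ bdd]) (use v in \<open>simp add: l1_norm_scaleR\<close>)
  then have "l1_norm (A *v v) / l1_norm v \<le> l1_opnorm A"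
    using v by (simp add: matrix_vector_mult_scaleR l1_norm_scaleR)
  then show ?thesis using v by (simp add: divide_le_eq)
qed simp

lemma l1_opnorm_nonneg: "l1_opnorm (A :: real^'m^'m) \<ge> 0"
proof -
  have "l1_norm (1 :: real^'m) = real CARD('m)" by (simp add: l1_norm_def)
  then have pos: "l1_norm (1 :: real^'m) > 0" by simp
  have "0 \<le> l1_opnorm A * l1_norm (1 :: real^'m)"
    using l1_norm_nonneg[of "A *v 1"] l1_norm_le_l1_opnorm[of A 1] by linarith
  then show ?thesis using pos by (simp add: zero_le_mult_iff)
qed

section \<open>Inverse matrices and their perturbation\<close>

lemma matrix_inv_mult:
  fixes A :: "real^'m^'m"
  assumes "invertible A" shows "A ** matrix_inv A = mat 1" "matrix_inv A ** A = mat 1"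
proof -
  obtain B where "A ** B = mat 1 \<and> B ** A = mat 1" using assms by (auto simp: invertible_def)
  then have "A ** matrix_inv A = mat 1 \<and> matrix_inv A ** A = mat 1"
    unfolding matrix_inv_def by (rule someI)
  then show "A ** matrix_inv A = mat 1" "matrix_inv A ** A = mat 1" by simp_all
qed

text \<open>The inverse satisfies all four Penrose equations. Conversely, multiplying
  \<open>A ** B ** A = A\<close> by the inverse on both sides determines \<open>B\<close>, as the
  definite description demands.\<close>

lemma moore_penrose_invertible:
  fixes A :: "real^'m^'m"
  assumes "invertible A" shows "moore_penrose A = matrix_inv A"
  unfolding moore_penrose_def
proof (rule the_equality)
  have inv: "A ** matrix_inv A = mat 1" "matrix_inv A ** A = mat 1"
    using assms by (simp_all add: matrix_inv_mult)
  then show "A ** matrix_inv A ** A = A \<and> matrix_inv A ** A ** matrix_inv A = matrix_inv A \<and>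
    transpose (A ** matrix_inv A) = A ** matrix_inv A \<and> transpose (matrix_inv A ** A) = matrix_inv A ** A"
    by (simp add: transpose_mat)
  fix B assume "A ** B ** A = A \<and> B ** A ** B = B \<and> transpose (A ** B) = A ** B \<and> transpose (B ** A) = B ** A"
  then have eq: "A ** B ** A = A" by blast
  have "B = (matrix_inv A ** A) ** B ** (A ** matrix_inv A)"
    by (simp only: inv matrix_mul_lid matrix_mul_rid)
  also have "\<dots> = matrix_inv A ** (A ** B ** A) ** matrix_inv A"
    by (simp only: matrix_mul_assoc)
  also have "\<dots> = matrix_inv A" by (simp only: eq inv matrix_mul_lid)
  finally show "B = matrix_inv A" .
qed

text \<open>From \<open>v = matrix_inv A *v (A *v v)\<close> and the smallness of
  \<open>A' - A\<close>, absorbing one term gives a lower bound for \<open>A'\<close> with factor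
  \<open>1 - m * g * e\<close>. It yields both injectivity, hence invertibility, and a bound for the
  inverse of \<open>A'\<close>, without a Neumann series.\<close>

lemma matrix_inv_perturbation:
  fixes A A' :: "real^'m^'m"
  assumes A: "invertible A" and d: "\<And>i j. \<bar>A' $ i $ j - A $ i $ j\<bar> \<le> e"
    and small: "real CARD('m) * l1_opnorm (matrix_inv A) * e < 1"
  shows "invertible A'"
    and "l1_norm (matrix_inv A *v w - matrix_inv A' *v w)
      \<le> real CARD('m) * (l1_opnorm (matrix_inv A))\<^sup>2 * e / (1 - real CARD('m) * l1_opnorm (matrix_inv A) * e) * l1_norm w"
proof -
  define g m where "g = l1_opnorm (matrix_inv A)" and "m = real CARD('m)"
  have g: "g \<ge> 0" unfolding g_def by (rule l1_opnorm_nonneg)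
  \<comment> \<open>Any entry shows this; \<open>undefined\<close> is used as an index at
    hand.\<close>
  have e: "e \<ge> 0" using d[of undefined undefined] by linarith
  have q: "1 - m * g * e > 0" using small by (simp add: g_def m_def)
  have inv: "A ** matrix_inv A = mat 1" "matrix_inv A ** A = mat 1"
    using A by (simp_all add: matrix_inv_mult)
  have diff: "l1_norm ((A' - A) *v v) \<le> m * e * l1_norm v" for v
    unfolding m_def by (rule l1_norm_matrix_le) (simp add: d)
  have lower: "(1 - m * g * e) * l1_norm v \<le> g * l1_norm (A' *v v)" for v
  proof -
    have "v = matrix_inv A *v (A *v v)" by (simp add: matrix_vector_mul_assoc inv)
    then have "l1_norm v \<le> g * l1_norm (A *v v)"
      using l1_norm_le_l1_opnorm[of "matrix_inv A" "A *v v"] by (simp add: g_def)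
    also have "A *v v = A' *v v + (- 1) *\<^sub>R ((A' - A) *v v)"
      by (simp add: matrix_vector_mult_diff_rdistrib)
    also have "g * l1_norm (A' *v v + (- 1) *\<^sub>R ((A' - A) *v v)) \<le> g * (l1_norm (A' *v v) + m * e * l1_norm v)"
      using l1_norm_add_le[of "A' *v v" "(- 1) *\<^sub>R ((A' - A) *v v)"] diff[of v] g
      by (intro mult_left_mono) (auto simp: l1_norm_scaleR simp del: scaleR_minus_left scaleR_minus1_left)
    finally show ?thesis by (simp add: algebra_simps)
  qed
  have "v = 0" if "A' *v v = 0" for v
  proof -
    have "(1 - m * g * e) * l1_norm v \<le> 0" using lower[of v] that by simp
    then have "l1_norm v \<le> 0" using q by (simp add: mult_le_0_iff)
    then show ?thesis using l1_norm_nonneg[of v] l1_norm_zero_iff[of v] by simp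
  qed
  then show A': "invertible A'"
    using invertible_left_inverse[of A'] matrix_left_invertible_ker[of A'] by blast
  have inv': "A' ** matrix_inv A' = mat 1" using A' by (simp add: matrix_inv_mult)
  define v where "v = matrix_inv A' *v w"
  have A'v: "A' *v v = w" by (simp add: v_def matrix_vector_mul_assoc inv')
  have v: "l1_norm v \<le> g * l1_norm w / (1 - m * g * e)"
    using lower[of v] q by (simp add: A'v le_divide_eq mult.commute)
  \<comment> \<open>The resolvent identity. Its three factors contribute \<open>g\<close>,
    \<open>m * e\<close> and \<open>g / (1 - m * g * e)\<close>, whose product is the constant in
    the claim.\<close>
  have "matrix_inv A *v w - v = matrix_inv A *v ((A' - A) *v v)"
    by (simp add: matrix_vector_mult_diff_rdistrib matrix_vector_mult_diff_distrib A'v matrix_vector_mul_assoc inv)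
  then have "l1_norm (matrix_inv A *v w - v) \<le> g * l1_norm ((A' - A) *v v)"
    using l1_norm_le_l1_opnorm by (simp add: g_def)
  also have "\<dots> \<le> g * (m * e * (g * l1_norm w / (1 - m * g * e)))"
    using g e v diff[of v] by (intro mult_left_mono order_trans[OF diff] mult_left_mono) (auto simp: m_def)
  also have "\<dots> = m * g\<^sup>2 * e / (1 - m * g * e) * l1_norm w" by (simp add: power2_eq_square)
  finally show "l1_norm (matrix_inv A *v w - matrix_inv A' *v w)
      \<le> real CARD('m) * (l1_opnorm (matrix_inv A))\<^sup>2 * e / (1 - real CARD('m) * l1_opnorm (matrix_inv A) * e) * l1_norm w"
    by (simp add: v_def g_def m_def)
qed

subsection \<open>Seminorms of finite combinations\<close>

lemma banach_function_spaceD: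
  assumes "banach_function_space \<Omega> X N"
  shows "(\<lambda>_. 0) \<in> X" "v \<in> X \<Longrightarrow> w \<in> X \<Longrightarrow> (\<lambda>y. v y + w y) \<in> X" "v \<in> X \<Longrightarrow> (\<lambda>y. c * v y) \<in> X"
  using assms unfolding banach_function_space_def by blast+

lemma seminorm_onD:
  assumes "seminorm_on X N p"
  shows "v \<in> X \<Longrightarrow> p v \<ge> 0" "v \<in> X \<Longrightarrow> w \<in> X \<Longrightarrow> p (\<lambda>y. v y + w y) \<le> p v + p w"
    "v \<in> X \<Longrightarrow> p (\<lambda>y. c * v y) = \<bar>c\<bar> * p v"
  using assms unfolding seminorm_on_def by blast+

lemma banach_function_space_diff:
  assumes "banach_function_space \<Omega> X N" "v \<in> X" "w \<in> X"
  shows "(\<lambda>y. v y - w y) \<in> X"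
  using banach_function_spaceD(2)[OF assms(1,2) banach_function_spaceD(3)[OF assms(1,3), of "-1"]] by simp

lemma seminorm_on_diff_le:
  assumes "banach_function_space \<Omega> X N" "seminorm_on X N p" "v \<in> X" "w \<in> X"
  shows "p (\<lambda>y. v y - w y) \<le> p v + p w"
  using seminorm_onD(2)[OF assms(2,3) banach_function_spaceD(3)[OF assms(1,4), of "-1"]] seminorm_onD(3)[OF assms(2,4), of "-1"]
  by simp

lemma seminorm_on_sum:
  assumes X: "banach_function_space \<Omega> X N" "seminorm_on X N p" and I: "finite I"
    and v: "\<And>i. i \<in> I \<Longrightarrow> v i \<in> X"
  shows "(\<lambda>y. \<Sum>i\<in>I. c i * v i y) \<in> X \<and> p (\<lambda>y. \<Sum>i\<in>I. c i * v i y) \<le> (\<Sum>i\<in>I. \<bar>c i\<bar> * p (v i))"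
  using I v
proof (induction rule: finite_induct)
  case empty
  have "p (\<lambda>y. 0 * 0) = 0" using seminorm_onD(3)[OF X(2) banach_function_spaceD(1)[OF X(1)], of 0] by simp
  then show ?case using banach_function_spaceD(1)[OF X(1)] by simp
next
  case (insert i I)
  have IH: "(\<lambda>y. \<Sum>i\<in>I. c i * v i y) \<in> X" "p (\<lambda>y. \<Sum>i\<in>I. c i * v i y) \<le> (\<Sum>i\<in>I. \<bar>c i\<bar> * p (v i))"
    using insert by auto
  have vi: "v i \<in> X" using insert by simp
  have ci: "(\<lambda>y. c i * v i y) \<in> X" by (rule banach_function_spaceD(3)[OF X(1) vi])
  have "p (\<lambda>y. c i * v i y + (\<Sum>i\<in>I. c i * v i y)) \<le> \<bar>c i\<bar> * p (v i) + (\<Sum>i\<in>I. \<bar>c i\<bar> * p (v i))"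
    using seminorm_onD(2)[OF X(2) ci IH(1)] seminorm_onD(3)[OF X(2) vi, of "c i"] IH(2) by linarith
  moreover have "(\<lambda>y. c i * v i y + (\<Sum>i\<in>I. c i * v i y)) \<in> X"
    by (rule banach_function_spaceD(2)[OF X(1) ci IH(1)])
  ultimately show ?case by (simp add: insert(1,2))
qed

text \<open>Pairs the sum norm of the coefficients with a uniform bound on the functions; this is
  the reason for measuring matrices in the operator norm of the sum norm.\<close>

lemma seminorm_on_sum_le_l1:
  fixes c :: "real^'m"
  assumes X: "banach_function_space \<Omega> X N" "seminorm_on X N p"
    and v: "\<And>i. v i \<in> X" "\<And>i. p (v i) \<le> B"
  shows "p (\<lambda>y. \<Sum>i\<in>UNIV. c $ i * v i y) \<le> l1_norm c * B"
proof -
  have "p (\<lambda>y. \<Sum>i\<in>UNIV. c $ i * v i y) \<le> (\<Sum>i\<in>UNIV. \<bar>c $ i\<bar> * p (v i))"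
    using seminorm_on_sum[OF X finite_class.finite_UNIV, of v "\<lambda>i. c $ i"] v(1) by simp
  also have "\<dots> \<le> (\<Sum>i\<in>UNIV. \<bar>c $ i\<bar> * B)" by (intro sum_mono mult_left_mono v(2)) simp
  finally show ?thesis by (simp add: l1_norm_def sum_distrib_right)
qed

subsection \<open>Optimal recovery\<close>

lemma harmonic_Hs_sum:
  assumes \<Omega>: "polyhedral_boundary \<Omega> F" and I: "finite I" "I \<noteq> {}" and v: "\<And>i. i \<in> I \<Longrightarrow> v i \<in> harmonic_Hs \<Omega> F s"
    and w: "w \<in> harmonic_Hs \<Omega> F s"
  shows "(\<lambda>y. \<Sum>i\<in>I. c i * v i y) \<in> harmonic_Hs \<Omega> F s \<and>
    harmonic_inner \<Omega> F s (\<lambda>y. \<Sum>i\<in>I. c i * v i y) w = (\<Sum>i\<in>I. c i * harmonic_inner \<Omega> F s (v i) w)"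
  using I v
proof (induction rule: finite_ne_induct)
  case (singleton i)
  then show ?case
    using harmonic_Hs_lincomb[OF \<Omega>, of "v i" s "v i" "c i" 0] harmonic_inner_lincomb[OF \<Omega>, of "v i" s "v i" w "c i" 0] w by simp
next
  case (insert i I)
  have IH: "(\<lambda>y. \<Sum>i\<in>I. c i * v i y) \<in> harmonic_Hs \<Omega> F s"
    "harmonic_inner \<Omega> F s (\<lambda>y. \<Sum>i\<in>I. c i * v i y) w = (\<Sum>i\<in>I. c i * harmonic_inner \<Omega> F s (v i) w)"
    using insert by auto
  have vi: "v i \<in> harmonic_Hs \<Omega> F s" using insert by simp
  show ?case
    using harmonic_Hs_lincomb[OF \<Omega> vi IH(1), of "c i" 1] harmonic_inner_lincomb[OF \<Omega> vi IH(1) w, of "c i" 1] insert(1,3) IH(2)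
    by simp
qed

text \<open>\<open>u0\<close> has trace zero and carries the right-hand side \<open>f\<close>.
  Subtracting it keeps the trace, and with it the norm bound, and turns the equation into the
  homogeneous one; adding it back gives the converse.\<close>

lemma model_class_iff_harmonic:
  assumes \<Omega>: "polyhedral_boundary \<Omega> F" and u0: "u0 \<in> H1_zero \<Omega>" "poisson_solution \<Omega> f u0" "continuous_on \<Omega> u0"
  shows "v \<in> model_class \<Omega> F s f CB \<longleftrightarrow>
    (\<lambda>y. v y - u0 y) \<in> harmonic_Hs \<Omega> F s \<and> harmonic_norm \<Omega> F s (\<lambda>y. v y - u0 y) \<le> CB"
proof -
  note F = polyhedral_boundaryD[OF \<Omega>]
  note tr0 = H1_zero_has_boundary_trace[OF \<Omega> u0(1)]
  let ?h = "\<lambda>y. v y - u0 y"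
  have trace: "has_boundary_trace \<Omega> F ?h g \<longleftrightarrow> has_boundary_trace \<Omega> F v g" for g
    using has_boundary_trace_lincomb[OF F(1,2) _ tr0, of v g 1 "-1"] has_boundary_trace_lincomb[OF F(1,2) _ tr0, of ?h g 1 1]
    by auto
  have poisson: "poisson_solution \<Omega> (\<lambda>_. 0) ?h \<longleftrightarrow> poisson_solution \<Omega> f v"
    using poisson_solution_lincomb[OF F(1,2) _ u0(2), of f v 1 "-1"] poisson_solution_lincomb[OF F(1,2) _ u0(2), of "\<lambda>_. 0" ?h 1 1]
    by auto
  have cont: "continuous_on \<Omega> ?h \<longleftrightarrow> continuous_on \<Omega> v"
    using continuous_on_diff[OF _ u0(3), of v] continuous_on_add[OF _ u0(3), of ?h] by auto
  have norm: "harmonic_norm \<Omega> F s ?h = Hs_boundary_norm F s g"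
    if "has_boundary_trace \<Omega> F v g" "g \<in> Hs_boundary F s" for g
    using boundary_trace_Hs(2)[OF \<Omega>, of ?h g s] that trace by simp
  show ?thesis
    unfolding model_class_def harmonic_Hs_def mem_Collect_eq trace poisson cont using norm by auto
qed

text \<open>The inner product of \<open>uH\<close> with \<open>w\<close> is a weighted sum of the
  values of \<open>w\<close> at the observation points, by the representer property. The difference
  \<open>k\<close> between \<open>h\<close> and \<open>uH\<close> vanishes there, so it is
  orthogonal to \<open>uH\<close>, and \<open>uH + k\<close> and \<open>uH - k\<close> have equal
  norm. Both have the same values at the observation points.\<close>

lemma data_class_mirror:
  fixes \<Omega> :: "(real^'n) set" and x :: "'m::finite \<Rightarrow> real^'n"
  assumes \<Omega>: "polyhedral_boundary \<Omega> F" and u0: "u0 \<in> H1_zero \<Omega>" "poisson_solution \<Omega> f u0" "continuous_on \<Omega> u0"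
    and \<phi>: "\<And>j. riesz_representer \<Omega> F s (x j) (\<phi> j)"
    and uH: "uH = (\<lambda>y. \<Sum>j\<in>UNIV. U $ j * \<phi> j y)" "\<And>i. u0 (x i) + uH (x i) = \<omega> $ i"
    and v: "v \<in> data_class \<Omega> F s f CB x \<omega>"
  shows "(\<lambda>y. 2 * (u0 y + uH y) - v y) \<in> data_class \<Omega> F s f CB x \<omega>"
proof -
  let ?H = "harmonic_Hs \<Omega> F s" and ?B = "harmonic_inner \<Omega> F s"
  have \<phi>H: "\<phi> j \<in> ?H" "w \<in> ?H \<Longrightarrow> ?B (\<phi> j) w = w (x j)" for j w
    using \<phi>[of j] by (auto simp: riesz_representer_def)
  define h where "h y = v y - u0 y" for y
  have h: "h \<in> ?H" "harmonic_norm \<Omega> F s h \<le> CB"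
    using v model_class_iff_harmonic[OF \<Omega> u0] unfolding data_class_def h_def[abs_def] by auto
  have hx: "h (x i) = uH (x i)" for i
    using v uH(2)[of i] by (simp add: data_class_def h_def)
  have uHH: "uH \<in> ?H" "?B uH w = (\<Sum>j\<in>UNIV. U $ j * w (x j))" if "w \<in> ?H" for w
    using harmonic_Hs_sum[OF \<Omega> finite_class.finite_UNIV, of \<phi> s w "\<lambda>j. U $ j"] \<phi>H that by (simp_all add: uH(1))
  have uHH': "uH \<in> ?H" using uHH(1)[OF h(1)] .
  define k where "k y = 1 * h y + (-1) * uH y" for y
  have k: "k \<in> ?H" unfolding k_def[abs_def] by (rule harmonic_Hs_lincomb[OF \<Omega> h(1) uHH'])
  have "?B uH k = 0" using uHH(2)[OF k] hx by (simp add: k_def)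
  then have ku: "?B uH k = 0" "?B k uH = 0" by (simp_all add: harmonic_inner_commute)
  \<comment> \<open>Pythagoras for both signs at once: \<open>c = 1\<close> gives \<open>h\<close>
    and \<open>c = -1\<close> gives its mirror image.\<close>
  have norm: "?B w w = ?B uH uH + ?B k k" if w: "w = (\<lambda>y. 1 * uH y + c * k y)" and c: "c * c = 1" for w c
  proof -
    have wH: "w \<in> ?H" unfolding w by (rule harmonic_Hs_lincomb[OF \<Omega> uHH' k])
    have 1: "?B w z = 1 * ?B uH z + c * ?B k z" if "z \<in> ?H" for z
      unfolding w by (rule harmonic_inner_lincomb[OF \<Omega> uHH' k that])
    have "?B w w = ?B w uH + c * ?B w k"
      using 1[OF wH] by (simp add: harmonic_inner_commute[of \<Omega> F s uH w] harmonic_inner_commute[of \<Omega> F s k w])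
    also have "\<dots> = ?B uH uH + c * c * ?B k k"
      using 1[OF uHH'] 1[OF k] ku by simp
    finally show ?thesis using c by simp
  qed
  define h' where "h' y = 2 * uH y - h y" for y
  have h'k: "h' = (\<lambda>y. 1 * uH y + (-1) * k y)" and hk: "h = (\<lambda>y. 1 * uH y + 1 * k y)"
    by (auto simp: h'_def k_def)
  have h'H: "h' \<in> ?H" unfolding h'k by (rule harmonic_Hs_lincomb[OF \<Omega> uHH' k])
  have "?B h' h' = ?B h h" using norm[OF h'k] norm[OF hk] by simp
  then have "harmonic_norm \<Omega> F s h' \<le> CB" using h(2) by (simp add: harmonic_norm_def)
  moreover have "(\<lambda>y. (2 * (u0 y + uH y) - v y) - u0 y) = h'" by (auto simp: h'_def h_def)
  ultimately have "(\<lambda>y. 2 * (u0 y + uH y) - v y) \<in> model_class \<Omega> F s f CB"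
    using model_class_iff_harmonic[OF \<Omega> u0, of "\<lambda>y. 2 * (u0 y + uH y) - v y" s CB] h'H by simp
  moreover have "2 * (u0 (x i) + uH (x i)) - v (x i) = \<omega> $ i" for i
    using v uH(2)[of i] by (simp add: data_class_def)
  ultimately show ?thesis by (simp add: data_class_def)
qed

text \<open>For any candidate centre \<open>w\<close>, the vector from \<open>c\<close> to
  \<open>v\<close> is half the difference between \<open>w - v'\<close> and \<open>w - v\<close>,
  where \<open>v'\<close> is the mirror image of \<open>v\<close>. Hence \<open>w\<close> is at
  least as far from one of the two points as \<open>c\<close> is from \<open>v\<close>.\<close>

lemma symmetric_le_chebyshev_radius:
  assumes X: "banach_function_space \<Omega> X N" "seminorm_on X N p"
    and v: "v \<in> Z" "v \<in> X" and v': "(\<lambda>y. 2 * c y - v y) \<in> Z" "(\<lambda>y. 2 * c y - v y) \<in> X"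
  shows "ereal (p (\<lambda>y. v y - c y)) \<le> chebyshev_radius X p Z"
  unfolding chebyshev_radius_def
proof (rule INF_greatest)
  fix w assume w: "w \<in> X"
  let ?v' = "\<lambda>y. 2 * c y - v y"
  have "(\<lambda>y. v y - c y) = (\<lambda>y. (1/2) * ((w y - ?v' y) - (w y - v y)))" by (auto simp: field_simps)
  then have "p (\<lambda>y. v y - c y) = (1/2) * p (\<lambda>y. (w y - ?v' y) - (w y - v y))"
    using seminorm_onD(3)[OF X(2) banach_function_space_diff[OF X(1) banach_function_space_diff[OF X(1) w v'(2)] banach_function_space_diff[OF X(1) w v(2)]], of "1/2"]
    by simp
  also have "\<dots> \<le> (1/2) * (p (\<lambda>y. w y - ?v' y) + p (\<lambda>y. w y - v y))"
    using seminorm_on_diff_le[OF X banach_function_space_diff[OF X(1) w v'(2)] banach_function_space_diff[OF X(1) w v(2)]]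
    by simp
  also have "\<dots> \<le> max (p (\<lambda>y. w y - ?v' y)) (p (\<lambda>y. w y - v y))" by simp
  finally have "ereal (p (\<lambda>y. v y - c y)) \<le> max (ereal (p (\<lambda>y. w y - ?v' y))) (ereal (p (\<lambda>y. w y - v y)))"
    by (simp add: max_def split: if_splits)
  also have "\<dots> \<le> (SUP z\<in>Z. ereal (p (\<lambda>y. w y - z y)))"
    using SUP_upper[OF v'(1), of "\<lambda>z. ereal (p (\<lambda>y. w y - z y))"] SUP_upper[OF v(1), of "\<lambda>z. ereal (p (\<lambda>y. w y - z y))"]
    by simp
  finally show "ereal (p (\<lambda>y. v y - c y)) \<le> (SUP z\<in>Z. ereal (p (\<lambda>y. w y - z y)))" .
qed

lemma max_discrepancy_bounds:
  fixes x :: "'m::finite \<Rightarrow> real^'n"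
  shows "\<bar>v (x i) - w (x i)\<bar> \<le> max_discrepancy x v w" "0 \<le> max_discrepancy x v w"
proof -
  show "\<bar>v (x i) - w (x i)\<bar> \<le> max_discrepancy x v w" for i unfolding max_discrepancy_def by (intro Max_ge) auto
  from order_trans[OF abs_ge_zero this] show "0 \<le> max_discrepancy x v w" .
qed

theorem theorem3p4:
  fixes \<Omega> :: "(real^'n) set" and F :: "(real^'n) set set"
    and f :: "(real^'n \<Rightarrow> real) \<Rightarrow> real"
    and u0 :: "real^'n \<Rightarrow> real"
    and x :: "'m::finite \<Rightarrow> real^'n" and \<omega> :: "real^'m"
    and \<phi> :: "'m \<Rightarrow> real^'n \<Rightarrow> real" and G :: "real^'m^'m"
    and X :: "(real^'n \<Rightarrow> real) set" and N p :: "(real^'n \<Rightarrow> real) \<Rightarrow> real"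
    and s d CB \<Lambda>sd \<Lambda>X CX \<delta> \<epsilon> \<epsilon>1 \<epsilon>2 \<epsilon>2bar m g1 :: real
  assumes dim: "CARD('n) = 2 \<or> CARD('n) = 3"
    and domain: "polyhedral_lipschitz_domain \<Omega> F"
    and s: "1/2 < s" "s < 3/2"
    and d: "d > 0" and CB: "CB > 0"
    and f: "f \<in> H_minus1 \<Omega>"
    and u0: "u0 \<in> H1_zero \<Omega>" "poisson_solution \<Omega> f u0"
    and points: "\<And>i. x i \<in> \<Omega>" "\<And>i. infdist (x i) (frontier \<Omega>) > d"
    and \<Lambda>sd: "\<Lambda>sd > 0"
      "\<And>v. v \<in> harmonic_Hs \<Omega> F s \<Longrightarrow> (MAX i. \<bar>v (x i)\<bar>) \<le> \<Lambda>sd * harmonic_norm \<Omega> F s v"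
    and data: "\<exists>w \<in> model_class \<Omega> F s f CB. \<forall>i. w (x i) = \<omega> $ i"
    and representers: "\<And>j. riesz_representer \<Omega> F s (x j) (\<phi> j)"
    and X: "banach_function_space \<Omega> X N" "seminorm_on X N p"
      "harmonic_Hs \<Omega> F s \<subseteq> X"
      "\<And>v. v \<in> harmonic_Hs \<Omega> F s \<Longrightarrow> p v \<le> \<Lambda>X * harmonic_norm \<Omega> F s v"
    and u0_X: "u0 \<in> X" "continuous_on \<Omega> u0"
    and G: "G = observation_matrix x \<phi>" "invertible G"
    and m: "m = real CARD('m)"
    and g1: "g1 = l1_opnorm (matrix_inv G)"
    and threshold: "\<epsilon>2bar > 0" "m * g1 * \<epsilon>2bar < 1"
    and tolerances: "\<epsilon> > 0" "\<epsilon>1 > 0" "\<epsilon>2 > 0" "\<epsilon>2 \<le> \<epsilon>2bar"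
    and CX: "CX = (MAX j. p (\<phi> j))"
    and \<delta>: "\<delta> = m * g1\<^sup>2 * \<epsilon>2 / (1 - m * g1 * \<epsilon>2)"
    and budget: "\<epsilon>1 + m * g1 * \<Lambda>sd * CB * \<epsilon>2
      + (CX + \<epsilon>2) * (m * g1 * \<epsilon>1 + m * (\<Lambda>sd * CB + \<epsilon>1) * \<delta>) \<le> \<epsilon>"
  shows "\<forall>uhat. recovery_output X p x \<omega> u0 \<phi> \<epsilon>1 \<epsilon>2 uhat \<longrightarrow>
    (\<forall>v \<in> data_class \<Omega> F s f CB x \<omega>.
       ereal (p (\<lambda>y. v y - uhat y)) \<le> chebyshev_radius X p (data_class \<Omega> F s f CB x \<omega>) + ereal \<epsilon>)"
proof (intro allI impI ballI)
  fix uhat v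
  assume out: "recovery_output X p x \<omega> u0 \<phi> \<epsilon>1 \<epsilon>2 uhat" and v: "v \<in> data_class \<Omega> F s f CB x \<omega>"
  have \<Omega>: "polyhedral_boundary \<Omega> F"
    using domain by (simp add: polyhedral_lipschitz_domain_def polyhedral_boundary_def)
  note model = model_class_iff_harmonic[OF \<Omega> u0 u0_X(2)]
  note XD = banach_function_spaceD[OF X(1)] and pD = seminorm_onD[OF X(2)] and X_diff = banach_function_space_diff[OF X(1)]
  obtain u0hat \<phi>hat where u0hat: "u0hat \<in> X" "p (\<lambda>y. u0hat y - u0 y) + max_discrepancy x u0hat u0 \<le> \<epsilon>1"
    and \<phi>hat: "\<And>j. \<phi>hat j \<in> X" "\<And>j. p (\<lambda>y. \<phi>hat j y - \<phi> j y) + max_discrepancy x (\<phi>hat j) (\<phi> j) \<le> \<epsilon>2"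
    and uhat: "uhat = (\<lambda>y. u0hat y + (\<Sum>i\<in>UNIV. (moore_penrose (observation_matrix x \<phi>hat) *v (\<chi> i. \<omega> $ i - u0hat (x i))) $ i * \<phi>hat i y))"
    using out unfolding recovery_output_def Let_def by blast
  have \<phi>H: "\<phi> j \<in> harmonic_Hs \<Omega> F s" for j using representers[of j] by (simp add: riesz_representer_def)
  then have \<phi>X: "\<phi> j \<in> X" for j using X(3) by blast
  \<comment> \<open>\<open>\<omega>t\<close> holds the exact point values of the harmonic part and
    \<open>\<omega>h\<close> those available to the algorithm; \<open>U\<close> and
    \<open>Uh\<close> are the corresponding coefficients.\<close>
  define \<omega>t \<omega>h where "\<omega>t = (\<chi> i. \<omega> $ i - u0 (x i))" and "\<omega>h = (\<chi> i. \<omega> $ i - u0hat (x i))"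
  define Gh where "Gh = observation_matrix x \<phi>hat"
  define U Uh where "U = matrix_inv G *v \<omega>t" and "Uh = matrix_inv Gh *v \<omega>h"
  define uH where "uH = (\<lambda>y. \<Sum>j\<in>UNIV. U $ j * \<phi> j y)"
  have g1_nonneg: "g1 \<ge> 0" unfolding g1 by (rule l1_opnorm_nonneg)
  have p_le1: "p (\<lambda>y. u0hat y - u0 y) \<le> \<epsilon>1"
    using u0hat(2) max_discrepancy_bounds(2)[of x u0hat u0] by linarith
  have d_le1: "\<bar>u0hat (x i) - u0 (x i)\<bar> \<le> \<epsilon>1" for i
    using u0hat(2) max_discrepancy_bounds(1)[of u0hat x i u0] pD(1)[OF X_diff[OF u0hat(1) u0_X(1)]] by linarith
  have p_le2: "p (\<lambda>y. \<phi>hat j y - \<phi> j y) \<le> \<epsilon>2" for j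
    using \<phi>hat(2)[of j] max_discrepancy_bounds(2)[of x "\<phi>hat j" "\<phi> j"] by linarith
  have d_le2: "\<bar>\<phi>hat j (x i) - \<phi> j (x i)\<bar> \<le> \<epsilon>2" for i j
    using \<phi>hat(2)[of j] max_discrepancy_bounds(1)[of "\<phi>hat j" x i "\<phi> j"] pD(1)[OF X_diff[OF \<phi>hat(1)[of j] \<phi>X[of j]]]
    by linarith
  \<comment> \<open>The given \<open>v\<close> already provides a harmonic function of norm at most
    \<open>CB\<close>, namely \<open>v - u0\<close>, that takes these values.\<close>
  have \<omega>t_bound: "\<bar>\<omega>t $ i\<bar> \<le> \<Lambda>sd * CB" for i
  proof -
    let ?h = "\<lambda>y. v y - u0 y"
    have h: "?h \<in> harmonic_Hs \<Omega> F s" "harmonic_norm \<Omega> F s ?h \<le> CB"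
      using v model[of v s CB] by (simp_all add: data_class_def)
    have "\<bar>\<omega>t $ i\<bar> = \<bar>?h (x i)\<bar>" using v by (simp add: data_class_def \<omega>t_def)
    also have "\<dots> \<le> (MAX i. \<bar>?h (x i)\<bar>)" by (intro Max_ge) auto
    also have "\<dots> \<le> \<Lambda>sd * harmonic_norm \<Omega> F s ?h" by (rule \<Lambda>sd(2)[OF h(1)])
    also have "\<dots> \<le> \<Lambda>sd * CB" using h(2) \<Lambda>sd(1) by simp
    finally show ?thesis .
  qed
  have \<omega>d: "\<bar>(\<omega>t - \<omega>h) $ i\<bar> \<le> \<epsilon>1" for i
    using d_le1[of i] by (simp add: \<omega>t_def \<omega>h_def)
  have \<omega>h_bound: "\<bar>\<omega>h $ i\<bar> \<le> \<Lambda>sd * CB + \<epsilon>1" for i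
    using \<omega>t_bound[of i] \<omega>d[of i] by simp
  have "m * g1 * \<epsilon>2 \<le> m * g1 * \<epsilon>2bar"
    using tolerances(4) g1_nonneg by (intro mult_left_mono) (simp_all add: m)
  then have small: "m * g1 * \<epsilon>2 < 1" using threshold(2) by linarith
  have Gd: "\<bar>Gh $ i $ j - G $ i $ j\<bar> \<le> \<epsilon>2" for i j
    using d_le2[of j i] by (simp add: Gh_def G(1) observation_matrix_def)
  note pert = matrix_inv_perturbation[OF G(2) Gd small[unfolded m g1], folded m g1, folded \<delta>]
  have Uh: "uhat = (\<lambda>y. u0hat y + (\<Sum>i\<in>UNIV. Uh $ i * \<phi>hat i y))"
    unfolding uhat Uh_def \<omega>h_def Gh_def using moore_penrose_invertible[OF pert(1)] by (simp add: Gh_def)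
  \<comment> \<open>The data error meets the exact inverse and the error of the inverse meets the
    computed data. The latter are bounded by \<open>\<Lambda>sd * CB + \<epsilon>1\<close>, which is
    the factor of \<open>\<delta>\<close> in the budget.\<close>
  have "U - Uh = matrix_inv G *v (\<omega>t - \<omega>h) + (matrix_inv G *v \<omega>h - matrix_inv Gh *v \<omega>h)"
    by (simp add: U_def Uh_def matrix_vector_mult_diff_distrib)
  then have "l1_norm (U - Uh) \<le> l1_norm (matrix_inv G *v (\<omega>t - \<omega>h)) + l1_norm (matrix_inv G *v \<omega>h - matrix_inv Gh *v \<omega>h)"
    by (simp only: l1_norm_add_le)
  also have "\<dots> \<le> g1 * (m * \<epsilon>1) + \<delta> * (m * (\<Lambda>sd * CB + \<epsilon>1))"
  proof (rule add_mono)
    have "l1_norm (matrix_inv G *v (\<omega>t - \<omega>h)) \<le> g1 * l1_norm (\<omega>t - \<omega>h)"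
      unfolding g1 by (rule l1_norm_le_l1_opnorm)
    also have "\<dots> \<le> g1 * (m * \<epsilon>1)"
      unfolding m by (intro mult_left_mono l1_norm_le_card \<omega>d g1_nonneg)
    finally show "l1_norm (matrix_inv G *v (\<omega>t - \<omega>h)) \<le> g1 * (m * \<epsilon>1)" .
    have "\<delta> \<ge> 0" unfolding \<delta> using small tolerances(3) m by (intro divide_nonneg_nonneg) auto
    then have "\<delta> * l1_norm \<omega>h \<le> \<delta> * (m * (\<Lambda>sd * CB + \<epsilon>1))"
      unfolding m by (intro mult_left_mono l1_norm_le_card \<omega>h_bound)
    then show "l1_norm (matrix_inv G *v \<omega>h - matrix_inv Gh *v \<omega>h) \<le> \<delta> * (m * (\<Lambda>sd * CB + \<epsilon>1))"
      using pert(2)[of \<omega>h] by linarith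
  qed
  finally have UUh: "l1_norm (U - Uh) \<le> m * g1 * \<epsilon>1 + m * (\<Lambda>sd * CB + \<epsilon>1) * \<delta>" by (simp add: algebra_simps)
  have "l1_norm U \<le> g1 * l1_norm \<omega>t"
    unfolding U_def g1 by (rule l1_norm_le_l1_opnorm)
  also have "\<dots> \<le> g1 * (m * (\<Lambda>sd * CB))"
    unfolding m by (intro mult_left_mono l1_norm_le_card \<omega>t_bound g1_nonneg)
  finally have U_bound: "l1_norm U \<le> m * g1 * \<Lambda>sd * CB" by (simp add: mult_ac)
  have \<phi>hat_le: "p (\<phi>hat j) \<le> CX + \<epsilon>2" for j
  proof -
    have "p (\<phi>hat j) \<le> p (\<lambda>y. \<phi>hat j y - \<phi> j y) + p (\<phi> j)"
      using pD(2)[OF X_diff[OF \<phi>hat(1)[of j] \<phi>X[of j]] \<phi>X[of j]] by simp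
    moreover have "p (\<phi> j) \<le> CX" unfolding CX by (intro Max_ge) auto
    ultimately show ?thesis using p_le2[of j] by linarith
  qed
  define u where "u y = u0 y + uH y" for y
  \<comment> \<open>The errors made in the representers, in the coefficients and in
    \<open>u0\<close>. Combining the exact coefficients with the representer error and the
    coefficient error with the computed representers leaves no quadratic remainder.\<close>
  define A B C where "A y = (\<Sum>i\<in>UNIV. U $ i * (\<phi>hat i y - \<phi> i y))" and "B y = (\<Sum>i\<in>UNIV. (U - Uh) $ i * \<phi>hat i y)"
    and "C y = u0hat y - u0 y" for y
  have A: "A \<in> X" "p A \<le> l1_norm U * \<epsilon>2"
    using seminorm_on_sum[OF X(1,2) finite_class.finite_UNIV, of "\<lambda>i y. \<phi>hat i y - \<phi> i y" "\<lambda>i. U $ i"]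
      seminorm_on_sum_le_l1[OF X(1,2), of "\<lambda>i y. \<phi>hat i y - \<phi> i y" \<epsilon>2 U] X_diff[OF \<phi>hat(1) \<phi>X] p_le2
    by (simp_all add: A_def[abs_def])
  have B: "B \<in> X" "p B \<le> l1_norm (U - Uh) * (CX + \<epsilon>2)"
    using seminorm_on_sum[OF X(1,2) finite_class.finite_UNIV, of \<phi>hat "\<lambda>i. (U - Uh) $ i"]
      seminorm_on_sum_le_l1[OF X(1,2), of \<phi>hat "CX + \<epsilon>2" "U - Uh"] \<phi>hat(1) \<phi>hat_le
    by (simp_all add: B_def[abs_def])
  have C: "C \<in> X" "p C \<le> \<epsilon>1" using X_diff[OF u0hat(1) u0_X(1)] p_le1 by (simp_all add: C_def[abs_def])
  have u_uhat: "u y - uhat y = (B y - A y) - C y" for y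
    by (simp add: u_def uH_def Uh A_def B_def C_def algebra_simps sum_subtractf sum.distrib)
  have BAX: "(\<lambda>y. B y - A y) \<in> X" by (rule X_diff[OF B(1) A(1)])
  have "p (\<lambda>y. u y - uhat y) \<le> p B + p A + p C"
    unfolding u_uhat using seminorm_on_diff_le[OF X(1,2) BAX C(1)] seminorm_on_diff_le[OF X(1,2) B(1) A(1)] by linarith
  also have "\<dots> \<le> (m * g1 * \<epsilon>1 + m * (\<Lambda>sd * CB + \<epsilon>1) * \<delta>) * (CX + \<epsilon>2) + m * g1 * \<Lambda>sd * CB * \<epsilon>2 + \<epsilon>1"
  proof (intro add_mono)
    \<comment> \<open>The sign follows from that of the seminorm of a computed representer, which
      lies below this number.\<close>
    have "0 \<le> CX + \<epsilon>2" using order_trans[OF pD(1)[OF \<phi>hat(1)] \<phi>hat_le] .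
    from mult_right_mono[OF UUh this] B(2)
    show "p B \<le> (m * g1 * \<epsilon>1 + m * (\<Lambda>sd * CB + \<epsilon>1) * \<delta>) * (CX + \<epsilon>2)" by linarith
    show "p A \<le> m * g1 * \<Lambda>sd * CB * \<epsilon>2"
      using A(2) mult_right_mono[OF U_bound, of \<epsilon>2] tolerances(3) by linarith
  qed (rule C(2))
  also have "\<dots> \<le> \<epsilon>" using budget by (simp add: mult.commute)
  finally have err: "p (\<lambda>y. u y - uhat y) \<le> \<epsilon>" .
  have interpolation: "u0 (x i) + uH (x i) = \<omega> $ i" for i
  proof -
    have "G *v U = \<omega>t" by (simp add: U_def matrix_vector_mul_assoc matrix_inv_mult[OF G(2)])
    then have "(G *v U) $ i = \<omega>t $ i" by simp
    then show ?thesis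
      by (simp add: matrix_vector_mult_def G(1) observation_matrix_def \<omega>t_def uH_def mult.commute)
  qed
  have in_X: "w \<in> X" if "w \<in> data_class \<Omega> F s f CB x \<omega>" for w
  proof -
    have "(\<lambda>y. w y - u0 y) \<in> X" using that model[of w s CB] X(3) by (auto simp: data_class_def)
    from XD(2)[OF this u0_X(1)] show ?thesis by simp
  qed
  have mirror: "(\<lambda>y. 2 * u y - v y) \<in> data_class \<Omega> F s f CB x \<omega>"
    using data_class_mirror[OF \<Omega> u0 u0_X(2) representers uH_def interpolation v] by (simp add: u_def)
  have radius: "ereal (p (\<lambda>y. v y - u y)) \<le> chebyshev_radius X p (data_class \<Omega> F s f CB x \<omega>)"
    by (rule symmetric_le_chebyshev_radius[OF X(1,2) v in_X[OF v] mirror in_X[OF mirror]])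
  \<comment> \<open>\<open>u\<close> is the midpoint of \<open>v\<close> and its mirror image, both
    of which lie in \<open>X\<close>.\<close>
  have uX: "u \<in> X"
  proof -
    have "(\<lambda>y. (1/2) * (v y + (2 * u y - v y))) \<in> X" by (intro XD(2,3) in_X v mirror)
    then show ?thesis by simp
  qed
  have "(\<lambda>y. u y - uhat y) \<in> X" unfolding u_uhat by (rule X_diff[OF BAX C(1)])
  from pD(2)[OF X_diff[OF in_X[OF v] uX] this] have "p (\<lambda>y. v y - uhat y) \<le> p (\<lambda>y. v y - u y) + \<epsilon>"
    using err by simp
  then have "ereal (p (\<lambda>y. v y - uhat y)) \<le> ereal (p (\<lambda>y. v y - u y)) + ereal \<epsilon>" by simp
  also have "\<dots> \<le> chebyshev_radius X p (data_class \<Omega> F s f CB x \<omega>) + ereal \<epsilon>"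
    using radius by (rule add_right_mono)
  finally show "ereal (p (\<lambda>y. v y - uhat y)) \<le> chebyshev_radius X p (data_class \<Omega> F s f CB x \<omega>) + ereal \<epsilon>" .
qed

end
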